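(* For every nonnegative integer $n$, \begin{align*} v_0(3^2(96n+68)) &\equiv 0\pmod{27},\\ v_0(3^3(96n+44)) &\equiv 0\pmod{27},\\ v_0(3^3(96n+76)) &\equiv 0\pmod{27}. \end{align*}
   Context: The integer sequence $v_0(n)$, $n\ge 0$, is defined by the generating function (formal power series in $q$) $$\sum_{n=0}^\infty v_0(n)q^n=\sum_{n=0}^\infty \frac{q^{n^2}(-q;q^2)_n}{(q;q^2)_n},$$ where $(a;q)_0=1$ and $(a;q)_n=\prod_{i=1}^n(1-aq^{i-1})$ for $n\ge1$, so that $(-q;q^2)_n=\prod_{i=1}^n(1+q^{2i-1})$ and $(q;q^2)_n=\prod_{i=1}^n(1-q^{2i-1})$. *)

theory Defs
  imports
    "HOL-Computational_Algebra.Formal_Power_Series"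
    "HOL-Number_Theory.Cong"
begin

definition qpoch :: "'a::comm_ring_1 \<Rightarrow> 'a \<Rightarrow> nat \<Rightarrow> 'a" where
  "qpoch a q n = (\<Prod>i=1..n. 1 - a * q ^ (i - 1))"

text \<open>
  The series has integer coefficients, so it is formed over the integers; there
  the class-based \<open>inverse\<close> is unavailable. As \<open>(q;q\<^sup>2)\<^sub>n\<close> has constant term 1, its
  reciprocal is \<open>fps_right_inverse _ 1\<close>, cf. \<open>qpoch_mult_inverse\<close>.
\<close>

definition v0_term :: "nat \<Rightarrow> int fps" where
  "v0_term n = fps_X ^ (n\<^sup>2) * qpoch (- fps_X) (fps_X\<^sup>2) n
     * fps_right_inverse (qpoch fps_X (fps_X\<^sup>2) n) 1"

text \<open>
  The infinite sum is taken in the topology of formal power series; it converges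
  by \<open>v0_term_sums\<close>.
\<close>

definition v0 :: "nat \<Rightarrow> int" where
  "v0 m = fps_nth (\<Sum>n. v0_term n) m"

lemma qpoch_mult_inverse:
  "qpoch fps_X (fps_X\<^sup>2) n * fps_right_inverse (qpoch fps_X (fps_X\<^sup>2) n) 1 = (1 :: int fps)"
proof -
  have "fps_nth (qpoch fps_X (fps_X\<^sup>2) n) 0 = (1 :: int)"
    by (induction n) (simp_all add: qpoch_def)
  then show ?thesis
    by (intro fps_right_inverse) simp
qed

lemma v0_term_nth_eq_0:
  assumes "m < n\<^sup>2"
  shows "fps_nth (v0_term n) m = 0"
  using assms by (simp add: v0_term_def mult.assoc fps_X_power_mult_nth)

lemma v0_term_sums: "v0_term sums Abs_fps v0"
proof -
  define S where "S = Abs_fps (\<lambda>m. \<Sum>n\<le>m. fps_nth (v0_term n) m)"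
  have "v0_term sums S"
    unfolding sums_def
  proof (rule tendsto_fpsI)
    fix m
    have "fps_nth (\<Sum>n<N. v0_term n) m = fps_nth S m" if "N > m" for N
    proof -
      have "fps_nth (v0_term n) m = 0" if "n > m" for n
        using less_le_trans[OF that le_square] by (intro v0_term_nth_eq_0) (simp only: power2_eq_square)
      then have "(\<Sum>n<N. fps_nth (v0_term n) m) = (\<Sum>n\<le>m. fps_nth (v0_term n) m)"
        using \<open>N > m\<close> by (intro sum.mono_neutral_right) auto
      then show ?thesis
        by (simp add: S_def fps_sum_nth)
    qed
    then show "eventually (\<lambda>N. fps_nth (\<Sum>n<N. v0_term n) m = fps_nth S m) sequentially"
      by (intro eventually_mono[OF eventually_gt_at_top[of m]])
  qed
  moreover have "Abs_fps v0 = (\<Sum>n. v0_term n)"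
    by (simp add: fps_eq_iff v0_def)
  ultimately show ?thesis
    by (simp add: sums_iff)
qed

end

theory Submission
  imports Defs
begin

text \<open>
  The bilateral series \<open>\<Sum> x\<^sup>n q^{n\<^sup>2} (-xq;q\<^sup>2)\<^sub>n / (xq;q\<^sup>2)\<^sub>n\<close>, multiplied by
  \<open>(xq;q\<^sup>2)\<^sub>\<infinity> (-q/x;q\<^sup>2)\<^sub>\<infinity>\<close>, is a Laurent series in \<open>x\<close> which satisfies a first order
  \<open>q\<close>-difference equation and is invariant under \<open>x \<mapsto> -1/x\<close>; hence it is a multiple of
  \<open>\<Sum> q^{2n\<^sup>2} x^{2n}\<close>. At \<open>x = 1\<close> the series is \<open>V(q) + V(-q) - 1\<close>, where \<open>V\<close> generates \<open>v\<^sub>0\<close>, and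
  so \<open>2 \<Sum> v\<^sub>0(4n) q\<^sup>n - 1 = \<phi>(q)\<^sup>2/\<phi>(-q)\<close>. Three dissections modulo 2 turn this into
  \<open>\<Sum> v\<^sub>0(32n+4) q\<^sup>n = 3 \<psi>(q) + 512 q \<psi>(q)\<^sup>9/\<phi>(-q)\<^sup>8\<close>.

  With \<open>u = (-q;q)\<^sub>\<infinity>\<close> we have \<open>\<psi>(q) = u\<^sup>3 \<phi>(-q)\<close>, so the quotient is \<open>u^{27} \<phi>(-q)\<close>, which is
  congruent to \<open>u(q\<^sup>3)\<^sup>9 \<phi>(-q)\<close> modulo 27. Two dissections modulo 3 then show that the coefficients of
  \<open>q^{9n}\<close> in it are generated modulo 27 by \<open>\<psi>(q) + 9 q \<psi>(q\<^sup>9)\<close>. Consequently 27 divides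
  \<open>v\<^sub>0(36(8n+1))\<close> unless \<open>8n+1\<close> is a square.
\<close>

section \<open>Infinite sums of formal power series\<close>

text \<open>The terms of negative index of the bilateral series are those of positive index with x
  replaced by -1/x, and at x = -1 the series is V(-q); this is why V(-q) appears. The difference
  equation determines the Laurent series only up to its constant term (-q^2;q^4)_infinity, which
  takes a separate argument: a telescoping sum and Gauss's alternating sum of q-binomials. No series
  in x is ever formed: coefficients of x^j are sums along diagonals of double series, which is why
  sums over arbitrary index types come first. Modulo 27 the difficulty is u^9, which is not
  congruent there to a series in q^3. Its section is the cube of the section of u^3, and that one is
  found exactly, up to a denominator, from the 3-dissection of psi(q) = u^3 phi(-q). The denominator
  cancels because it is congruent to psi modulo 3 and remains only in a term with the factor 9.
  Finally 36(8n+1) = 32(9n+1) + 4, and the exponents of psi are the n with 8n+1 a square.\<close>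

definition fsummable :: "('i \<Rightarrow> 'a::comm_ring_1 fps) \<Rightarrow> bool" where
  "fsummable f \<longleftrightarrow> (\<forall>m. finite {i. fps_nth (f i) m \<noteq> 0})"

text \<open>Each coefficient is summed over its own support, so the index may be a natural number,
  an integer or a pair, and rearrangement is a matter of bijections. A coefficient with infinite
  support gets the default value 0.\<close>

definition fsum :: "('i \<Rightarrow> 'a::comm_ring_1 fps) \<Rightarrow> 'a fps" where
  "fsum f = Abs_fps (\<lambda>m. \<Sum>i | fps_nth (f i) m \<noteq> 0. fps_nth (f i) m)"

lemma fsum_nth:
  assumes "finite S" "\<And>i. fps_nth (f i) m \<noteq> 0 \<Longrightarrow> i \<in> S"
  shows "fps_nth (fsum f) m = (\<Sum>i\<in>S. fps_nth (f i) m)"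
  unfolding fsum_def using assms by (auto intro!: sum.mono_neutral_left)

lemma fsummableD: "fsummable f \<Longrightarrow> finite {i. fps_nth (f i) m \<noteq> 0}"
  by (simp add: fsummable_def)

lemma fsummable_X_power:
  assumes "\<And>m. finite {i. d i \<le> m}" "\<And>i. fps_X ^ d i dvd f i"
  shows "fsummable f"
  unfolding fsummable_def
proof
  fix m
  have "fps_nth (f i) m = 0" if "m < d i" for i
  proof -
    obtain h where "f i = fps_X ^ d i * h" using assms(2) by blast
    then show ?thesis using that by (simp add: fps_X_power_mult_nth)
  qed
  then have "{i. fps_nth (f i) m \<noteq> 0} \<subseteq> {i. d i \<le> m}"
    using leI by blast
  then show "finite {i. fps_nth (f i) m \<noteq> 0}"
    using assms(1) finite_subset by blast
qed

lemma fsummable_nat: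
  assumes "\<And>i::nat. fps_X ^ i dvd f i"
  shows "fsummable f"
  using fsummable_X_power[of "\<lambda>i. i" f] assms by (simp add: atMost_def[symmetric])

lemma fsummable_add:
  assumes "fsummable f" "fsummable g"
  shows "fsummable (\<lambda>i. f i + g i)"
  unfolding fsummable_def
proof
  fix m
  have "{i. fps_nth (f i + g i) m \<noteq> 0} \<subseteq> {i. fps_nth (f i) m \<noteq> 0} \<union> {i. fps_nth (g i) m \<noteq> 0}"
    by auto
  then show "finite {i. fps_nth (f i + g i) m \<noteq> 0}"
    using assms by (auto dest: fsummableD intro: finite_subset)
qed

lemma fsum_add:
  assumes "fsummable f" "fsummable g"
  shows "fsum (\<lambda>i. f i + g i) = fsum f + fsum g"
proof (rule fps_ext)
  fix m
  let ?S = "{i. fps_nth (f i) m \<noteq> 0} \<union> {i. fps_nth (g i) m \<noteq> 0}"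
  have fin: "finite ?S" using assms by (auto dest: fsummableD)
  have "fps_nth (fsum (\<lambda>i. f i + g i)) m = (\<Sum>i\<in>?S. fps_nth (f i + g i) m)"
    by (rule fsum_nth) (use fin in auto)
  moreover have "fps_nth (fsum f) m = (\<Sum>i\<in>?S. fps_nth (f i) m)"
    by (rule fsum_nth) (use fin in auto)
  moreover have "fps_nth (fsum g) m = (\<Sum>i\<in>?S. fps_nth (g i) m)"
    by (rule fsum_nth) (use fin in auto)
  ultimately show "fps_nth (fsum (\<lambda>i. f i + g i)) m = fps_nth (fsum f + fsum g) m"
    by (simp add: sum.distrib)
qed

lemma fsummable_cmult:
  assumes "fsummable f"
  shows "fsummable (\<lambda>i. c * f i)"
  unfolding fsummable_def
proof
  fix m
  have "i \<in> (\<Union>k\<le>m. {i. fps_nth (f i) k \<noteq> 0})" if "fps_nth (c * f i) m \<noteq> 0" for i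
  proof (rule ccontr)
    assume "i \<notin> (\<Union>k\<le>m. {i. fps_nth (f i) k \<noteq> 0})"
    then have "fps_nth (f i) (m - k) = 0" for k by auto
    then show False using that by (simp add: fps_mult_nth)
  qed
  then have "{i. fps_nth (c * f i) m \<noteq> 0} \<subseteq> (\<Union>k\<le>m. {i. fps_nth (f i) k \<noteq> 0})"
    by blast
  then show "finite {i. fps_nth (c * f i) m \<noteq> 0}"
    by (rule finite_subset) (use assms in \<open>auto dest: fsummableD\<close>)
qed

lemma fsum_cmult:
  assumes "fsummable f"
  shows "fsum (\<lambda>i. c * f i) = c * fsum f"
proof (rule fps_ext)
  fix m
  let ?S = "(\<Union>k\<le>m. {i. fps_nth (f i) k \<noteq> 0}) \<union> {i. fps_nth (c * f i) m \<noteq> 0}"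
  have fin: "finite ?S"
    using assms fsummable_cmult[OF assms, of c] by (auto dest: fsummableD)
  have eq: "fps_nth (fsum f) k = (\<Sum>i\<in>?S. fps_nth (f i) k)" if "k \<le> m" for k
    by (rule fsum_nth) (use fin that in auto)
  have "fps_nth (fsum (\<lambda>i. c * f i)) m = (\<Sum>i\<in>?S. fps_nth (c * f i) m)"
    by (rule fsum_nth) (use fin in auto)
  also have "\<dots> = (\<Sum>i\<in>?S. \<Sum>k=0..m. fps_nth c k * fps_nth (f i) (m - k))"
    by (simp add: fps_mult_nth)
  also have "\<dots> = (\<Sum>k=0..m. \<Sum>i\<in>?S. fps_nth c k * fps_nth (f i) (m - k))"
    by (rule sum.swap)
  also have "\<dots> = (\<Sum>k=0..m. fps_nth c k * fps_nth (fsum f) (m - k))"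
    by (intro sum.cong refl) (simp add: eq sum_distrib_left)
  finally show "fps_nth (fsum (\<lambda>i. c * f i)) m = fps_nth (c * fsum f) m"
    by (simp add: fps_mult_nth)
qed

lemma fsum_diff:
  assumes "fsummable f" "fsummable g"
  shows "fsum (\<lambda>i. f i - g i) = fsum f - fsum g"
  using fsum_add[OF assms(1) fsummable_cmult[OF assms(2), of "-1"]] fsum_cmult[OF assms(2), of "-1"]
  by simp

lemma fsummable_inj:
  assumes "fsummable f" "inj g"
  shows "fsummable (\<lambda>i. f (g i))"
  unfolding fsummable_def
proof
  fix m
  have "{i. fps_nth (f (g i)) m \<noteq> 0} = g -` {i. fps_nth (f i) m \<noteq> 0}" by auto
  then show "finite {i. fps_nth (f (g i)) m \<noteq> 0}"
    using finite_vimageI[OF fsummableD[OF assms(1)] assms(2)] by simp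
qed

lemma fsum_split:
  assumes f: "fsummable f" and inj: "inj g" "inj h"
    and cover: "range g \<inter> range h = {}" "range g \<union> range h = UNIV"
  shows "fsum f = fsum (\<lambda>i. f (g i)) + fsum (\<lambda>j. f (h j))"
proof (rule fps_ext)
  fix m
  let ?S = "{i. fps_nth (f i) m \<noteq> 0}"
  have fin: "finite ?S" using f by (rule fsummableD)
  have S: "?S = g ` (g -` ?S) \<union> h ` (h -` ?S)" using cover(2) by auto
  have fin': "finite (g -` ?S)" "finite (h -` ?S)" 
    using finite_vimageI[OF fin inj(1)] finite_vimageI[OF fin inj(2)] by auto
  have "fps_nth (fsum f) m = (\<Sum>i\<in>?S. fps_nth (f i) m)"
    by (rule fsum_nth) (use fin in auto)
  also have "\<dots> = (\<Sum>i\<in>g ` (g -` ?S) \<union> h ` (h -` ?S). fps_nth (f i) m)"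
    by (rule sum.cong[OF S refl])
  also have "\<dots> = (\<Sum>i\<in>g ` (g -` ?S). fps_nth (f i) m) + (\<Sum>i\<in>h ` (h -` ?S). fps_nth (f i) m)"
    by (rule sum.union_disjoint) (use fin' cover(1) in auto)
  also have "(\<Sum>i\<in>g ` (g -` ?S). fps_nth (f i) m) = (\<Sum>i\<in>g -` ?S. fps_nth (f (g i)) m)"
    by (subst sum.reindex) (use inj in \<open>auto simp: inj_def inj_on_def\<close>)
  also have "\<dots> = fps_nth (fsum (\<lambda>i. f (g i))) m"
    by (rule fsum_nth[symmetric]) (use fin' in auto)
  also have "(\<Sum>i\<in>h ` (h -` ?S). fps_nth (f i) m) = (\<Sum>i\<in>h -` ?S. fps_nth (f (h i)) m)"
    by (subst sum.reindex) (use inj in \<open>auto simp: inj_def inj_on_def\<close>)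
  also have "\<dots> = fps_nth (fsum (\<lambda>i. f (h i))) m"
    by (rule fsum_nth[symmetric]) (use fin' in auto)
  finally show "fps_nth (fsum f) m = fps_nth (fsum (\<lambda>i. f (g i)) + fsum (\<lambda>j. f (h j))) m"
    by simp
qed

lemma fsum_reindex:
  assumes "bij g"
  shows "fsum (\<lambda>i. f (g i)) = fsum f"
proof (rule fps_ext)
  fix m
  have "bij_betw g {i. fps_nth (f (g i)) m \<noteq> 0} {i. fps_nth (f i) m \<noteq> 0}"
    unfolding bij_betw_def using assms
    by (auto simp: bij_def inj_on_def image_iff surj_def)
  then show "fps_nth (fsum (\<lambda>i. f (g i))) m = fps_nth (fsum f) m"
    unfolding fsum_def fps_nth_Abs_fps by (rule sum.reindex_bij_betw)
qed

lemma fsum_Suc: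
  assumes "fsummable f"
  shows "fsum f = f 0 + fsum (\<lambda>k. f (Suc k))"
proof (rule fps_ext)
  fix m
  let ?S = "{i. fps_nth (f i) m \<noteq> 0}"
  let ?T = "{k. fps_nth (f (Suc k)) m \<noteq> 0}"
  have fin: "finite ?S" "finite ?T"
    using assms fsummable_inj[OF assms, of Suc] by (auto dest: fsummableD)
  have "fps_nth (fsum f) m = (\<Sum>i\<in>insert 0 (Suc ` ?T). fps_nth (f i) m)"
  proof (rule fsum_nth)
    show "i \<in> insert 0 (Suc ` ?T)" if "fps_nth (f i) m \<noteq> 0" for i
      using that by (cases i) auto
  qed (use fin in auto)
  also have "\<dots> = fps_nth (f 0) m + (\<Sum>k\<in>?T. fps_nth (f (Suc k)) m)"
    using fin by (subst sum.insert) (auto simp: sum.reindex)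
  also have "(\<Sum>k\<in>?T. fps_nth (f (Suc k)) m) = fps_nth (fsum (\<lambda>k. f (Suc k))) m"
    by (rule fsum_nth[symmetric]) (use fin in auto)
  finally show "fps_nth (fsum f) m = fps_nth (f 0 + fsum (\<lambda>k. f (Suc k))) m"
    by simp
qed

lemma fsummable_fsum_slice:
  assumes "fsummable f"
  shows "fsummable (\<lambda>i. fsum (\<lambda>j. f (i, j)))"
  unfolding fsummable_def
proof
  fix m
  have "i \<in> fst ` {p. fps_nth (f p) m \<noteq> 0}" if "fps_nth (fsum (\<lambda>j. f (i, j))) m \<noteq> 0" for i
  proof -
    have "\<exists>j. fps_nth (f (i, j)) m \<noteq> 0"
    proof (rule ccontr)
      assume "\<nexists>j. fps_nth (f (i, j)) m \<noteq> 0"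
      then show False using that fsum_nth[of "{}" "\<lambda>j. f (i, j)" m] by auto
    qed
    then show ?thesis by (force simp: image_iff)
  qed
  then have "{i. fps_nth (fsum (\<lambda>j. f (i, j))) m \<noteq> 0} \<subseteq> fst ` {p. fps_nth (f p) m \<noteq> 0}"
    by blast
  then show "finite {i. fps_nth (fsum (\<lambda>j. f (i, j))) m \<noteq> 0}"
    by (rule finite_subset) (use assms in \<open>auto dest: fsummableD\<close>)
qed

lemma fsum_pair:
  assumes "fsummable f"
  shows "fsum f = fsum (\<lambda>i. fsum (\<lambda>j. f (i, j)))"
proof (rule fps_ext)
  fix m
  let ?S = "{p. fps_nth (f p) m \<noteq> 0}"
  have fin: "finite ?S" using assms by (rule fsummableD)
  have "fps_nth (fsum f) m = (\<Sum>p\<in>fst ` ?S \<times> snd ` ?S. fps_nth (f p) m)"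
  proof (rule fsum_nth)
    show "p \<in> fst ` ?S \<times> snd ` ?S" if "fps_nth (f p) m \<noteq> 0" for p
      using that by (simp add: mem_Times_iff)
  qed (use fin in auto)
  also have "\<dots> = (\<Sum>i\<in>fst ` ?S. \<Sum>j\<in>snd ` ?S. fps_nth (f (i, j)) m)"
    by (simp add: sum.cartesian_product)
  also have "\<dots> = (\<Sum>i\<in>fst ` ?S. fps_nth (fsum (\<lambda>j. f (i, j))) m)"
  proof (intro sum.cong refl fsum_nth[symmetric])
    show "j \<in> snd ` ?S" if "fps_nth (f (i, j)) m \<noteq> 0" for i j
      using that by (force simp: image_iff)
  qed (use fin in auto)
  also have "\<dots> = fps_nth (fsum (\<lambda>i. fsum (\<lambda>j. f (i, j)))) m"
  proof (rule fsum_nth[symmetric])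
    fix i assume *: "fps_nth (fsum (\<lambda>j. f (i, j))) m \<noteq> 0"
    have "\<exists>j. fps_nth (f (i, j)) m \<noteq> 0"
      using * fsum_nth[of "{}" "\<lambda>j. f (i, j)" m] by fastforce
    then show "i \<in> fst ` ?S" by (force simp: image_iff)
  qed (use fin in auto)
  finally show "fps_nth (fsum f) m = fps_nth (fsum (\<lambda>i. fsum (\<lambda>j. f (i, j)))) m" .
qed

lemma fsummable_prod:
  assumes "fsummable f" "fsummable g"
  shows "fsummable (\<lambda>(i, j). f i * g j)"
  unfolding fsummable_def
proof
  fix m
  let ?F = "\<Union>k\<le>m. {i. fps_nth (f i) k \<noteq> 0}" and ?G = "\<Union>k\<le>m. {i. fps_nth (g i) k \<noteq> 0}"
  have "(i, j) \<in> ?F \<times> ?G" if "fps_nth (f i * g j) m \<noteq> 0" for i j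
  proof -
    from that obtain k where "k \<le> m" "fps_nth (f i) k * fps_nth (g j) (m - k) \<noteq> 0"
      unfolding fps_mult_nth by (metis (no_types, lifting) atLeastAtMost_iff sum.neutral)
    then have "fps_nth (f i) k \<noteq> 0" "fps_nth (g j) (m - k) \<noteq> 0" by auto
    with \<open>k \<le> m\<close> have "i \<in> ?F" "j \<in> ?G"
      by (auto intro: bexI[of _ k] bexI[of _ "m - k"])
    then show ?thesis by simp
  qed
  then have "{p. fps_nth (case p of (i, j) \<Rightarrow> f i * g j) m \<noteq> 0} \<subseteq> ?F \<times> ?G"
    by auto
  then show "finite {p. fps_nth (case p of (i, j) \<Rightarrow> f i * g j) m \<noteq> 0}"
    by (rule finite_subset) (use assms in \<open>auto dest: fsummableD\<close>)
qed

lemma fsum_prod: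
  assumes "fsummable f" "fsummable g"
  shows "fsum f * fsum g = fsum (\<lambda>(i, j). f i * g j)"
proof -
  have "fsum (\<lambda>(i, j). f i * g j) = fsum (\<lambda>i. fsum (\<lambda>j. f i * g j))"
    using fsum_pair[OF fsummable_prod[OF assms]] by simp
  also have "\<dots> = fsum (\<lambda>i. fsum g * f i)"
    by (simp add: fsum_cmult[OF assms(2)] mult.commute)
  also have "\<dots> = fsum f * fsum g"
    by (simp add: fsum_cmult[OF assms(1)] mult.commute)
  finally show ?thesis ..
qed

text \<open>This is how products of Laurent series are multiplied out at x = 1: if the factors are
  the sums of f_k x^-k and of g_l x^l, the diagonal l - k = j collects the coefficient of
  x^j.\<close>

lemma fsum_diagonals:
  fixes f :: "nat \<times> nat \<Rightarrow> 'a::comm_ring_1 fps"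
  assumes "fsummable f"
  shows "fsum f = fsum (\<lambda>j. fsum (\<lambda>k. f (k, k + j))) + fsum (\<lambda>j. fsum (\<lambda>k. f (k + Suc j, k)))"
proof -
  define g where "g = (\<lambda>(j, k). (k, k + j) :: nat \<times> nat)"
  define h where "h = (\<lambda>(j, k). (k + Suc j, k) :: nat \<times> nat)"
  have inj: "inj g" "inj h" by (auto simp: inj_def g_def h_def)
  have "p \<in> range g \<union> range h" for p
  proof (cases "fst p \<le> snd p")
    case True
    then have "p = g (snd p - fst p, fst p)" by (simp add: g_def prod_eq_iff)
    then show ?thesis by blast
  next
    case False
    then have "p = h (fst p - snd p - 1, snd p)" by (simp add: h_def prod_eq_iff)
    then show ?thesis by blast
  qed
  then have "fsum f = fsum (\<lambda>i. f (g i)) + fsum (\<lambda>j. f (h j))"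
    by (intro fsum_split assms inj) (auto simp: g_def h_def)
  also have "fsum (\<lambda>i. f (g i)) = fsum (\<lambda>j. fsum (\<lambda>k. f (k, k + j)))"
    by (subst fsum_pair[OF fsummable_inj[OF assms inj(1)]]) (simp add: g_def)
  also have "fsum (\<lambda>i. f (h i)) = fsum (\<lambda>j. fsum (\<lambda>k. f (k + Suc j, k)))"
    by (subst fsum_pair[OF fsummable_inj[OF assms inj(2)]]) (simp add: h_def)
  finally show ?thesis .
qed

lemma fsummable_fsum_diagonal:
  fixes f :: "nat \<times> nat \<Rightarrow> 'a::comm_ring_1 fps"
  assumes "fsummable f"
  shows "fsummable (\<lambda>j. fsum (\<lambda>k. f (k, k + j)))"
  using fsummable_fsum_slice[OF fsummable_inj[OF assms, of "\<lambda>(j, k). (k, k + j)"]]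
  by (auto simp: inj_def)

lemma fsum_dvd:
  assumes "\<And>i. fps_X ^ m dvd f i"
  shows "fps_X ^ m dvd fsum f"
proof -
  have zero: "fps_nth (f i) k = 0" if "k < m" for i k
    using assms[of i] that by (auto simp: fps_X_power_mult_nth elim!: dvdE)
  have "fps_nth (fsum f) k = 0" if "k < m" for k
    using fsum_nth[of "{}" f k] zero[OF that] by auto
  then have "fsum f = fps_X ^ m * fps_shift m (fsum f)"
    by (intro fps_ext) (simp add: fps_X_power_mult_nth)
  then show ?thesis by (rule dvdI)
qed

lemma fps_X_power_dvd_all_zero:
  assumes "\<And>m. fps_X ^ m dvd (f :: 'a::comm_ring_1 fps)"
  shows "f = 0"
proof (rule fps_ext)
  fix k
  show "fps_nth f k = fps_nth 0 k"
    using assms[of "Suc k"] by (auto simp: fps_X_power_mult_nth simp del: power_Suc elim!: dvdE)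
qed

section \<open>Infinite products and the Jacobi triple product\<close>

definition qfac :: "nat \<Rightarrow> nat \<Rightarrow> int fps" where
  "qfac L k = (\<Prod>i=1..k. 1 - fps_X ^ (L * i))"

definition iqfac :: "nat \<Rightarrow> nat \<Rightarrow> int fps" where
  "iqfac L k = fps_right_inverse (qfac L k) 1"

lemma qfac_Suc: "qfac L (Suc k) = qfac L k * (1 - fps_X ^ (L * Suc k))"
  by (simp add: qfac_def)

lemma qfac_iqfac: "L > 0 \<Longrightarrow> qfac L k * iqfac L k = 1"
proof -
  assume "L > 0"
  then have "fps_nth (qfac L k) 0 = 1"
    by (induction k) (simp_all add: qfac_def)
  then show ?thesis
    unfolding iqfac_def by (intro fps_right_inverse) simp
qed

lemma iqfac_0 [simp]: "L > 0 \<Longrightarrow> iqfac L 0 = 1"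
  using qfac_iqfac[of L 0] by (simp add: qfac_def)

lemma iqfac_Suc: "L > 0 \<Longrightarrow> (1 - fps_X ^ (L * Suc k)) * iqfac L (Suc k) = iqfac L k"
proof -
  assume L: "L > 0"
  have "iqfac L k = iqfac L k * (qfac L (Suc k) * iqfac L (Suc k))"
    using qfac_iqfac[OF L, of "Suc k"] by simp
  also have "\<dots> = (qfac L k * iqfac L k) * ((1 - fps_X ^ (L * Suc k)) * iqfac L (Suc k))"
    by (simp only: qfac_Suc mult_ac)
  finally show ?thesis using qfac_iqfac[OF L, of k] by simp
qed

text \<open>Summand of Euler's expansion of an infinite product. With the expansion as definition,
  limits of finite products enter only through \<open>infinite_product_unique\<close>.\<close>

definition eterm :: "int fps \<Rightarrow> nat \<Rightarrow> nat \<Rightarrow> nat \<Rightarrow> int fps" where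
  "eterm e a L k = e ^ k * fps_X ^ (a * k + L * (k choose 2)) * iqfac L k"

lemma choose2_Suc: "Suc k choose 2 = (k choose 2) + k"
  by (simp add: numeral_2_eq_2)

lemma choose2_add: "(m + n) choose 2 = (m choose 2) + (n choose 2) + m * n"
  by (induction n) (simp_all add: choose2_Suc)

lemma eterm_0 [simp]: "L > 0 \<Longrightarrow> eterm e a L 0 = 1"
  by (simp add: eterm_def numeral_2_eq_2)

lemma eterm_Suc:
  assumes "L > 0"
  shows "(1 - fps_X ^ (L * Suc k)) * eterm e a L (Suc k) = e * fps_X ^ (a + L * k) * eterm e a L k"
proof -
  have "fps_X ^ (a * Suc k + L * (Suc k choose 2)) =
      fps_X ^ (a + L * k) * (fps_X ^ (a * k + L * (k choose 2)) :: int fps)"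
    by (simp add: choose2_Suc power_add[symmetric] algebra_simps)
  then show ?thesis
    unfolding eterm_def iqfac_Suc[OF assms, of k, symmetric] by (simp add: mult_ac)
qed

lemma eterm_dvd: "fps_X ^ (a * k + L * (k choose 2)) dvd eterm e a L k"
  unfolding eterm_def by (intro dvd_mult2 dvd_mult) simp

lemma fsummable_eterm:
  assumes "a > 0"
  shows "fsummable (eterm e a L)"
proof (rule fsummable_nat)
  fix k
  have "(fps_X :: int fps) ^ k dvd fps_X ^ (a * k + L * (k choose 2))"
    using assms by (intro le_imp_power_dvd) (simp add: trans_le_add1)
  then show "fps_X ^ k dvd eterm e a L k" using eterm_dvd dvd_trans by blast
qed

lemma eterm_shift: "eterm e (a + L) L k = fps_X ^ (L * k) * eterm e a L k"
  by (simp add: eterm_def power_add algebra_simps)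

text \<open>By Euler's expansion this is the infinite product \<open>(- e q^a; q^L)\<^sub>\<infinity>\<close>.\<close>

definition qprod :: "int fps \<Rightarrow> nat \<Rightarrow> nat \<Rightarrow> int fps" where
  "qprod e a L = fsum (eterm e a L)"

text \<open>Subtracting the two series multiplies the k-th term by 1 - q^(L k). This kills k = 0 and
  cancels the last denominator factor of the others, so that an index shift gives back the series at
  a + L.\<close>

lemma qprod_rec:
  assumes "a > 0" "L > 0"
  shows "qprod e a L = (1 + e * fps_X ^ a) * qprod e (a + L) L"
proof -
  have sm: "fsummable (eterm e a L)" "fsummable (eterm e (a + L) L)"
    using assms by (simp_all add: fsummable_eterm)
  have diff: "eterm e a L k - eterm e (a + L) L k = (1 - fps_X ^ (L * k)) * eterm e a L k" for k
    unfolding eterm_shift by (simp add: algebra_simps)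
  have "qprod e a L - qprod e (a + L) L = fsum (\<lambda>k. eterm e a L k - eterm e (a + L) L k)"
    unfolding qprod_def using sm by (simp add: fsum_diff)
  also have "\<dots> = fsum (\<lambda>k. (1 - fps_X ^ (L * k)) * eterm e a L k)"
    by (simp only: diff)
  also have "\<dots> = fsum (\<lambda>k. (1 - fps_X ^ (L * Suc k)) * eterm e a L (Suc k))"
  proof (subst fsum_Suc)
    show "fsummable (\<lambda>k. (1 - fps_X ^ (L * k)) * eterm e a L k)"
      using fsummable_add[OF sm(1) fsummable_cmult[OF sm(2), of "-1"]]
      by (simp add: diff)
  qed simp
  also have "\<dots> = fsum (\<lambda>k. (e * fps_X ^ a) * eterm e (a + L) L k)"
    unfolding eterm_Suc[OF assms(2)] eterm_shift by (simp add: power_add mult_ac)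
  also have "\<dots> = (e * fps_X ^ a) * qprod e (a + L) L"
    unfolding qprod_def by (rule fsum_cmult[OF sm(2)])
  finally show ?thesis by (simp add: algebra_simps)
qed

lemma qprod_cong_1:
  assumes "a > 0" "L > 0"
  shows "fps_X ^ a dvd qprod e a L - 1"
proof -
  have "qprod e a L - 1 = fsum (\<lambda>k. eterm e a L (Suc k))"
    unfolding qprod_def using assms by (subst fsum_Suc) (simp_all add: fsummable_eterm)
  moreover have "fps_X ^ a dvd eterm e a L (Suc k)" for k
  proof -
    have "(fps_X :: int fps) ^ a dvd fps_X ^ (a * Suc k + L * (Suc k choose 2))"
      by (intro le_imp_power_dvd) simp
    then show ?thesis using eterm_dvd dvd_trans by blast
  qed
  ultimately show ?thesis by (simp add: fsum_dvd)
qed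

text \<open>Stands in for the convergence of infinite products: n steps of the recurrence leave a
  difference divisible by X^n, for every n.\<close>

lemma infinite_product_unique:
  fixes G H :: "nat \<Rightarrow> 'a::comm_ring_1 fps"
  assumes "\<And>n. G n = c n * G (Suc n)" "\<And>n. H n = c n * H (Suc n)"
    and "\<And>n. fps_X ^ n dvd G n - 1" "\<And>n. fps_X ^ n dvd H n - 1"
  shows "G 0 = H 0"
proof -
  have "G 0 - H 0 = (\<Prod>k<n. c k) * (G n - H n)" for n
  proof (induction n)
    case (Suc n)
    have "G n - H n = c n * (G (Suc n) - H (Suc n))"
      using assms(1)[of n] assms(2)[of n] by (simp add: algebra_simps)
    with Suc show ?case by (simp add: mult_ac)
  qed simp
  moreover have "fps_X ^ n dvd G n - H n" for n
    using dvd_diff[OF assms(3)[of n] assms(4)[of n]] by simp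
  ultimately have "fps_X ^ n dvd G 0 - H 0" for n by (metis dvd_mult)
  then show ?thesis using fps_X_power_dvd_all_zero[of "G 0 - H 0"] by simp
qed

lemma dvd_mult_minus_1:
  fixes x y d :: "'a::comm_ring_1"
  assumes "d dvd x - 1" "d dvd y - 1"
  shows "d dvd x * y - 1"
proof -
  have eq: "x * y - 1 = x * (y - 1) + (x - 1)" by (simp add: algebra_simps)
  show ?thesis unfolding eq using assms by (intro dvd_add dvd_mult)
qed

lemma qprod_index_rec:
  assumes "a > 0" "L > 0"
  shows "qprod e (a + n * L) L = (1 + e * fps_X ^ (a + n * L)) * qprod e (a + Suc n * L) L"
  using qprod_rec[of "a + n * L" L e] assms by (simp add: add_ac)

lemma qprod_cong_1_weak:
  assumes "a > 0" "L > 0" "n \<le> a"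
  shows "fps_X ^ n dvd qprod e a L - 1"
  using qprod_cong_1[OF assms(1,2), of e] le_imp_power_dvd[OF assms(3), of "fps_X :: int fps"]
  by (rule dvd_trans[rotated])

lemma le_index: "L > 0 \<Longrightarrow> (n::nat) \<le> a + n * L"
  by (simp add: trans_le_add2)

text \<open>The factors are sorted by the parity of their index. From \<open>H n\<close> to
  \<open>H (Suc n)\<close> the second factor becomes the first, and the first, advanced by 2L,
  becomes the second; so a single recurrence factor is split off per step.\<close>

lemma qprod_split2:
  assumes "a > 0" "L > 0"
  shows "qprod e a L = qprod e a (2 * L) * qprod e (a + L) (2 * L)"
proof -
  define H where "H = (\<lambda>n. qprod e (a + n * L) (2 * L) * qprod e (a + L + n * L) (2 * L))"
  have "qprod e (a + 0 * L) L = H 0"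
  proof (rule infinite_product_unique[where G = "\<lambda>n. qprod e (a + n * L) L" and
        c = "\<lambda>n. 1 + e * fps_X ^ (a + n * L)"])
    show "qprod e (a + n * L) L = (1 + e * fps_X ^ (a + n * L)) * qprod e (a + Suc n * L) L" for n
      by (rule qprod_index_rec[OF assms])
    show "H n = (1 + e * fps_X ^ (a + n * L)) * H (Suc n)" for n
      unfolding H_def using qprod_rec[of "a + n * L" "2 * L" e] assms by (simp add: mult_ac add_ac mult_2 mult_2_right)
    show "fps_X ^ n dvd qprod e (a + n * L) L - 1" for n
      using assms by (intro qprod_cong_1_weak) (auto simp: le_index)
    show "fps_X ^ n dvd H n - 1" for n
      unfolding H_def using assms
      by (intro dvd_mult_minus_1 qprod_cong_1_weak) (auto simp: le_index)
  qed
  then show ?thesis by (simp add: H_def)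
qed

lemma qprod_split3:
  assumes "a > 0" "L > 0"
  shows "qprod e a L =
    qprod e a (3 * L) * qprod e (a + L) (3 * L) * qprod e (a + 2 * L) (3 * L)"
proof -
  define H where "H = (\<lambda>n. qprod e (a + n * L) (3 * L) * qprod e (a + L + n * L) (3 * L)
    * qprod e (a + 2 * L + n * L) (3 * L))"
  have "qprod e (a + 0 * L) L = H 0"
  proof (rule infinite_product_unique[where G = "\<lambda>n. qprod e (a + n * L) L" and
        c = "\<lambda>n. 1 + e * fps_X ^ (a + n * L)"])
    show "qprod e (a + n * L) L = (1 + e * fps_X ^ (a + n * L)) * qprod e (a + Suc n * L) L" for n
      by (rule qprod_index_rec[OF assms])
    show "H n = (1 + e * fps_X ^ (a + n * L)) * H (Suc n)" for n
      unfolding H_def using qprod_rec[of "a + n * L" "3 * L" e] assms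
      by (simp add: mult_ac add_ac numeral_3_eq_3 mult_2_right)
    show "fps_X ^ n dvd qprod e (a + n * L) L - 1" for n
      using assms by (intro qprod_cong_1_weak) (auto simp: le_index)
    show "fps_X ^ n dvd H n - 1" for n
      unfolding H_def using assms
      by (intro dvd_mult_minus_1 qprod_cong_1_weak) (auto simp: le_index)
  qed
  then show ?thesis by (simp add: H_def)
qed

lemma qprod_plus_minus:
  assumes "a > 0" "L > 0"
  shows "qprod 1 a L * qprod (-1) a L = qprod (-1) (2 * a) (2 * L)"
proof -
  define H where "H = (\<lambda>n. qprod 1 (a + n * L) L * qprod (-1) (a + n * L) L)"
  define G where "G = (\<lambda>n. qprod (-1) (2 * a + n * (2 * L)) (2 * L))"
  have "H 0 = G 0"
  proof (rule infinite_product_unique[where c = "\<lambda>n. 1 - fps_X ^ (2 * a + n * (2 * L))"])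
    show "H n = (1 - fps_X ^ (2 * a + n * (2 * L))) * H (Suc n)" for n
    proof -
      have "1 - fps_X ^ (2 * a + n * (2 * L)) =
          (1 + fps_X ^ (a + n * L)) * (1 - fps_X ^ (a + n * L) :: int fps)"
        by (simp add: algebra_simps power_add[symmetric] mult_2)
      then show ?thesis
        unfolding H_def using qprod_index_rec[OF assms, of 1 n] qprod_index_rec[OF assms, of "-1" n]
        by (simp only: mult_ac mult_1 mult_minus_left) (simp add: mult_ac)
    qed
    show "G n = (1 - fps_X ^ (2 * a + n * (2 * L))) * G (Suc n)" for n
      unfolding G_def using qprod_index_rec[of "2 * a" "2 * L" "-1" n] assms by simp
    show "fps_X ^ n dvd H n - 1" for n
      unfolding H_def using assms
      by (intro dvd_mult_minus_1 qprod_cong_1_weak) (auto simp: le_index)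
    show "fps_X ^ n dvd G n - 1" for n
      unfolding G_def using assms
      by (intro qprod_cong_1_weak) (auto simp: le_index)
  qed
  then show ?thesis by (simp add: G_def H_def)
qed

section \<open>The triple product, coefficient by coefficient\<close>

lemma qprod_qfac:
  assumes "L > 0"
  shows "qprod (-1) L L = qfac L n * qprod (-1) (L + n * L) L"
proof (induction n)
  case 0
  show ?case by (simp add: qfac_def)
next
  case (Suc n)
  have rec: "qprod (-1) (L + n * L) L = (1 - fps_X ^ (L * Suc n)) * qprod (-1) (L + Suc n * L) L"
    using qprod_index_rec[OF assms assms, of "-1" n] by (simp add: mult.commute)
  show ?case
    by (simp only: Suc[unfolded rec] qfac_Suc mult.assoc)
qed

text \<open>The coefficient of x^n in (-e q^b x;q^L)_infinity (-e q^a/x;q^L)_infinity with L = a +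
  b; exchanging a and b gives that of x^-n.\<close>

definition dterm :: "int fps \<Rightarrow> nat \<Rightarrow> nat \<Rightarrow> nat \<Rightarrow> int fps" where
  "dterm e a b n = fsum (\<lambda>k. eterm e a (a + b) k * eterm e b (a + b) (k + n))"

lemma fsummable_eterm_prod:
  assumes "a > 0" "b > 0"
  shows "fsummable (\<lambda>(k, l). eterm e a L k * eterm e b L l)"
  using assms by (intro fsummable_prod fsummable_eterm)

lemma fsummable_eterm_diag:
  assumes "a > 0" "b > 0"
  shows "fsummable (\<lambda>k. eterm e a L k * eterm e b L (k + n))"
  using fsummable_inj[OF fsummable_eterm_prod[OF assms], of "\<lambda>k. (k, k + n)"]
  by (simp add: inj_def)

text \<open>Coefficient form of the functional equation under x -> x q^L. Rewriting both factors by
  the ratio of consecutive Euler terms leaves the auxiliary sum \<open>T\<close> with coefficient (1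
  - e^2) q^(L(n+1)), which vanishes.\<close>

lemma dterm_Suc:
  assumes "a > 0" "b > 0" and e: "e * e = 1"
  shows "dterm e a b (Suc n) = e * fps_X ^ (b + (a + b) * n) * dterm e a b n"
proof -
  define L where "L = a + b"
  have L: "L > 0" using assms by (simp add: L_def)
  define f g where "f = eterm e a L" and "g = eterm e b L"
  have g_Suc: "g (Suc k) = fps_X ^ (L * Suc k) * g (Suc k) + e * fps_X ^ (b + L * k) * g k" for k
    using eterm_Suc[OF L, of k e b] by (simp add: g_def algebra_simps)
  have f_Suc: "(1 - fps_X ^ (L * Suc k)) * f (Suc k) = e * fps_X ^ (a + L * k) * f k" for k
    using eterm_Suc[OF L, of k e a] by (simp add: f_def)
  have sm: "fsummable (\<lambda>k. f k * g (k + m))" for m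
    unfolding f_def g_def by (rule fsummable_eterm_diag[OF assms(1,2)])
  have smf: "fsummable (\<lambda>k. fps_X ^ (L * k) * f k * g (k + m))" for m
    using fsummable_inj[OF fsummable_eterm_prod[of "a + L" b e L], of "\<lambda>k. (k, k + m)"] assms
    by (simp add: inj_def eterm_shift f_def g_def)
  define T where "T = fsum (\<lambda>k. fps_X ^ (L * k) * f k * g (k + Suc n))"
  have "dterm e a b (Suc n) = fsum (\<lambda>k. fps_X ^ (L * Suc n) * (fps_X ^ (L * k) * f k * g (k + Suc n))
      + e * fps_X ^ (b + L * n) * (fps_X ^ (L * k) * f k * g (k + n)))"
  proof -
    have "f k * g (k + Suc n) = fps_X ^ (L * Suc n) * (fps_X ^ (L * k) * f k * g (k + Suc n))
      + e * fps_X ^ (b + L * n) * (fps_X ^ (L * k) * f k * g (k + n))" for k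
    proof -
      have "f k * g (k + Suc n) = f k * (fps_X ^ (L * Suc (k + n)) * g (Suc (k + n))
          + e * fps_X ^ (b + L * (k + n)) * g (k + n))"
        using g_Suc[of "k + n"] by simp
      then show ?thesis by (simp add: algebra_simps power_add)
    qed
    then show ?thesis by (simp add: dterm_def f_def g_def L_def)
  qed
  also have "\<dots> = fps_X ^ (L * Suc n) * T
      + e * fps_X ^ (b + L * n) * fsum (\<lambda>k. fps_X ^ (L * k) * f k * g (k + n))"
    unfolding T_def by (simp only: fsum_add[OF fsummable_cmult[OF smf] fsummable_cmult[OF smf]]
      fsum_cmult[OF smf])
  also have "fsum (\<lambda>k. fps_X ^ (L * k) * f k * g (k + n)) = dterm e a b n - e * fps_X ^ a * T"
  proof -
    have "dterm e a b n - fsum (\<lambda>k. fps_X ^ (L * k) * f k * g (k + n))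
        = fsum (\<lambda>k. f k * g (k + n) - fps_X ^ (L * k) * f k * g (k + n))"
      using fsum_diff[OF sm smf, of n n] by (simp add: dterm_def f_def g_def L_def)
    also have "\<dots> = fsum (\<lambda>k. (1 - fps_X ^ (L * k)) * f k * g (k + n))"
      by (simp add: algebra_simps)
    also have "\<dots> = fsum (\<lambda>k. (1 - fps_X ^ (L * Suc k)) * f (Suc k) * g (Suc k + n))"
    proof (subst fsum_Suc)
      show "fsummable (\<lambda>k. (1 - fps_X ^ (L * k)) * f k * g (k + n))"
        using fsummable_add[OF sm fsummable_cmult[OF smf, of "-1"], of n n]
        by (simp add: algebra_simps)
    qed simp
    also have "\<dots> = fsum (\<lambda>k. e * fps_X ^ a * (fps_X ^ (L * k) * f k * g (k + Suc n)))"
      unfolding f_Suc by (simp add: power_add mult_ac)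
    also have "\<dots> = e * fps_X ^ a * T"
      unfolding T_def by (rule fsum_cmult[OF smf])
    finally show ?thesis by (simp add: algebra_simps)
  qed
  also have "fps_X ^ (L * Suc n) * T + e * fps_X ^ (b + L * n) * (dterm e a b n - e * fps_X ^ a * T)
      = e * fps_X ^ (b + L * n) * dterm e a b n
        + (1 - e * e) * (fps_X ^ (L * Suc n) * T)"
    by (simp add: algebra_simps power_add L_def)
  finally show ?thesis using e by (simp add: L_def)
qed

lemma dterm_eq:
  assumes "a > 0" "b > 0" "e * e = 1"
  shows "dterm e a b n = e ^ n * fps_X ^ (b * n + (a + b) * (n choose 2)) * dterm e a b 0"
proof (induction n)
  case 0
  show ?case by (simp add: numeral_2_eq_2)
next
  case (Suc n)
  then show ?case
    by (simp add: dterm_Suc[OF assms] choose2_Suc power_add algebra_simps)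
qed

lemma sign_power_unit: "(e::int fps) * e = 1 \<Longrightarrow> e ^ n * e ^ n = 1"
  by (metis power_mult_distrib power_one)

text \<open>The constant coefficient is read off from the far ones. In \<open>dterm e a b n\<close>
  the terms with k > 0 are divisible by q^n beyond the leading power q^(d n), so after division
  \<open>dterm e a b 0\<close> agrees with 1/(q^L;q^L)_n to order n; this holds for all n.\<close>

lemma dterm_0:
  assumes "a > 0" "b > 0" and e: "e * e = 1"
  shows "dterm e a b 0 * qprod (-1) (a + b) (a + b) = 1"
proof -
  define L where "L = a + b"
  have L: "L > 0" using assms by (simp add: L_def)
  define d where "d = (\<lambda>n. b * n + L * (n choose 2))"
  have main: "fps_X ^ n dvd dterm e a b 0 * qprod (-1) L L - 1" for n
  proof -
    have "fps_X ^ (d n + n) dvd dterm e a b n - eterm e b L n"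
    proof -
      have "dterm e a b n - eterm e b L n
          = fsum (\<lambda>k. eterm e a L (Suc k) * eterm e b L (Suc k + n))"
        unfolding dterm_def L_def[symmetric]
        by (subst fsum_Suc) (use assms L fsummable_eterm_diag in auto)
      moreover have "fps_X ^ (d n + n) dvd eterm e a L (Suc k) * eterm e b L (Suc k + n)" for k
      proof -
        have "L * (n choose 2) + n \<le> L * (Suc n choose 2)"
          using L by (simp add: choose2_Suc algebra_simps)
        also have "\<dots> \<le> L * ((Suc k + n) choose 2)"
          using choose2_add[of "Suc n" k] by (intro mult_le_mono2) (simp add: add.commute)
        finally have "d n + n \<le> b * (Suc k + n) + L * ((Suc k + n) choose 2)"
          by (simp add: d_def algebra_simps)
        then have "fps_X ^ (d n + n) dvd eterm e b L (Suc k + n)"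
          using eterm_dvd le_imp_power_dvd dvd_trans by blast
        then show ?thesis by (rule dvd_mult)
      qed
      ultimately show ?thesis by (simp add: fsum_dvd)
    qed
    moreover have "dterm e a b n - eterm e b L n
        = e ^ n * (fps_X ^ d n * (dterm e a b 0 - iqfac L n))"
      using dterm_eq[OF assms, of n] by (simp add: eterm_def d_def L_def algebra_simps)
    ultimately have "fps_X ^ (d n + n) dvd e ^ n * (e ^ n * (fps_X ^ d n * (dterm e a b 0 - iqfac L n)))"
      by simp
    then have "fps_X ^ (d n + n) dvd fps_X ^ d n * (dterm e a b 0 - iqfac L n)"
      using sign_power_unit[OF e, of n] by (simp add: mult.assoc[symmetric])
    then have 1: "fps_X ^ n dvd dterm e a b 0 - iqfac L n"
      by (simp add: power_add)
    have 2: "fps_X ^ n dvd qprod (-1) (L + n * L) L - 1"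
      using L by (intro qprod_cong_1_weak) (auto simp: le_index)
    have "dterm e a b 0 * qprod (-1) L L - 1
        = (dterm e a b 0 - iqfac L n) * qprod (-1) L L
          + qfac L n * iqfac L n * (qprod (-1) (L + n * L) L - 1) + (qfac L n * iqfac L n - 1)"
      unfolding qprod_qfac[OF L, of n] by (simp add: algebra_simps)
    also have "qfac L n * iqfac L n - 1 = 0" using qfac_iqfac[OF L] by simp
    finally show ?thesis using 1 2 by (simp only: add_0_right) (intro dvd_add dvd_mult dvd_mult2)
  qed
  have "dterm e a b 0 * qprod (-1) L L - 1 = 0"
    by (rule fps_X_power_dvd_all_zero) (rule main)
  then show ?thesis by (simp add: L_def)
qed

text \<open>Ramanujan's \<open>f(e q^a, e q^b)\<close>, for \<open>e = \<plusminus>1\<close>.\<close>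

definition texp :: "nat \<Rightarrow> nat \<Rightarrow> int \<Rightarrow> nat" where
  "texp a b n = nat ((int a * (n * (n + 1)) + int b * (n * (n - 1))) div 2)"

definition theta :: "int fps \<Rightarrow> nat \<Rightarrow> nat \<Rightarrow> int fps" where
  "theta e a b = fsum (\<lambda>n. e ^ nat \<bar>n\<bar> * fps_X ^ texp a b n)"

lemma choose2_int: "2 * int (n choose 2) = int n * (int n - 1)"
  by (induction n) (simp_all add: choose2_Suc algebra_simps)

lemma texp_nat: "texp a b (int n) = a * n + (a + b) * (n choose 2)"
proof -
  have "int a * (int n * (int n + 1)) + int b * (int n * (int n - 1))
      = 2 * int (a * n + (a + b) * (n choose 2))"
    using choose2_int[of n, symmetric] by (simp add: algebra_simps)
  then have "texp a b (int n) = nat ((2 * int (a * n + (a + b) * (n choose 2))) div 2)"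
    unfolding texp_def by (rule arg_cong)
  also have "(2 * int (a * n + (a + b) * (n choose 2))) div 2 = int (a * n + (a + b) * (n choose 2))"
    by (rule nonzero_mult_div_cancel_left) simp
  finally show ?thesis by (simp only: nat_int)
qed

lemma texp_uminus: "texp a b (- n) = texp b a n"
  by (simp add: texp_def algebra_simps)

lemma texp_ge: "a > 0 \<Longrightarrow> b > 0 \<Longrightarrow> nat \<bar>n\<bar> \<le> texp a b n"
proof -
  assume ab: "a > 0" "b > 0"
  have *: "m \<le> c * m + d" if "c > 0" for c m d :: nat
    using that by (simp add: trans_le_add1)
  show ?thesis
  proof (cases "n \<ge> 0")
    case True
    then obtain m where "n = int m" using nonneg_int_cases by blast
    then show ?thesis using ab by (simp add: texp_nat *)
  next
    case False
    then obtain m where "n = - int m" by (metis int_cases2 of_nat_0_le_iff)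
    then show ?thesis using ab by (simp add: texp_nat texp_uminus *)
  qed
qed

lemma finite_int_abs_le: "finite {n::int. nat \<bar>n\<bar> \<le> m}"
  by (rule finite_subset[of _ "{- int m..int m}"]) auto

lemma fsummable_theta:
  assumes "a > 0" "b > 0"
  shows "fsummable (\<lambda>n. e ^ nat \<bar>n\<bar> * fps_X ^ texp a b n :: int fps)"
proof (rule fsummable_X_power[where d = "\<lambda>n. nat \<bar>n\<bar>"])
  fix n :: int
  have "(fps_X :: int fps) ^ nat \<bar>n\<bar> dvd fps_X ^ texp a b n"
    by (intro le_imp_power_dvd texp_ge assms)
  then show "fps_X ^ nat \<bar>n\<bar> dvd e ^ nat \<bar>n\<bar> * fps_X ^ texp a b n"
    by (rule dvd_mult)
qed (rule finite_int_abs_le)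

lemma theta_halves:
  assumes "a > 0" "b > 0"
  shows "theta e a b = fsum (\<lambda>n. e ^ n * fps_X ^ (b * n + (a + b) * (n choose 2)))
    + fsum (\<lambda>n. e ^ Suc n * fps_X ^ (a * Suc n + (a + b) * (Suc n choose 2)))"
proof -
  define g h where "g = (\<lambda>n. - int n)" and "h = (\<lambda>n. int (Suc n))"
  have "theta e a b = fsum (\<lambda>n. e ^ nat \<bar>g n\<bar> * fps_X ^ texp a b (g n))
      + fsum (\<lambda>n. e ^ nat \<bar>h n\<bar> * fps_X ^ texp a b (h n))"
    unfolding theta_def
  proof (rule fsum_split[OF fsummable_theta[OF assms]])
    have "n \<in> range g \<union> range h" for n
    proof (cases "n \<le> 0")
      case True
      then have "n = g (nat (- n))" by (simp add: g_def)
      then show ?thesis by blast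
    next
      case False
      then have "n = h (nat n - 1)" by (simp add: h_def)
      then show ?thesis by blast
    qed
    then show "range g \<union> range h = UNIV" by blast
  qed (auto simp: g_def h_def inj_def)
  moreover have "texp a b (h n) = a * Suc n + (a + b) * (Suc n choose 2)" for n
    unfolding h_def by (rule texp_nat)
  moreover have "texp a b (g n) = b * n + (a + b) * (n choose 2)" for n
    by (simp add: g_def texp_uminus texp_nat add.commute)
  ultimately show ?thesis by (simp add: g_def h_def nat_add_distrib)
qed

text \<open>Sorting the product of Euler's two series by diagonals gives the coefficients of x^n and
  x^-n. By \<open>dterm_eq\<close> each is the matching theta term times the common factor
  \<open>c\<close>, which is the reciprocal of the third product.\<close>

theorem jacobi_triple_product:
  assumes "a > 0" "b > 0" and e: "e * e = 1"
  shows "theta e a b = qprod e a (a + b) * qprod e b (a + b) * qprod (-1) (a + b) (a + b)"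
proof -
  define L where "L = a + b"
  have sm: "fsummable (eterm e a L)" "fsummable (eterm e b L)"
    using assms by (simp_all add: fsummable_eterm)
  define c where "c = dterm e a b 0"
  have comm: "dterm e b a 0 = c"
    by (simp add: c_def dterm_def add.commute mult.commute)
  let ?d = "\<lambda>b n. e ^ n * fps_X ^ (b * n + L * (n choose 2))"
  have sm2: "fsummable (\<lambda>n. ?d d n)" if "d > 0" for d
  proof (rule fsummable_nat)
    fix n
    have "(fps_X :: int fps) ^ n dvd fps_X ^ (d * n + L * (n choose 2))"
      using that by (intro le_imp_power_dvd) (simp add: trans_le_add1)
    then show "fps_X ^ n dvd ?d d n" by (rule dvd_mult)
  qed
  have "qprod e a L * qprod e b L = fsum (\<lambda>(k, l). eterm e a L k * eterm e b L l)"
    unfolding qprod_def by (rule fsum_prod[OF sm])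
  also have "\<dots> = fsum (dterm e a b) + fsum (\<lambda>n. dterm e b a (Suc n))"
    unfolding fsum_diagonals[OF fsummable_prod[OF sm]]
    by (simp add: dterm_def[abs_def] L_def mult.commute add.commute[of b a])
  also have "\<dots> = fsum (\<lambda>n. c * ?d b n) + fsum (\<lambda>n. c * ?d a (Suc n))"
  proof -
    have "dterm e a b n = c * ?d b n" for n
      using dterm_eq[OF assms, of n] by (simp only: c_def L_def mult_ac)
    moreover have "dterm e b a n = c * ?d a n" for n
      using dterm_eq[OF assms(2,1) e, of n] by (simp only: comm L_def mult_ac add.commute[of b a])
    ultimately show ?thesis by presburger
  qed
  also have "\<dots> = c * (fsum (\<lambda>n. ?d b n) + fsum (\<lambda>n. ?d a (Suc n)))"
    using assms sm2 fsum_cmult[OF sm2, of b c]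
      fsum_cmult[OF fsummable_inj[OF sm2, of a Suc], of c] by (simp add: distrib_left)
  also have "\<dots> = c * theta e a b"
    using theta_halves[OF assms(1,2), of e] by (simp add: L_def)
  finally have "qprod e a L * qprod e b L * qprod (-1) L L = (c * qprod (-1) L L) * theta e a b"
    by (simp add: mult_ac)
  also have "c * qprod (-1) L L = 1"
    unfolding c_def L_def by (rule dterm_0[OF assms])
  finally show ?thesis by (simp add: L_def)
qed

section \<open>Dissection operators\<close>

text \<open>The substitution q -> q^a. Its counterpart \<open>sec\<close> collects the coefficients
  in one residue class, so dissecting an identity means applying \<open>sec\<close> to both
  sides.\<close>

definition dil :: "nat \<Rightarrow> 'a::comm_ring_1 fps \<Rightarrow> 'a fps" where
  "dil a f = Abs_fps (\<lambda>n. if a dvd n then fps_nth f (n div a) else 0)"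

definition sec :: "nat \<Rightarrow> nat \<Rightarrow> 'a::comm_ring_1 fps \<Rightarrow> 'a fps" where
  "sec a r f = Abs_fps (\<lambda>n. fps_nth f (a * n + r))"

lemma sec_nth [simp]: "fps_nth (sec a r f) n = fps_nth f (a * n + r)"
  by (simp add: sec_def)

lemma dil_nth: "fps_nth (dil a f) n = (if a dvd n then fps_nth f (n div a) else 0)"
  by (simp add: dil_def)

lemma sec_add: "sec a r (f + g) = sec a r f + sec a r g"
  and sec_diff: "sec a r (f - g) = sec a r f - sec a r g"
  by (simp_all add: fps_eq_iff)

lemma sec_numeral_mult: "sec a r (numeral c * f) = numeral c * sec a r f"
  by (simp add: fps_eq_iff fps_numeral_fps_const)

text \<open>Series in q^a act as scalars under dissection: only exponents divisible by a occur in
  the first factor, so the residue of a product exponent is decided by g.\<close>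

lemma sec_dil_mult:
  assumes "r < a"
  shows "sec a r (dil a f * g) = f * sec a r g"
proof (rule fps_ext)
  fix n
  have "fps_nth (sec a r (dil a f * g)) n
      = (\<Sum>i=0..a * n + r. fps_nth (dil a f) i * fps_nth g (a * n + r - i))"
    by (simp add: fps_mult_nth)
  also have "\<dots> = (\<Sum>i\<in>(\<lambda>k. a * k) ` {0..n}. fps_nth (dil a f) i * fps_nth g (a * n + r - i))"
  proof (rule sum.mono_neutral_right)
    show "(\<lambda>k. a * k) ` {0..n} \<subseteq> {0..a * n + r}"
    proof clarsimp
      fix k assume "k \<le> n"
      then show "a * k \<le> a * n + r" by (intro trans_le_add1 mult_le_mono2)
    qed
    show "\<forall>i\<in>{0..a * n + r} - (\<lambda>k. a * k) ` {0..n}. fps_nth (dil a f) i * fps_nth g (a * n + r - i) = 0"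
    proof
      fix i assume i: "i \<in> {0..a * n + r} - (\<lambda>k. a * k) ` {0..n}"
      have "\<not> a dvd i"
      proof
        assume "a dvd i"
        then obtain k where k: "i = a * k" by blast
        have "a * k < a * Suc n" using i k assms by simp
        then have "k \<le> n" by (metis less_Suc_eq_le mult_less_cancel1)
        then show False using i k by auto
      qed
      then show "fps_nth (dil a f) i * fps_nth g (a * n + r - i) = 0" by (simp add: dil_nth)
    qed
  qed simp
  also have "\<dots> = (\<Sum>k=0..n. fps_nth f k * fps_nth g (a * n + r - a * k))"
    using assms by (subst sum.reindex) (auto simp: inj_on_def dil_nth)
  also have "\<dots> = fps_nth (f * sec a r g) n"
    unfolding fps_mult_nth by (intro sum.cong refl) (auto simp: diff_mult_distrib2)
  finally show "fps_nth (sec a r (dil a f * g)) n = fps_nth (f * sec a r g) n" .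
qed

lemma sec_dil: "r < a \<Longrightarrow> sec a r (dil a f) = (if r = 0 then f else 0)"
  by (auto simp: fps_eq_iff dil_nth dvd_add_right_iff nat_dvd_not_less)

lemma sec_X_power: "r < a \<Longrightarrow> s < a \<Longrightarrow> sec a r (fps_X ^ s) = (if r = s then 1 else 0)"
proof -
  assume *: "r < a" "s < a"
  have "a * n + r = s \<longleftrightarrow> n = 0 \<and> r = s" for n
    using * by (cases n) auto
  then show ?thesis by (auto simp: fps_eq_iff fps_X_power_nth)
qed

lemma sec_X_power_dil:
  "r < a \<Longrightarrow> s < a \<Longrightarrow> sec a r (fps_X ^ s * dil a f) = (if r = s then f else 0)"
  by (subst mult.commute) (simp add: sec_dil_mult sec_X_power)

lemma sec_X_dil: "r < a \<Longrightarrow> 1 < a \<Longrightarrow> sec a r (fps_X * dil a f) = (if r = 1 then f else 0)"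
  using sec_X_power_dil[of r a 1 f] by simp

lemma fps_eq_sec:
  assumes "a > 0" "\<And>r. r < a \<Longrightarrow> sec a r f = sec a r g"
  shows "f = g"
proof (rule fps_ext)
  fix n
  have "fps_nth (sec a (n mod a) f) (n div a) = fps_nth (sec a (n mod a) g) (n div a)"
    using assms by simp
  then show "fps_nth f n = fps_nth g n" by simp
qed

lemma dil_mult: "a > 0 \<Longrightarrow> dil a (f * g) = dil a f * dil a g"
  by (rule fps_eq_sec[of a]) (simp_all add: sec_dil_mult sec_dil)

lemma dil_add: "dil a (f + g) = dil a f + dil a g"
  and dil_diff: "dil a (f - g) = dil a f - dil a g"
  and dil_uminus: "dil a (- f) = - dil a f"
  by (simp_all add: fps_eq_iff dil_nth)

lemma dil_1 [simp]: "a > 0 \<Longrightarrow> dil a 1 = 1"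
  by (auto simp: fps_eq_iff dil_nth dvd_div_eq_0_iff)

lemma dil_numeral [simp]: "a > 0 \<Longrightarrow> dil a (numeral c) = numeral c"
  by (auto simp: fps_eq_iff dil_nth fps_numeral_nth dvd_div_eq_0_iff)

lemma dil_power: "a > 0 \<Longrightarrow> dil a (f ^ n) = dil a f ^ n"
  by (induction n) (simp_all add: dil_mult)

lemma dil_X: "a > 0 \<Longrightarrow> dil a fps_X = fps_X ^ a"
proof -
  assume "a > 0"
  then have "(a dvd n \<and> n div a = 1) = (n = a)" for n by auto
  then show ?thesis by (auto simp: fps_eq_iff dil_nth fps_X_power_nth)
qed

lemma dil_dil: "a > 0 \<Longrightarrow> b > 0 \<Longrightarrow> dil a (dil b f) = dil (a * b) f"
  by (auto simp: fps_eq_iff dil_nth div_mult2_eq dvd_mult_div_cancel mult_dvd_mono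
      elim!: dvdE) 

lemma dil_fsum: "a > 0 \<Longrightarrow> dil a (fsum f) = fsum (\<lambda>i. dil a (f i))"
  by (rule fps_ext) (simp add: dil_nth fsum_def)

text \<open>The substitution q -> -q, not the additive inverse.\<close>

definition neg :: "'a::comm_ring_1 fps \<Rightarrow> 'a fps" where
  "neg f = Abs_fps (\<lambda>n. (-1) ^ n * fps_nth f n)"

lemma neg_nth [simp]: "fps_nth (neg f) n = (-1) ^ n * fps_nth f n"
  by (simp add: neg_def)

lemma neg_mult: "neg (f * g) = neg f * neg g"
proof (rule fps_ext)
  fix n
  have "(-1) ^ n * (fps_nth f i * fps_nth g (n - i))
      = ((-1) ^ i * fps_nth f i) * ((-1) ^ (n - i) * fps_nth g (n - i))" if "i \<le> n" for i
  proof -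
    have "(-1 :: 'a) ^ n = (-1) ^ i * (-1) ^ (n - i)" using that by (simp add: power_add[symmetric])
    then show ?thesis by (simp add: mult_ac)
  qed
  then show "fps_nth (neg (f * g)) n = fps_nth (neg f * neg g) n"
    by (simp add: fps_mult_nth sum_distrib_left)
qed

lemma neg_add: "neg (f + g) = neg f + neg g"
  and neg_diff: "neg (f - g) = neg f - neg g"
  and neg_uminus: "neg (- f) = - neg f"
  by (simp_all add: fps_eq_iff algebra_simps)

lemma neg_1 [simp]: "neg 1 = 1"
  and neg_numeral [simp]: "neg (numeral c) = numeral c"
  and neg_X [simp]: "neg fps_X = - fps_X"
  by (auto simp: fps_eq_iff fps_numeral_nth fps_X_def)

lemma neg_power: "neg (f ^ n) = neg f ^ n"
  by (induction n) (simp_all add: neg_mult)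

lemma neg_dil_even: "even a \<Longrightarrow> neg (dil a f) = dil a f"
  by (auto simp: fps_eq_iff dil_nth elim!: dvdE)

lemma neg_fsum:
  fixes f :: "'i \<Rightarrow> int fps"
  shows "neg (fsum f) = fsum (\<lambda>i. neg (f i))"
  by (rule fps_ext) (simp add: fsum_def sum_distrib_left)

section \<open>Identities and dissections of theta functions\<close>

lemma dil_theta:
  assumes "c > 0" "dil c e = e"
  shows "dil c (theta e a b) = theta e (c * a) (c * b)"
proof -
  have texp: "texp (c * a) (c * b) n = c * texp a b n" for n
  proof -
    have "even (int a * (n * (n + 1)) + int b * (n * (n - 1)))" by simp
    then obtain k where k: "int a * (n * (n + 1)) + int b * (n * (n - 1)) = 2 * k" by blast
    have "int (c * a) * (n * (n + 1)) + int (c * b) * (n * (n - 1))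
        = int c * (int a * (n * (n + 1)) + int b * (n * (n - 1)))"
      by (simp only: of_nat_mult distrib_left mult.assoc)
    also have "\<dots> = 2 * (int c * k)" unfolding k by simp
    finally have "texp (c * a) (c * b) n = nat (int c * k)"
      unfolding texp_def by simp
    moreover have "texp a b n = nat k"
      unfolding texp_def k by simp
    ultimately show ?thesis by (simp add: nat_mult_distrib)
  qed
  show ?thesis
    unfolding theta_def dil_fsum[OF assms(1)]
    by (simp add: dil_mult dil_power dil_X assms texp power_mult)
qed

text \<open>\<open>\<phi>(q)\<close>, \<open>\<phi>(-q)\<close> and \<open>\<psi>(q)\<close>.\<close>

definition phi :: "int fps" where "phi = theta 1 1 1"
definition phim :: "int fps" where "phim = theta (-1) 1 1"
definition psi :: "int fps" where "psi = theta 1 1 3"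

lemma dil_phi: "c > 0 \<Longrightarrow> dil c phi = theta 1 c c"
  and dil_phim: "c > 0 \<Longrightarrow> dil c phim = theta (-1) c c"
  and dil_psi: "c > 0 \<Longrightarrow> dil c psi = theta 1 c (3 * c)"
  by (simp_all add: phi_def phim_def psi_def dil_theta dil_uminus mult.commute)

lemma theta_phi_prod: "c > 0 \<Longrightarrow> theta 1 c c = qprod 1 c (2 * c) ^ 2 * qprod (-1) (2 * c) (2 * c)"
  and theta_phim_prod: "c > 0 \<Longrightarrow> theta (-1) c c = qprod (-1) c (2 * c) ^ 2 * qprod (-1) (2 * c) (2 * c)"
  by (simp_all add: jacobi_triple_product mult_2 power2_eq_square)

lemma theta_psi_prod: "c > 0 \<Longrightarrow> theta 1 c (3 * c) = qprod 1 c (2 * c) * qprod (-1) (4 * c) (4 * c)"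
  using qprod_split2[of c "2 * c" 1] by (simp add: jacobi_triple_product)

lemma qprod_self_split: "c > 0 \<Longrightarrow> qprod e c c = qprod e c (2 * c) * qprod e (2 * c) (2 * c)"
  using qprod_split2[of c c e] by (simp add: mult_2)

lemma qprod_nonzero: "a > 0 \<Longrightarrow> L > 0 \<Longrightarrow> qprod e a L \<noteq> 0"
proof
  assume *: "a > 0" "L > 0" "qprod e a L = 0"
  then have "fps_X dvd (-1 :: int fps)" using qprod_cong_1_weak[of a L 1 e] by simp
  then obtain k where "(-1 :: int fps) = fps_X * k" by blast
  then have "fps_nth (-1 :: int fps) 0 = fps_nth (fps_X * k) 0" by simp
  then show False by simp
qed

text \<open>Multiplication by (q^(2c);q^(2c))_infinity completes the second factor to
  (q^c;q^c)_infinity, and (1 + x)(1 - x) = 1 - x^2 turns the product back into the multiplier, which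
  cancels.\<close>

lemma qprod_euler: "c > 0 \<Longrightarrow> qprod 1 c c * qprod (-1) c (2 * c) = 1"
proof -
  assume c: "c > 0"
  have "qprod 1 c c * qprod (-1) c (2 * c) * qprod (-1) (2 * c) (2 * c) = qprod (-1) (2 * c) (2 * c)"
    using qprod_plus_minus[OF c c] qprod_self_split[OF c, of "-1"] by (simp add: mult_ac)
  then show ?thesis using qprod_nonzero[of "2 * c" "2 * c" "-1"] c by simp
qed

section \<open>Product identities between phi, psi and (-q;q)_infinity\<close>

lemma phi_phim: "phi * phim = dil 2 phim ^ 2"
proof -
  have 1: "qprod (-1) 2 4 = qprod 1 1 2 * qprod (-1) 1 2"
    using qprod_plus_minus[of 1 2] by simp
  have 2: "qprod (-1) 2 2 = qprod (-1) 2 4 * qprod (-1) 4 4"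
    using qprod_self_split[of 2 "-1"] by simp
  have 3: "phi = qprod 1 1 2 ^ 2 * qprod (-1) 2 2"
    using theta_phi_prod[of 1] by (simp add: phi_def)
  have 4: "phim = qprod (-1) 1 2 ^ 2 * qprod (-1) 2 2"
    using theta_phim_prod[of 1] by (simp add: phim_def)
  have 5: "dil 2 phim = qprod (-1) 2 4 ^ 2 * qprod (-1) 4 4"
    using theta_phim_prod[of 2] by (simp add: dil_phim)
  show ?thesis
    unfolding 5 unfolding 3 4 unfolding 2 unfolding 1 by (simp only: power2_eq_square mult_ac)
qed

lemma psi_prod: "psi = qprod 1 1 2 * qprod (-1) 4 4"
  using theta_psi_prod[of 1] by (simp add: psi_def)

lemma psi_square: "psi ^ 2 = phi * dil 2 psi"
proof -
  have 1: "qprod (-1) 2 2 = qprod (-1) 2 4 * qprod (-1) 4 4"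
    using qprod_self_split[of 2 "-1"] by simp
  have 2: "phi = qprod 1 1 2 ^ 2 * qprod (-1) 2 2"
    using theta_phi_prod[of 1] by (simp add: phi_def)
  have 3: "dil 2 psi = qprod 1 2 4 * qprod (-1) 8 8"
    using theta_psi_prod[of 2] by (simp add: dil_psi)
  have 4: "qprod (-1) 4 4 = qprod 1 2 4 * qprod (-1) 2 4 * qprod (-1) 8 8"
    using qprod_plus_minus[of 2 4] qprod_self_split[of 4 "-1"] by simp
  show ?thesis
    unfolding 3 unfolding psi_prod 2 unfolding 1 unfolding 4 by (simp only: power2_eq_square mult_ac)
qed

text \<open>\<open>(-q;q)\<^sub>\<infinity>\<close>\<close>

definition uu :: "int fps" where "uu = qprod 1 1 1"

lemma psi_eq_uu: "psi = uu ^ 3 * phim"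
proof -
  have euler: "uu * qprod (-1) 1 2 = 1"
    using qprod_euler[of 1] by (simp add: uu_def)
  have "uu ^ 3 * phim = (uu * qprod (-1) 1 2) ^ 2 * (uu * qprod (-1) 2 2)"
    using theta_phim_prod[of 1] by (simp add: phim_def power2_eq_square power3_eq_cube mult_ac)
  also have "\<dots> = qprod 1 1 2 * (qprod 1 2 2 * qprod (-1) 2 2)"
    using qprod_self_split[of 1 1] unfolding euler by (simp add: uu_def mult_ac)
  also have "qprod 1 2 2 * qprod (-1) 2 2 = qprod (-1) 4 4"
    using qprod_plus_minus[of 2 2] by simp
  finally show ?thesis by (simp add: psi_prod)
qed

text \<open>With \<open>theta_m1_5\<close> this evaluates the theta functions left over in the
  3-dissections of psi(q) and phi(-q). Once u is split into residue classes modulo 3, Euler's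
  identity in q^3 cancels its class 0 against a factor of phi(-q^3).\<close>

lemma theta_1_2: "theta 1 1 2 = uu * dil 3 phim"
proof -
  have "uu * dil 3 phim = qprod 1 1 3 * qprod 1 2 3 * (qprod 1 3 3 * qprod (-1) 3 6)
      * (qprod (-1) 3 6 * qprod (-1) 6 6)"
    using qprod_split3[of 1 1 1] theta_phim_prod[of 3]
    by (simp add: uu_def dil_phim power2_eq_square mult_ac numeral_2_eq_2[symmetric])
  also have "qprod 1 3 3 * qprod (-1) 3 6 = 1"
    using qprod_euler[of 3] by simp
  also have "qprod (-1) 3 6 * qprod (-1) 6 6 = qprod (-1) 3 3"
    using qprod_self_split[of 3 "-1"] by simp
  finally show ?thesis
    using jacobi_triple_product[of 1 2 1] by (simp del: One_nat_def)
qed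

lemma theta_m1_5: "theta (-1) 1 5 * uu = dil 3 psi"
proof -
  have euler: "uu * qprod (-1) 1 2 = 1" "qprod 1 3 3 * qprod (-1) 3 6 = 1"
    using qprod_euler[of 1] qprod_euler[of 3] by (simp_all add: uu_def)
  have split: "qprod (-1) 1 2 = qprod (-1) 1 6 * qprod (-1) 3 6 * qprod (-1) 5 6"
    using qprod_split3[of 1 2 "-1"] by (simp del: One_nat_def)
  have "theta (-1) 1 5 * uu = theta (-1) 1 5 * uu * (qprod 1 3 3 * qprod (-1) 3 6)"
    by (simp only: euler mult_1_right)
  also have "\<dots> = (uu * qprod (-1) 1 2) * (qprod 1 3 3 * qprod (-1) 6 6)"
    unfolding split by (simp add: jacobi_triple_product mult_ac)
  also have "\<dots> = qprod 1 3 6 * (qprod 1 6 6 * qprod (-1) 6 6)"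
    using qprod_self_split[of 3 1] unfolding euler by (simp add: mult_ac)
  also have "qprod 1 6 6 * qprod (-1) 6 6 = qprod (-1) 12 12"
    using qprod_plus_minus[of 6 6] by simp
  also have "qprod 1 3 6 * qprod (-1) 12 12 = dil 3 psi"
    using theta_psi_prod[of 3] by (simp add: dil_psi)
  finally show ?thesis .
qed

section \<open>Exponents of theta series and splitting of the index set\<close>

lemma texp_1_1: "texp 1 1 n = nat (n\<^sup>2)"
proof -
  have "int 1 * (n * (n + 1)) + int 1 * (n * (n - 1)) = 2 * n\<^sup>2"
    by (simp add: algebra_simps power2_eq_square)
  then show ?thesis unfolding texp_def by simp
qed

lemma texp_1_3: "texp 1 3 n = nat (n * (2 * n - 1))"
proof -
  have "int 1 * (n * (n + 1)) + int 3 * (n * (n - 1)) = 2 * (n * (2 * n - 1))"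
    by (simp add: algebra_simps)
  then show ?thesis unfolding texp_def by simp
qed

lemma texp_1_5: "texp 1 5 n = nat (n * (3 * n - 2))"
proof -
  have "int 1 * (n * (n + 1)) + int 5 * (n * (n - 1)) = 2 * (n * (3 * n - 2))"
    by (simp add: algebra_simps)
  then show ?thesis unfolding texp_def by simp
qed

lemma nat_exp_eq: "nat x = c * nat y + d" if "x = int c * y + int d" "y \<ge> 0 \<or> c = 0"
proof -
  from that have "nat x = nat (int (c * nat y + d))" by auto
  then show ?thesis by (simp only: nat_int)
qed

lemma mult_pred_nonneg: "0 \<le> n * (c * n - d)" if "0 \<le> d" "d \<le> c" for n c d :: int
proof (cases "n \<le> 0")
  case True
  then have "c * n \<le> 0" using that by (simp add: mult_nonneg_nonpos)
  then have "c * n - d \<le> 0" using that by simp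
  then show ?thesis using True by (simp add: mult_nonpos_nonpos)
next
  case False
  then have "c * n \<ge> c * 1" using that by (intro mult_left_mono) auto
  then show ?thesis using False that by simp
qed

lemma fsum_split_mod2:
  fixes f :: "int \<Rightarrow> int fps"
  assumes "fsummable f"
  shows "fsum f = fsum (\<lambda>n. f (2 * n)) + fsum (\<lambda>n. f (2 * n + 1))"
proof (rule fsum_split[OF assms])
  show "range (\<lambda>n::int. 2 * n) \<inter> range (\<lambda>n. 2 * n + 1) = {}" by (auto, presburger)
  have "n \<in> range (\<lambda>n. 2 * n) \<union> range (\<lambda>n. 2 * n + 1)" for n :: int
    by (cases "even n") (auto elim!: evenE oddE)
  then show "range (\<lambda>n::int. 2 * n) \<union> range (\<lambda>n. 2 * n + 1) = UNIV" by blast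
qed (auto simp: inj_def)

lemma fsum_split_mod3:
  fixes f :: "int \<Rightarrow> int fps"
  assumes "fsummable f"
  shows "fsum f = fsum (\<lambda>n. f (3 * n)) + fsum (\<lambda>n. f (3 * n + 1)) + fsum (\<lambda>n. f (3 * n - 1))"
proof -
  \<comment> \<open>The two nonzero classes are interleaved, 3k + 1 at 2k and 3k + 2 at 2k + 1, so
    that the two-way splitting can be used twice.\<close>
  define g where "g = (\<lambda>n::int. if even n then 3 * (n div 2) + 1 else 3 * ((n + 1) div 2) - 1)"
  have g: "g (2 * n) = 3 * n + 1" "g (2 * n + 1) = 3 * (n + 1) - 1" for n
    by (simp_all add: g_def)
  have parity: "\<exists>k. n = 2 * k \<or> n = 2 * k + 1" for n :: int
    by presburger
  have g_mod: "g n mod 3 \<noteq> 0" for n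
    using parity[of n] by (elim exE disjE) (simp_all only: g, presburger+)
  have g_inv: "(if g n mod 3 = 1 then 2 * (g n div 3) else 2 * ((g n + 1) div 3) - 1) = n" for n
    using parity[of n] by (elim exE disjE) (simp_all only: g, presburger+)
  have inj: "inj g"
    by (rule injI) (metis g_inv)
  have "fsum f = fsum (\<lambda>n. f (3 * n)) + fsum (\<lambda>n. f (g n))"
  proof (rule fsum_split[OF assms _ inj])
    show "range (\<lambda>n::int. 3 * n) \<inter> range g = {}"
      using g_mod by (metis (no_types, lifting) disjoint_iff mod_mult_self1_is_0 rangeE)
    have "n \<in> range (\<lambda>n. 3 * n) \<union> range g" for n :: int
    proof -
      have "n = 3 * (n div 3) \<or> n = 3 * (n div 3) + 1 \<or> n = 3 * (n div 3 + 1) - 1"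
        by presburger
      then show ?thesis
        using g(1)[of "n div 3"] g(2)[of "n div 3"] by (metis UnI1 UnI2 rangeI)
    qed
    then show "range (\<lambda>n::int. 3 * n) \<union> range g = UNIV" by blast
  qed (auto simp: inj_def)
  also have "fsum (\<lambda>n. f (g n)) = fsum (\<lambda>n. f (3 * n + 1)) + fsum (\<lambda>n. f (3 * (n + 1) - 1))"
    using fsum_split_mod2[OF fsummable_inj[OF assms inj]] by (simp only: g)
  also have "fsum (\<lambda>n. f (3 * (n + 1) - 1)) = fsum (\<lambda>n. f (3 * n - 1))"
    by (rule fsum_reindex[of "\<lambda>n. n + 1" "\<lambda>n. f (3 * n - 1)"])
      (rule bij_plus_right)
  finally show ?thesis by simp
qed

lemma fsum_uminus_index:
  fixes f :: "int \<Rightarrow> int fps"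
  shows "fsum (\<lambda>n. f (- n)) = fsum f"
  by (rule fsum_reindex) (rule bij_uminus)

declare One_nat_def [simp del]

section \<open>Dissections of phi(q), phi(-q) and psi(q)\<close>

lemma phi_fsum: "phi = fsum (\<lambda>n. fps_X ^ nat (n\<^sup>2))"
  by (simp add: phi_def theta_def texp_1_1)

text \<open>For integers n the numbers n(2n-1) are the triangular numbers, each once, so this is the
  usual psi(q).\<close>

lemma psi_fsum: "psi = fsum (\<lambda>n. fps_X ^ nat (n * (2 * n - 1)))"
  by (simp add: psi_def theta_def texp_1_3)

lemma phim_fsum: "phim = fsum (\<lambda>n. (-1) ^ nat \<bar>n\<bar> * fps_X ^ nat (n\<^sup>2))"
  by (simp add: phim_def theta_def texp_1_1)

lemma fsummable_phi: "fsummable (\<lambda>n. fps_X ^ nat (n\<^sup>2) :: int fps)"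
  using fsummable_theta[of 1 1 1] by (simp add: texp_1_1)

lemma fsummable_phim: "fsummable (\<lambda>n. (-1) ^ nat \<bar>n\<bar> * fps_X ^ nat (n\<^sup>2) :: int fps)"
  using fsummable_theta[of 1 1 "-1"] by (simp add: texp_1_1)

lemma fsummable_psi: "fsummable (\<lambda>n. fps_X ^ nat (n * (2 * n - 1)) :: int fps)"
  using fsummable_theta[of 1 3 1] by (simp add: texp_1_3)

lemma pow_abs_neg1: "(-1) ^ nat \<bar>n\<bar> = (if even n then 1 else -1 :: 'a::ring_1)"
  by (simp add: uminus_power_if even_nat_iff)

lemma int_mod2_cases:
  fixes n :: int
  obtains k where "n = 2 * k" | k where "n = 2 * k + 1"
  by (cases "even n") (auto elim!: evenE oddE)

text \<open>The integers 4n - 1 and 1 - 4n together exhaust the odd ones, and both have the square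
  8n(2n-1) + 1; hence the factor 2 and the psi exponents.\<close>

lemma phi_dissect: "phi = dil 4 phi + 2 * fps_X * dil 8 psi"
proof -
  have sm: "fsummable (\<lambda>n. fps_X ^ nat ((2 * n + 1)\<^sup>2) :: int fps)"
    using fsummable_inj[OF fsummable_phi, of "\<lambda>n. 2 * n + 1"] by (simp add: inj_def)
  have e0: "nat ((2 * n)\<^sup>2) = 4 * nat (n\<^sup>2)" for n :: int
    using nat_exp_eq[of "(2 * n)\<^sup>2" 4 "n\<^sup>2" 0] by (simp add: power2_eq_square)
  have e1: "nat ((2 * (2 * n - 1) + 1)\<^sup>2) = 8 * nat (n * (2 * n - 1)) + 1" for n :: int
    using mult_pred_nonneg[of 1 2 n]
    by (intro nat_exp_eq) (auto simp: power2_eq_square algebra_simps)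
  have e2: "nat ((2 * (- 2 * n) + 1)\<^sup>2) = 8 * nat (n * (2 * n - 1)) + 1" for n :: int
    using mult_pred_nonneg[of 1 2 n]
    by (intro nat_exp_eq) (auto simp: power2_eq_square algebra_simps)
  have odd: "fsum (\<lambda>n. fps_X ^ (8 * nat (n * (2 * n - 1)) + 1)) = fps_X * dil 8 psi"
  proof -
    have "dil 8 psi = fsum (\<lambda>n. fps_X ^ (8 * nat (n * (2 * n - 1))))"
      by (simp add: psi_fsum dil_fsum dil_power dil_X power_mult)
    moreover have "fsummable (\<lambda>n. fps_X ^ (8 * nat (n * (2 * n - 1))) :: int fps)"
    proof (rule fsummable_X_power[where d = "\<lambda>n. nat \<bar>n\<bar>"])
      fix n
      have "nat \<bar>n\<bar> \<le> 8 * nat (n * (2 * n - 1))"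
        using texp_ge[of 1 3 n] by (simp add: texp_1_3)
      then show "fps_X ^ nat \<bar>n\<bar> dvd (fps_X ^ (8 * nat (n * (2 * n - 1))) :: int fps)"
        by (rule le_imp_power_dvd)
    qed (rule finite_int_abs_le)
    ultimately show ?thesis
      by (simp add: fsum_cmult[symmetric] power_add mult.commute)
  qed
  have "fsum (\<lambda>n. fps_X ^ nat ((2 * n + 1)\<^sup>2) :: int fps)
      = fsum (\<lambda>n. fps_X ^ nat ((2 * (2 * n - 1) + 1)\<^sup>2)) + fsum (\<lambda>n. fps_X ^ nat ((2 * (- 2 * n) + 1)\<^sup>2))"
  proof (rule fsum_split[OF sm])
    show "range (\<lambda>n::int. 2 * n - 1) \<inter> range (\<lambda>n. - 2 * n) = {}" by (auto, presburger)
    have "m \<in> range (\<lambda>n. 2 * n - 1) \<union> range (\<lambda>n. - 2 * n)" for m :: int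
    proof (cases m rule: int_mod2_cases)
      case (1 k)
      then have "m = - 2 * (- k)" by simp
      then show ?thesis by blast
    next
      case (2 k)
      then have "m = 2 * (k + 1) - 1" by simp
      then show ?thesis by blast
    qed
    then show "range (\<lambda>n::int. 2 * n - 1) \<union> range (\<lambda>n. - 2 * n) = UNIV" by blast
  qed (auto simp: inj_def)
  also have "\<dots> = 2 * (fps_X * dil 8 psi)"
    unfolding e1 e2 odd by simp
  finally have "fsum (\<lambda>n. fps_X ^ nat ((2 * n + 1)\<^sup>2)) = 2 * (fps_X * dil 8 psi)" .
  moreover have "fsum (\<lambda>n. fps_X ^ nat ((2 * n)\<^sup>2)) = dil 4 phi"
    unfolding e0 by (simp add: phi_fsum dil_fsum dil_power dil_X power_mult)
  ultimately show ?thesis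
    using fsum_split_mod2[OF fsummable_phi] by (simp add: phi_fsum[symmetric] mult.assoc)
qed

text \<open>Multiples of 3 give phi(-q^9). The roots 3n - 1 and 3n + 1 correspond under change of
  sign, and (3n-1)^2 = 3n(3n-2) + 1, with n and 3n - 1 of opposite parity.\<close>

lemma phim_dissect: "phim = dil 9 phim - 2 * fps_X * dil 3 (theta (-1) 1 5)"
proof -
  let ?f = "\<lambda>n. (-1) ^ nat \<bar>n\<bar> * fps_X ^ nat (n\<^sup>2) :: int fps"
  let ?g = "\<lambda>n. - (fps_X * dil 3 ((-1) ^ nat \<bar>n\<bar> * fps_X ^ texp 1 5 n)) :: int fps"
  have g: "fsum ?g = - (fps_X * dil 3 (theta (-1) 1 5))"
  proof -
    have "fsummable (\<lambda>n. dil 3 ((-1) ^ nat \<bar>n\<bar> * fps_X ^ texp 1 5 n :: int fps))"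
    proof (rule fsummable_X_power[where d = "\<lambda>n. nat \<bar>n\<bar>"])
      fix n
      have "nat \<bar>n\<bar> \<le> 3 * texp 1 5 n"
        using texp_ge[of 1 5 n] by simp
      then have "fps_X ^ nat \<bar>n\<bar> dvd (fps_X ^ (3 * texp 1 5 n) :: int fps)"
        by (rule le_imp_power_dvd)
      then show "fps_X ^ nat \<bar>n\<bar> dvd dil 3 ((-1) ^ nat \<bar>n\<bar> * fps_X ^ texp 1 5 n :: int fps)"
        by (simp add: dil_mult dil_power dil_X dil_uminus power_mult)
    qed (rule finite_int_abs_le)
    from fsum_cmult[OF this, of "- fps_X"] show ?thesis
      by (simp add: theta_def dil_fsum)
  qed
  have f0: "?f (3 * n) = dil 9 (?f n)" for n
  proof -
    have "nat ((3 * n)\<^sup>2) = 9 * nat (n\<^sup>2)"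
      using nat_exp_eq[of "(3 * n)\<^sup>2" 9 "n\<^sup>2" 0] by (simp add: power2_eq_square)
    then show ?thesis
      by (simp add: dil_mult dil_power dil_X dil_uminus power_mult pow_abs_neg1)
  qed
  have f1: "?f (3 * n - 1) = ?g n" for n
  proof -
    have "nat ((3 * n - 1)\<^sup>2) = 3 * nat (n * (3 * n - 2)) + 1"
      using mult_pred_nonneg[of 2 3 n]
      by (intro nat_exp_eq) (auto simp: power2_eq_square algebra_simps)
    then show ?thesis
      by (simp add: dil_mult dil_power dil_X dil_uminus power_mult pow_abs_neg1 texp_1_5 power_add mult.commute)
  qed
  have f2: "?f (3 * n + 1) = ?g (- n)" for n
  proof -
    have "(3 * n + 1)\<^sup>2 = (3 * (- n) - 1)\<^sup>2" by (simp add: power2_eq_square algebra_simps)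
    then have "?f (3 * n + 1) = ?f (3 * (- n) - 1)" by (simp only: pow_abs_neg1) simp
    then show ?thesis using f1[of "- n"] by (rule trans)
  qed
  have "phim = fsum (\<lambda>n. ?f (3 * n)) + fsum (\<lambda>n. ?f (3 * n + 1)) + fsum (\<lambda>n. ?f (3 * n - 1))"
    unfolding phim_fsum by (rule fsum_split_mod3[OF fsummable_phim])
  also have "fsum (\<lambda>n. ?f (3 * n)) = dil 9 phim"
    unfolding f0 by (simp add: phim_fsum dil_fsum)
  also have "fsum (\<lambda>n. ?f (3 * n + 1)) = fsum ?g"
    unfolding f2 by (rule fsum_uminus_index)
  also have "fsum (\<lambda>n. ?f (3 * n - 1)) = fsum ?g"
    unfolding f1 ..
  finally show ?thesis unfolding g by (simp add: mult.assoc)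
qed

lemma texp_1_2_even: "texp 1 2 (2 * n) = nat (n * (6 * n - 1))"
proof -
  have "int 1 * (2 * n * (2 * n + 1)) + int 2 * (2 * n * (2 * n - 1)) = 2 * (n * (6 * n - 1))"
    by (simp add: algebra_simps)
  then show ?thesis unfolding texp_def by simp
qed

lemma texp_1_2_odd: "texp 1 2 (1 - 2 * n) = nat ((3 * n - 1) * (2 * n - 1))"
proof -
  have "int 1 * ((1 - 2 * n) * ((1 - 2 * n) + 1)) + int 2 * ((1 - 2 * n) * ((1 - 2 * n) - 1))
      = 2 * ((3 * n - 1) * (2 * n - 1))"
    by (simp add: algebra_simps)
  then show ?thesis unfolding texp_def by simp
qed

text \<open>At 3n + 1 the exponent is 9 times the psi exponent at -n, plus 1. The classes 3n and 3n
  - 1 supply the summands of even and of odd index in f(q^3,q^6).\<close>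

lemma psi_dissect: "psi = dil 3 (theta 1 1 2) + fps_X * dil 9 psi"
proof -
  let ?f = "\<lambda>n. fps_X ^ nat (n * (2 * n - 1)) :: int fps"
  let ?g = "\<lambda>n. fps_X * dil 9 (?f n)"
  have g: "fsum ?g = fps_X * dil 9 psi"
  proof -
    have "fsummable (\<lambda>n. dil 9 (?f n))"
    proof (rule fsummable_X_power[where d = "\<lambda>n. nat \<bar>n\<bar>"])
      fix n
      have "nat \<bar>n\<bar> \<le> 9 * nat (n * (2 * n - 1))"
        using texp_ge[of 1 3 n] by (simp add: texp_1_3)
      then have "fps_X ^ nat \<bar>n\<bar> dvd (fps_X ^ (9 * nat (n * (2 * n - 1))) :: int fps)"
        by (rule le_imp_power_dvd)
      then show "fps_X ^ nat \<bar>n\<bar> dvd dil 9 (?f n)"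
        by (simp add: dil_power dil_X power_mult)
    qed (rule finite_int_abs_le)
    from fsum_cmult[OF this, of "fps_X"] show ?thesis
      by (simp add: psi_fsum dil_fsum)
  qed
  have f1: "?f (3 * n + 1) = ?g (- n)" for n
  proof -
    have "nat ((3 * n + 1) * (2 * (3 * n + 1) - 1)) = 9 * nat (- n * (2 * - n - 1)) + 1"
      using mult_pred_nonneg[of 1 2 "- n"]
      by (intro nat_exp_eq) (auto simp: algebra_simps)
    then show ?thesis by (simp add: dil_power dil_X power_mult power_add mult.commute)
  qed
  have f0: "?f (3 * n) = dil 3 (fps_X ^ texp 1 2 (2 * n))" for n
  proof -
    have "nat (3 * n * (2 * (3 * n) - 1)) = 3 * nat (n * (6 * n - 1)) + 0"
      using mult_pred_nonneg[of 1 6 n]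
      by (intro nat_exp_eq) (auto simp: algebra_simps)
    then show ?thesis by (simp add: dil_power dil_X power_mult texp_1_2_even)
  qed
  have f2: "?f (3 * n - 1) = dil 3 (fps_X ^ texp 1 2 (1 - 2 * n))" for n
  proof -
    have nn: "0 \<le> (3 * n - 1) * (2 * n - 1)"
    proof (cases "n \<ge> 1")
      case True
      then show ?thesis by (intro mult_nonneg_nonneg) auto
    next
      case False
      then show ?thesis by (intro mult_nonpos_nonpos) auto
    qed
    have "nat ((3 * n - 1) * (2 * (3 * n - 1) - 1)) = 3 * nat ((3 * n - 1) * (2 * n - 1)) + 0"
      using nn by (intro nat_exp_eq) (auto simp: algebra_simps)
    then show ?thesis by (simp add: dil_power dil_X power_mult texp_1_2_odd)
  qed
  have A: "dil 3 (theta 1 1 2) = fsum (\<lambda>n. dil 3 (fps_X ^ texp 1 2 (2 * n)))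
      + fsum (\<lambda>n. dil 3 (fps_X ^ texp 1 2 (1 - 2 * n)))"
  proof -
    have sm: "fsummable (\<lambda>n. fps_X ^ texp 1 2 n :: int fps)"
      using fsummable_theta[of 1 2 1] by simp
    have "theta 1 1 2 = fsum (\<lambda>n. fps_X ^ texp 1 2 (2 * n)) + fsum (\<lambda>n. fps_X ^ texp 1 2 (1 - 2 * n))"
      unfolding theta_def
    proof (subst fsum_split)
      show "range (\<lambda>n::int. 2 * n) \<inter> range (\<lambda>n. 1 - 2 * n) = {}" by (auto, presburger)
      have "m \<in> range (\<lambda>n. 2 * n) \<union> range (\<lambda>n. 1 - 2 * n)" for m :: int
      proof (cases m rule: int_mod2_cases)
        case (1 k)
        then show ?thesis by blast
      next
        case (2 k)
        then have "m = 1 - 2 * (- k)" by simp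
        then show ?thesis by blast
      qed
      then show "range (\<lambda>n::int. 2 * n) \<union> range (\<lambda>n. 1 - 2 * n) = UNIV" by blast
    qed (use sm in \<open>auto simp: inj_def\<close>)
    then show ?thesis by (simp add: dil_add dil_fsum)
  qed
  have "psi = fsum (\<lambda>n. ?f (3 * n)) + fsum (\<lambda>n. ?f (3 * n + 1)) + fsum (\<lambda>n. ?f (3 * n - 1))"
    unfolding psi_fsum by (rule fsum_split_mod3[OF fsummable_psi])
  also have "fsum (\<lambda>n. ?f (3 * n + 1)) = fsum ?g"
    unfolding f1 by (rule fsum_uminus_index)
  finally show ?thesis unfolding g A f0 f2 by (simp only: add_ac)
qed

lemma neg_phi: "neg phi = phim"
proof -
  have "neg (fps_X ^ nat (n\<^sup>2) :: int fps) = (-1) ^ nat \<bar>n\<bar> * fps_X ^ nat (n\<^sup>2)" for n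
  proof -
    have "neg (fps_X ^ nat (n\<^sup>2) :: int fps) = (- fps_X) ^ nat (n\<^sup>2)"
      by (simp add: neg_power)
    also have "\<dots> = (-1) ^ nat (n\<^sup>2) * fps_X ^ nat (n\<^sup>2)"
      by (rule power_minus)
    also have "(-1 :: int fps) ^ nat (n\<^sup>2) = (-1) ^ nat \<bar>n\<bar>"
      by (simp add: uminus_power_if even_nat_iff)
    finally show ?thesis .
  qed
  then show ?thesis by (simp add: phi_fsum phim_fsum neg_fsum)
qed

text \<open>The substitution \<open>(m, n) = (a + b, a - b)\<close> in \<open>m\<^sup>2 + n\<^sup>2\<close>.\<close>

lemma sec_phi_square: "sec 2 0 (phi ^ 2) = phi ^ 2"
proof -
  let ?f = "\<lambda>(m, n). fps_X ^ nat (m\<^sup>2) * (fps_X ^ nat (n\<^sup>2) :: int fps)"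
  have sm: "fsummable ?f" by (rule fsummable_prod[OF fsummable_phi fsummable_phi])
  define g h where "g = (\<lambda>(a, b). (a + b, a - b) :: int \<times> int)"
    and "h = (\<lambda>(a, b). (a + b + 1, a - b) :: int \<times> int)"
  have inj: "inj g" "inj h" by (auto simp: inj_def g_def h_def)
  have sq: "phi ^ 2 = fsum ?f"
    unfolding power2_eq_square[of phi]
    by (rule fsum_prod[OF fsummable_phi fsummable_phi, folded phi_fsum])
  also have "\<dots> = fsum (\<lambda>p. ?f (g p)) + fsum (\<lambda>p. ?f (h p))"
  proof (rule fsum_split[OF sm inj])
    have "p \<in> range g \<union> range h" for p
    proof -
      obtain m n where p: "p = (m, n)" by (cases p)
      show ?thesis
      proof (cases "m + n" rule: int_mod2_cases)
        case (1 k)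
        then have "p = g (k, k - n)" by (simp add: p g_def)
        then show ?thesis by blast
      next
        case (2 k)
        then have "p = h (k, k - n)" by (simp add: p h_def)
        then show ?thesis by blast
      qed
    qed
    then show "range g \<union> range h = UNIV" by blast
    show "range g \<inter> range h = {}" unfolding g_def h_def by (auto, presburger)
  qed
  also have "fsum (\<lambda>p. ?f (g p)) = dil 2 (phi ^ 2)"
  proof -
    have "?f (g p) = dil 2 (?f p)" for p
    proof -
      obtain a b where p: "p = (a, b)" by (cases p)
      have "nat ((a + b)\<^sup>2) + nat ((a - b)\<^sup>2) = 2 * (nat (a\<^sup>2) + nat (b\<^sup>2))"
      proof -
        have "(a + b)\<^sup>2 + (a - b)\<^sup>2 = 2 * (a\<^sup>2 + b\<^sup>2)"
          by (simp add: power2_eq_square algebra_simps)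
        then have "nat ((a + b)\<^sup>2 + (a - b)\<^sup>2) = 2 * nat (a\<^sup>2 + b\<^sup>2)"
          by (simp add: nat_mult_distrib)
        then show ?thesis by (simp add: nat_add_distrib)
      qed
      then show ?thesis
        by (simp add: p g_def dil_mult dil_power dil_X power_add[symmetric] power_mult[symmetric])
    qed
    then show ?thesis by (simp add: sq dil_fsum)
  qed
  finally have eq: "phi ^ 2 = dil 2 (phi ^ 2) + fsum (\<lambda>p. ?f (h p))" .
  have "sec 2 0 (fsum (\<lambda>p. ?f (h p))) = 0"
  proof (rule fps_ext)
    fix n
    have "fps_nth (?f (h p)) (2 * n) = 0" for p
    proof -
      obtain a b where p: "p = (a, b)" by (cases p)
      have "odd (nat ((a + b + 1)\<^sup>2) + nat ((a - b)\<^sup>2))"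
        by (simp add: even_nat_iff)
      then have "2 * n \<noteq> nat ((a + b + 1)\<^sup>2) + nat ((a - b)\<^sup>2)"
        by (metis dvd_triv_left)
      then show ?thesis
        by (auto simp: p h_def power_add[symmetric] fps_X_power_nth)
    qed
    then show "fps_nth (sec 2 0 (fsum (\<lambda>p. ?f (h p)))) n = fps_nth 0 n"
      by (simp add: fsum_def)
  qed
  then show ?thesis
    by (subst eq) (simp add: sec_add sec_dil)
qed

text \<open>The even part is \<open>sec_phi_square\<close>; the odd part is the cross term of
  \<open>phi_dissect\<close>, turned into a square of psi by \<open>psi_square\<close>.\<close>

lemma phi_square_dissect: "phi ^ 2 = dil 2 (phi ^ 2) + 4 * fps_X * dil 4 (psi ^ 2)"
proof (rule fps_eq_sec[of 2])
  fix r :: nat assume r: "r < 2"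
  have sq: "phi ^ 2 = (dil 2 (dil 2 phi ^ 2) + 4 * (dil 2 (fps_X * dil 4 psi ^ 2)))
      + 4 * (fps_X * dil 2 (dil 2 phi * dil 4 psi))"
    by (subst phi_dissect)
      (simp add: power2_eq_square algebra_simps dil_mult dil_dil dil_X flip: power_add)
  have "sec 2 1 (phi ^ 2) = 4 * (dil 2 phi * dil 4 psi)"
    by (subst sq) (simp add: sec_add sec_numeral_mult sec_dil sec_X_dil)
  also have "dil 2 phi * dil 4 psi = dil 2 (psi ^ 2)"
    by (simp add: psi_square dil_mult dil_dil)
  finally have 1: "sec 2 1 (phi ^ 2) = 4 * dil 2 (psi ^ 2)" .
  have rhs: "sec 2 r (dil 2 (phi ^ 2) + 4 * fps_X * dil 4 (psi ^ 2))
      = sec 2 r (dil 2 (phi ^ 2)) + 4 * sec 2 r (fps_X * dil 2 (dil 2 (psi ^ 2)))"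
    by (simp add: sec_add mult.assoc sec_numeral_mult dil_dil)
  from r consider "r = 0" | "r = 1" by linarith
  then show "sec 2 r (phi ^ 2) = sec 2 r (dil 2 (phi ^ 2) + 4 * fps_X * dil 4 (psi ^ 2))"
    unfolding rhs using 1 sec_phi_square by cases (simp_all add: sec_dil sec_X_dil)
qed simp

lemma phim_square_dissect: "phim ^ 2 = dil 2 (phi ^ 2) - 4 * fps_X * dil 4 (psi ^ 2)"
proof -
  have "phim ^ 2 = neg (phi ^ 2)"
    by (simp only: neg_power neg_phi)
  also have "\<dots> = neg (dil 2 (phi ^ 2) + 4 * fps_X * dil 4 (psi ^ 2))"
    by (rule arg_cong[OF phi_square_dissect])
  finally show ?thesis by (simp add: neg_add neg_mult neg_dil_even)
qed

lemma psi_4: "psi ^ 4 = phi ^ 2 * dil 2 (psi ^ 2)"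
proof -
  have "psi ^ 4 = (psi ^ 2) ^ 2" by (simp flip: power_mult)
  also have "\<dots> = (phi * dil 2 psi) ^ 2" by (simp only: psi_square)
  also have "\<dots> = phi ^ 2 * dil 2 (psi ^ 2)" by (simp add: power_mult_distrib dil_power)
  finally show ?thesis .
qed

text \<open>Jacobi's quartic identity. By \<open>phi_square_dissect\<close> and
  \<open>phim_square_dissect\<close> the squares are a + b and a - b, so the fourth powers differ by
  4ab, and \<open>psi_4\<close> at q^2 evaluates ab.\<close>

lemma phi4_phim4: "phi ^ 4 = phim ^ 4 + 16 * fps_X * dil 2 (psi ^ 4)"
proof -
  define a b where "a = dil 2 (phi ^ 2)" and "b = 4 * fps_X * dil 4 (psi ^ 2)"
  have ab: "phi ^ 2 = a + b" "phim ^ 2 = a - b"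
    unfolding a_def b_def by (rule phi_square_dissect phim_square_dissect)+
  have "phi ^ 4 - phim ^ 4 = (phi ^ 2 - phim ^ 2) * (phi ^ 2 + phim ^ 2)"
    by (simp add: algebra_simps power4_eq_xxxx power2_eq_square)
  also have "\<dots> = (2 * b) * (2 * a)"
    unfolding ab by simp
  also have "\<dots> = 16 * fps_X * dil 2 (phi ^ 2 * dil 2 (psi ^ 2))"
    by (simp add: a_def b_def dil_mult dil_dil mult_ac)
  also have "phi ^ 2 * dil 2 (psi ^ 2) = psi ^ 4"
    by (rule psi_4[symmetric])
  finally show ?thesis by (simp add: algebra_simps)
qed

section \<open>The bilateral series\<close>

text \<open>q^(k^2)/(q^2;q^2)_k, the coefficient of x^k in (-xq;q^2)_infinity and of x^-k in
  (-q/x;q^2)_infinity.\<close>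

abbreviation ee :: "nat \<Rightarrow> int fps" where "ee \<equiv> eterm 1 1 2"

lemma ee_Suc: "(1 - fps_X ^ (2 * k + 2)) * ee (Suc k) = fps_X ^ (2 * k + 1) * ee k"
  using eterm_Suc[of 2 k 1 1] by (simp add: add.commute)

lemma eterm_m1: "eterm (-1) 1 2 k = (-1) ^ k * ee k"
  by (simp add: eterm_def)

lemma fsummable_ee: "fsummable ee"
  by (rule fsummable_eterm) simp

lemma fsummable_ee_alt: "fsummable (\<lambda>k. (-1) ^ k * ee k)"
  using fsummable_eterm[of 1 "-1" 2] by (simp add: eterm_m1[abs_def])

text \<open>
  The coefficients in \<open>x\<close> of
  \<open>\<Sum>\<^sub>n x\<^sup>n q^{n\<^sup>2} (-xq;q\<^sup>2)\<^sub>n (xq^{2n+1};q\<^sup>2)\<^sub>\<infinity>\<close>, \<open>n \<ge> 0\<close>, as obtained from its \<open>q\<close>-difference equation.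
\<close>

fun pp :: "nat \<Rightarrow> int fps" where
  "pp 0 = 1"
| "pp (Suc 0) = - ee 1 + fps_X"
| "pp (Suc (Suc n)) = (-1) ^ n * ee (n + 2) + fps_X ^ (2 * n + 3) * pp (Suc n) + fps_X ^ (2 * n + 2) * pp n"

lemma X_dvd_ee: "fps_X ^ k dvd ee k"
proof -
  have "(fps_X :: int fps) ^ k dvd fps_X ^ (1 * k + 2 * (k choose 2))"
    by (intro le_imp_power_dvd) simp
  then show ?thesis using eterm_dvd dvd_trans by blast
qed

lemma X_dvd_pp: "fps_X ^ n dvd pp n"
proof (induction n rule: pp.induct)
  case 1
  then show ?case by simp
next
  case 2
  show ?case using X_dvd_ee[of 1] by (simp add: One_nat_def)
next
  case (3 n)
  have "(fps_X :: int fps) ^ Suc (Suc n) dvd fps_X ^ (2 * n + 3)" "(fps_X :: int fps) ^ Suc (Suc n) dvd fps_X ^ (2 * n + 2)"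
    by (intro le_imp_power_dvd; simp)+
  moreover have "fps_X ^ Suc (Suc n) dvd ee (n + 2)"
    using X_dvd_ee[of "Suc (Suc n)"] by simp
  ultimately show ?case
    unfolding pp.simps by (intro dvd_add dvd_mult dvd_mult2)
qed

lemma fsummable_pp: "fsummable pp"
  by (rule fsummable_nat) (rule X_dvd_pp)

lemma fsummable_shift_prod:
  fixes f g :: "nat \<Rightarrow> int fps"
  assumes "fsummable f" "fsummable g"
  shows "fsummable (\<lambda>k. f k * g (k + j))"
  using fsummable_inj[OF fsummable_prod[OF assms], of "\<lambda>k. (k, k + j)"] by (simp add: inj_def)

lemma fsummable_pp_mult: "fsummable (\<lambda>k. g k * pp k)"
  by (rule fsummable_nat) (intro dvd_mult X_dvd_pp)

text \<open>Let P(x) be the series with coefficients \<open>pp\<close>. It satisfies P(x) =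
  (xq;q^2)_infinity + xq(1 + xq) P(xq^2), and \<open>dd\<close> are the coefficients of P(x) -
  (xq;q^2)_infinity, the part with n >= 1.\<close>

definition dd :: "nat \<Rightarrow> int fps" where
  "dd n = pp n - (-1) ^ n * ee n"

lemma dd_0 [simp]: "dd 0 = 0"
  by (simp add: dd_def)

lemma dd_Suc: "dd (Suc n) = fps_X ^ (2 * n + 1) * pp n + (case n of 0 \<Rightarrow> 0 | Suc m \<Rightarrow> fps_X ^ (2 * n) * pp m)"
  by (cases n) (simp_all add: dd_def One_nat_def numeral_3_eq_3)

text \<open>The difference equation of P paired with arbitrary weights; the two sums come from xq
  P(xq^2) and x^2 q^2 P(xq^2).\<close>

lemma dd_sum:
  "fsum (\<lambda>k. g k * dd (Suc k)) = fsum (\<lambda>k. fps_X ^ (2 * k + 1) * g k * pp k)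
    + fsum (\<lambda>k. fps_X ^ (2 * k + 2) * g (Suc k) * pp k)"
proof -
  let ?c = "\<lambda>n. g n * (case n of 0 \<Rightarrow> 0 | Suc m \<Rightarrow> fps_X ^ (2 * n) * pp m)"
  have sm: "fsummable ?c"
  proof (rule fsummable_nat)
    fix i
    show "fps_X ^ i dvd ?c i"
    proof (cases i)
      case (Suc m)
      have "(fps_X :: int fps) ^ i dvd fps_X ^ (2 * i)" by (intro le_imp_power_dvd) simp
      then show ?thesis unfolding Suc nat.case by (intro dvd_mult dvd_mult2)
    qed simp
  qed
  have "g k * dd (Suc k) = fps_X ^ (2 * k + 1) * g k * pp k + ?c k" for k
    unfolding dd_Suc by (simp add: algebra_simps)
  then have "fsum (\<lambda>k. g k * dd (Suc k)) = fsum (\<lambda>k. fps_X ^ (2 * k + 1) * g k * pp k) + fsum ?c"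
    using fsum_add[OF fsummable_pp_mult sm] by simp
  also have "fsum ?c = fsum (\<lambda>k. fps_X ^ (2 * k + 2) * g (Suc k) * pp k)"
    by (subst fsum_Suc[OF sm]) (simp add: mult_ac)
  finally show ?thesis .
qed

lemma fsummable_dd: "fsummable dd"
  using fsummable_add[OF fsummable_pp fsummable_cmult[OF fsummable_ee_alt, of "-1"]]
  by (simp add: dd_def[abs_def])

text \<open>With P(x) the series of the \<open>pp\<close>, \<open>alpha j\<close> and
  \<open>beta j\<close> are the coefficients of x^j and x^-j in (-q/x;q^2)_infinity P(x), and
  \<open>gamma j\<close> is that of x^-j in (-q/x;q^2)_infinity (xq;q^2)_infinity.\<close>

definition alpha :: "nat \<Rightarrow> int fps" where "alpha j = fsum (\<lambda>k. ee k * pp (k + j))"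
definition beta :: "nat \<Rightarrow> int fps" where "beta j = fsum (\<lambda>k. ee (k + j) * pp k)"
definition gamma :: "nat \<Rightarrow> int fps" where "gamma j = fsum (\<lambda>k. (-1) ^ k * ee k * ee (k + j))"

text \<open>Expanding \<open>pp\<close> by its recurrence produces the weighted sums
  \<open>S1\<close> and \<open>S0\<close>. The ratio of consecutive \<open>ee\<close> gives S0 =
  alpha j - q S1, and then S1 cancels, as \<open>T\<close> does in \<open>dterm_Suc\<close>.\<close>

lemma alpha_rec: "alpha (j + 2) = (-1) ^ j * gamma (j + 2) + fps_X ^ (2 * j + 2) * alpha j"
proof -
  have sm3: "fsummable (\<lambda>k. (fps_X ^ (2 * k) * ee k) * pp (k + i))" for i
    using fsummable_shift_prod[OF fsummable_eterm[of "1 + 2" 1 2] fsummable_pp, of i]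
    by (simp only: eterm_shift)
  have smg: "fsummable (\<lambda>k. ((-1) ^ k * ee k) * ee (k + i))" for i
    by (rule fsummable_shift_prod[OF fsummable_ee_alt fsummable_ee])
  have sma: "fsummable (\<lambda>k. ee k * pp (k + i))" for i
    by (rule fsummable_shift_prod[OF fsummable_ee fsummable_pp])
  define S1 where "S1 = fsum (\<lambda>k. (fps_X ^ (2 * k) * ee k) * pp (k + Suc j))"
  define S0 where "S0 = fsum (\<lambda>k. (fps_X ^ (2 * k) * ee k) * pp (k + j))"
  have expand: "ee k * pp (k + (j + 2)) = (-1) ^ j * (((-1) ^ k * ee k) * ee (k + (j + 2)))
      + (fps_X ^ (2 * j + 3) * ((fps_X ^ (2 * k) * ee k) * pp (k + Suc j))
        + fps_X ^ (2 * j + 2) * ((fps_X ^ (2 * k) * ee k) * pp (k + j)))" for k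
  proof -
    have "pp (k + (j + 2)) = (-1) ^ (k + j) * ee (k + (j + 2)) + fps_X ^ (2 * (k + j) + 3) * pp (k + Suc j)
        + fps_X ^ (2 * (k + j) + 2) * pp (k + j)"
      using pp.simps(3)[of "k + j"] by (simp add: add_ac)
    then show ?thesis by (simp add: algebra_simps power_add)
  qed
  have "alpha (j + 2) = (-1) ^ j * gamma (j + 2) + (fps_X ^ (2 * j + 3) * S1 + fps_X ^ (2 * j + 2) * S0)"
    unfolding alpha_def expand gamma_def S1_def S0_def
    by (simp only: fsum_add[OF fsummable_cmult[OF smg] fsummable_add[OF fsummable_cmult[OF sm3] fsummable_cmult[OF sm3]]]
        fsum_add[OF fsummable_cmult[OF sm3] fsummable_cmult[OF sm3]] fsum_cmult[OF smg] fsum_cmult[OF sm3])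
  moreover have "S0 = alpha j - fps_X * S1"
  proof -
    have "alpha j - S0 = fsum (\<lambda>k. ee k * pp (k + j) - (fps_X ^ (2 * k) * ee k) * pp (k + j))"
      unfolding alpha_def S0_def by (rule fsum_diff[OF sma sm3, symmetric])
    also have "\<dots> = fsum (\<lambda>k. ee (Suc k) * pp (Suc k + j) - (fps_X ^ (2 * Suc k) * ee (Suc k)) * pp (Suc k + j))"
    proof (subst fsum_Suc)
      show "fsummable (\<lambda>k. ee k * pp (k + j) - (fps_X ^ (2 * k) * ee k) * pp (k + j))"
        using fsummable_add[OF sma fsummable_cmult[OF sm3, of "-1"], of j j] by simp
    qed simp
    also have "\<dots> = fsum (\<lambda>k. fps_X * ((fps_X ^ (2 * k) * ee k) * pp (k + Suc j)))"
    proof -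
      have "ee (Suc k) * pp (Suc k + j) - (fps_X ^ (2 * Suc k) * ee (Suc k)) * pp (Suc k + j)
          = ((1 - fps_X ^ (2 * k + 2)) * ee (Suc k)) * pp (k + Suc j)" for k
        by (simp add: algebra_simps)
      moreover have "((1 - fps_X ^ (2 * k + 2)) * ee (Suc k)) * pp (k + Suc j) = fps_X * ((fps_X ^ (2 * k) * ee k) * pp (k + Suc j))" for k
        unfolding ee_Suc by (simp add: power_add mult_ac)
      ultimately show ?thesis by presburger
    qed
    also have "\<dots> = fps_X * S1" unfolding S1_def by (rule fsum_cmult[OF sm3])
    finally show ?thesis by (simp add: algebra_simps)
  qed
  ultimately show ?thesis by (simp add: algebra_simps numeral_3_eq_3)
qed

lemma beta_minus_gamma: "beta j - gamma j = fsum (\<lambda>k. ee (k + j) * dd k)"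
proof -
  have "beta j - gamma j = fsum (\<lambda>k. ee (k + j) * pp k - ((-1) ^ k * ee k) * ee (k + j))"
    unfolding beta_def gamma_def
    by (rule fsum_diff[OF fsummable_pp_mult fsummable_shift_prod[OF fsummable_ee_alt fsummable_ee], symmetric])
  then show ?thesis by (simp add: dd_def algebra_simps)
qed

lemma fsum_dd_Suc: "fsum (\<lambda>k. g k * dd k) = fsum (\<lambda>k. g (Suc k) * dd (Suc k))"
proof (subst fsum_Suc)
  have "fps_X ^ n dvd dd n" for n
    unfolding dd_def by (intro dvd_diff X_dvd_pp dvd_mult X_dvd_ee)
  then show "fsummable (\<lambda>k. g k * dd k)"
    by (intro fsummable_nat dvd_mult)
qed simp

text \<open>Here the difference equation of P is applied to \<open>beta j - gamma j\<close>; the two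
  weights that arise combine, by the ratio of consecutive \<open>ee\<close>, into the single
  \<open>ee (k + (j + 2))\<close>.\<close>

lemma beta_rec: "beta (j + 2) = fps_X ^ (2 * j + 2) * (beta j - gamma j)"
proof -
  have "beta j - gamma j = fsum (\<lambda>k. fps_X ^ (2 * k + 1) * ee (Suc k + j) * pp k)
      + fsum (\<lambda>k. fps_X ^ (2 * k + 2) * ee (Suc (Suc k) + j) * pp k)"
    unfolding beta_minus_gamma by (subst fsum_dd_Suc) (rule dd_sum)
  also have "\<dots> = fsum (\<lambda>k. fps_X ^ (2 * k + 1) * ee (Suc k + j) * pp k
      + fps_X ^ (2 * k + 2) * ee (Suc (Suc k) + j) * pp k)"
    by (rule fsum_add[OF fsummable_pp_mult fsummable_pp_mult, symmetric])
  finally have "fps_X ^ (2 * j + 2) * (beta j - gamma j) = fsum (\<lambda>k. fps_X ^ (2 * j + 2) *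
      (fps_X ^ (2 * k + 1) * ee (Suc k + j) * pp k + fps_X ^ (2 * k + 2) * ee (Suc (Suc k) + j) * pp k))"
    by (simp only: fsum_cmult[OF fsummable_add[OF fsummable_pp_mult fsummable_pp_mult]])
  also have "\<dots> = fsum (\<lambda>k. ee (k + (j + 2)) * pp k)"
  proof -
    have "fps_X ^ (2 * j + 2) * (fps_X ^ (2 * k + 1) * ee (Suc k + j) * pp k
        + fps_X ^ (2 * k + 2) * ee (Suc (Suc k) + j) * pp k) = ee (k + (j + 2)) * pp k" for k
    proof -
      have "ee (Suc (Suc (k + j))) = fps_X ^ (2 * Suc (k + j) + 1) * ee (Suc (k + j))
          + fps_X ^ (2 * Suc (k + j) + 2) * ee (Suc (Suc (k + j)))"
        using ee_Suc[of "Suc (k + j)"] by (simp add: algebra_simps)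
      then have "ee (k + (j + 2)) * pp k = (fps_X ^ (2 * Suc (k + j) + 1) * ee (Suc (k + j))
          + fps_X ^ (2 * Suc (k + j) + 2) * ee (Suc (Suc (k + j)))) * pp k"
        by simp
      also have "\<dots> = fps_X ^ (2 * j + 2) * (fps_X ^ (2 * k + 1) * ee (Suc k + j) * pp k
        + fps_X ^ (2 * k + 2) * ee (Suc (Suc k) + j) * pp k)"
      proof -
        have "2 * Suc (k + j) + 1 = (2 * j + 2) + (2 * k + 1)" "2 * Suc (k + j) + 2 = (2 * j + 2) + (2 * k + 2)"
          by simp_all
        then have "(fps_X :: int fps) ^ (2 * Suc (k + j) + 1) = fps_X ^ (2 * j + 2) * fps_X ^ (2 * k + 1)"
          "(fps_X :: int fps) ^ (2 * Suc (k + j) + 2) = fps_X ^ (2 * j + 2) * fps_X ^ (2 * k + 2)"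
          by (simp_all only: power_add)
        then show ?thesis
          by (simp only: distrib_left distrib_right mult_ac add_Suc)
      qed
      finally show ?thesis ..
    qed
    then show ?thesis by simp
  qed
  finally show ?thesis by (simp add: beta_def)
qed

text \<open>In terms of \<open>rr\<close> below this is the step from x^-1 to x^1: the difference
  equation makes the two coefficients equal, the symmetry x -> -1/x makes them opposite, so both
  vanish.\<close>

lemma alpha_1: "alpha 1 = beta 1 - gamma 1"
proof -
  have sm1: "fsummable (\<lambda>k. ((-1) ^ k * ee k) * ee (k + 1))"
    by (rule fsummable_shift_prod[OF fsummable_ee_alt fsummable_ee])
  have sm2: "fsummable (\<lambda>k. ee k * dd (k + 1))"
    by (rule fsummable_shift_prod[OF fsummable_ee fsummable_dd])
  have "ee k * pp (k + 1) = ee k * dd (k + 1) - ((-1) ^ k * ee k) * ee (k + 1)" for k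
    by (simp add: dd_def algebra_simps power_add)
  then have "alpha 1 = fsum (\<lambda>k. ee k * dd (k + 1)) - gamma 1"
    using fsum_diff[OF sm2 sm1] by (simp add: alpha_def gamma_def)
  also have "fsum (\<lambda>k. ee k * dd (k + 1)) = fsum (\<lambda>k. ee (Suc k) * pp k)"
  proof -
    have "fsum (\<lambda>k. ee k * dd (Suc k)) = fsum (\<lambda>k. fps_X ^ (2 * k + 1) * ee k * pp k
        + fps_X ^ (2 * k + 2) * ee (Suc k) * pp k)"
      unfolding dd_sum by (rule fsum_add[OF fsummable_pp_mult fsummable_pp_mult, symmetric])
    also have "\<dots> = fsum (\<lambda>k. ee (Suc k) * pp k)"
      unfolding ee_Suc[symmetric] by (simp add: algebra_simps)
    finally show ?thesis by (simp only: Suc_eq_plus1)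
  qed
  finally show ?thesis by (simp only: beta_def Suc_eq_plus1)
qed

text \<open>
  \<open>rr j\<close> is the coefficient of \<open>x\<^sup>j\<close> in
  \<open>(xq;q\<^sup>2)\<^sub>\<infinity> (-q/x;q\<^sup>2)\<^sub>\<infinity> \<Sum>\<^sub>n x\<^sup>n q^{n\<^sup>2} (-xq;q\<^sup>2)\<^sub>n / (xq;q\<^sup>2)\<^sub>n\<close>, the sum being over
  all integers \<open>n\<close>; the substitution \<open>x \<mapsto> -1/x\<close> gives \<open>(-1)\<^sup>j rr j\<close> as the coefficient of \<open>x\<^sup>-\<^sup>j\<close>.
\<close>

definition rr :: "nat \<Rightarrow> int fps" where
  "rr j = alpha j + (-1) ^ j * (beta j - gamma j)"

lemma rr_rec: "rr (j + 2) = fps_X ^ (2 * j + 2) * rr j"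
  unfolding rr_def alpha_rec beta_rec by (simp add: algebra_simps)

lemma rr_odd: "rr (2 * j + 1) = 0"
proof (induction j)
  case 0
  show ?case by (simp add: rr_def alpha_1)
next
  case (Suc j)
  then show ?case using rr_rec[of "2 * j + 1"] by (simp add: add_ac)
qed

lemma rr_even: "rr (2 * j) = fps_X ^ (2 * j\<^sup>2) * rr 0"
proof (induction j)
  case (Suc j)
  have "2 * (Suc j)\<^sup>2 = (2 * (2 * j) + 2) + 2 * j\<^sup>2" by (simp add: power2_eq_square)
  then show ?case using rr_rec[of "2 * j"] Suc by (simp only: power_add mult.assoc) simp
qed simp

text \<open>Gauss: \<open>\<Sum>\<^sub>k (-1)\<^sup>k [M, k]\<^sub>q\<close>, divided by \<open>(q;q)\<^sub>M\<close>.\<close>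

definition gsum :: "nat \<Rightarrow> nat \<Rightarrow> int fps" where
  "gsum L M = (\<Sum>k\<le>M. (-1) ^ k * iqfac L k * iqfac L (M - k))"

text \<open>With Q = q^L, \<open>gsum L M\<close> is the coefficient of z^M in 1/((z;Q)_infinity
  (-z;Q)_infinity) = 1/(z^2;Q^2)_infinity, and z -> Qz multiplies this by 1 - z^2. The proof reaches
  the recurrence in two steps of length one, through the sums \<open>t\<close> weighted by
  Q^k.\<close>

lemma gsum_rec:
  assumes L: "L > 0"
  shows "(1 - fps_X ^ (L * (M + 2))) * gsum L (M + 2) = gsum L M"
proof -
  define c where "c = iqfac L"
  define Q where "Q = (\<lambda>k. (fps_X :: int fps) ^ (L * k))"
  have Q: "Q (i + j) = Q i * Q j" "Q 0 = 1" for i j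
    by (simp_all add: Q_def power_add algebra_simps)
  have c: "(1 - Q (Suc k)) * c (Suc k) = c k" for k
    unfolding c_def Q_def by (rule iqfac_Suc[OF L])
  define t where "t = (\<lambda>M. \<Sum>k\<le>M. (-1) ^ k * Q k * c k * c (M - k))"
  define g where "g = (\<lambda>M. \<Sum>k\<le>M. (-1) ^ k * c k * c (M - k))"
  have low: "(\<Sum>k\<le>Suc M. (-1) ^ k * (1 - Q k) * c k * c (Suc M - k)) = - g M" for M
  proof -
    have "(\<Sum>k\<le>Suc M. (-1) ^ k * (1 - Q k) * c k * c (Suc M - k))
        = (\<Sum>k\<le>M. (-1) ^ Suc k * ((1 - Q (Suc k)) * c (Suc k)) * c (M - k))"
      by (subst sum.atMost_Suc_shift) (simp add: Q mult.assoc)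
    also have "\<dots> = - g M"
      unfolding c g_def by (simp add: sum_negf[symmetric])
    finally show ?thesis .
  qed
  have high: "(\<Sum>k\<le>Suc M. (-1) ^ k * Q k * c k * ((1 - Q (Suc M - k)) * c (Suc M - k))) = t M" for M
    unfolding t_def by (simp add: Q Suc_diff_le c)
  have g: "(1 - Q (Suc M)) * g (Suc M) = t M - g M" for M
  proof -
    \<comment> \<open>1 - Q^(M+1) = (1 - Q^k) + Q^k (1 - Q^(M+1-k)); each bracket cancels a factor
      of one of the two denominators.\<close>
    have "(1 - Q (Suc M)) * g (Suc M) = (\<Sum>k\<le>Suc M. (-1) ^ k * (1 - Q k) * c k * c (Suc M - k))
        + (\<Sum>k\<le>Suc M. (-1) ^ k * Q k * c k * ((1 - Q (Suc M - k)) * c (Suc M - k)))"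
      unfolding g_def sum_distrib_left sum.distrib[symmetric]
    proof (intro sum.cong refl)
      fix k assume "k \<in> {..Suc M}"
      then have "Q (Suc M) = Q k * Q (Suc M - k)" by (simp add: Q(1)[symmetric])
      then show "(1 - Q (Suc M)) * ((-1) ^ k * c k * c (Suc M - k)) =
          (-1) ^ k * (1 - Q k) * c k * c (Suc M - k)
          + (-1) ^ k * Q k * c k * ((1 - Q (Suc M - k)) * c (Suc M - k))"
        by (simp add: algebra_simps)
    qed
    then show ?thesis unfolding low high by simp
  qed
  have "t (Suc M) - g (Suc M) = - (\<Sum>k\<le>Suc M. (-1) ^ k * (1 - Q k) * c k * c (Suc M - k))" for M
    unfolding t_def g_def by (simp add: sum_subtractf[symmetric] sum_negf[symmetric] algebra_simps del: sum.atMost_Suc)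
  then have "(1 - Q (Suc (Suc M))) * g (Suc (Suc M)) = g M"
    unfolding g low by simp
  then show ?thesis by (simp add: g_def gsum_def c_def Q_def del: sum.atMost_Suc)
qed

lemma one_minus_X_power_nonzero: "n > 0 \<Longrightarrow> 1 - fps_X ^ n \<noteq> (0 :: int fps)"
proof
  assume "n > 0" "1 - fps_X ^ n = (0 :: int fps)"
  then have "fps_nth (1 - fps_X ^ n :: int fps) 0 = 0" by simp
  with \<open>n > 0\<close> show False by (simp add: fps_X_power_nth)
qed

lemma gsum_even:
  assumes L: "L > 0"
  shows "gsum L (2 * l) = iqfac (2 * L) l"
proof (induction l)
  case 0
  show ?case using L by (simp add: gsum_def)
next
  case (Suc l)
  have "(1 - fps_X ^ (2 * L * Suc l)) * gsum L (2 * Suc l) = gsum L (2 * l)"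
    using gsum_rec[OF L, of "2 * l"] by (simp add: algebra_simps)
  also have "\<dots> = (1 - fps_X ^ (2 * L * Suc l)) * iqfac (2 * L) (Suc l)"
    using L Suc iqfac_Suc[of "2 * L" l] by simp
  finally show ?case
    using one_minus_X_power_nonzero[of "2 * L * Suc l"] L by simp
qed

section \<open>The constant term of the bilateral series\<close>

lemma fsum_offset:
  fixes f :: "nat \<Rightarrow> 'a::comm_ring_1 fps"
  assumes "fsummable f" "\<And>i. i < n \<Longrightarrow> f i = 0"
  shows "fsum f = fsum (\<lambda>i. f (i + n))"
  using assms(2)
proof (induction n)
  case (Suc n)
  have "fsummable (\<lambda>i. f (i + n))"
    using fsummable_inj[OF assms(1), of "\<lambda>i. i + n"] by simp
  then show ?case using Suc fsum_Suc[of "\<lambda>i. f (i + n)"] by simp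
qed simp

lemma fsum_finite:
  assumes "finite S" "\<And>i. i \<notin> S \<Longrightarrow> f i = 0"
  shows "fsum f = sum f S"
proof (rule fps_ext)
  fix m
  have "fps_nth (fsum f) m = (\<Sum>i\<in>S. fps_nth (f i) m)"
    by (rule fsum_nth) (use assms in fastforce)+
  then show "fps_nth (fsum f) m = fps_nth (sum f S) m"
    by (simp add: fps_sum_nth)
qed

lemma ee_eq: "ee k = fps_X ^ (k\<^sup>2) * iqfac 2 k"
proof -
  have "k + 2 * (k choose 2) = k\<^sup>2"
    by (induction k) (simp_all add: choose2_Suc power2_eq_square)
  then show ?thesis by (simp add: eterm_def)
qed

text \<open>\<open>gamma\<close> and, next, \<open>beta\<close> at even index, freed of the power
  q^(2 i^2) that \<open>rr_even\<close> also carries; this turns the recurrence of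
  \<open>beta\<close> into a telescoping one.\<close>

definition gamma' :: "nat \<Rightarrow> int fps" where
  "gamma' i = fsum (\<lambda>k. (-1) ^ k * fps_X ^ (2 * (k + i)\<^sup>2) * iqfac 2 k * iqfac 2 (k + 2 * i))"

definition beta' :: "nat \<Rightarrow> int fps" where
  "beta' i = fsum (\<lambda>k. fps_X ^ (2 * i\<^sup>2 + 4 * i * k + k\<^sup>2) * iqfac 2 (k + 2 * i) * pp k)"

lemma gamma_even: "gamma (2 * i) = fps_X ^ (2 * i\<^sup>2) * gamma' i"
proof -
  have sm: "fsummable (\<lambda>k. (-1) ^ k * fps_X ^ (2 * (k + i)\<^sup>2) * iqfac 2 k * iqfac 2 (k + 2 * i) :: int fps)"
  proof (rule fsummable_nat)
    fix k
    have "k \<le> 2 * (k + i)\<^sup>2" using le_square[of "k + i"] unfolding power2_eq_square by linarith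
    then have "(fps_X :: int fps) ^ k dvd fps_X ^ (2 * (k + i)\<^sup>2)" by (rule le_imp_power_dvd)
    then show "fps_X ^ k dvd (-1) ^ k * fps_X ^ (2 * (k + i)\<^sup>2) * iqfac 2 k * iqfac 2 (k + 2 * i)"
      by (intro dvd_mult2 dvd_mult)
  qed
  have "k\<^sup>2 + (k + 2 * i)\<^sup>2 = 2 * i\<^sup>2 + 2 * (k + i)\<^sup>2" for k
    by (simp add: power2_eq_square algebra_simps)
  then have exp: "(fps_X :: int fps) ^ (k\<^sup>2) * fps_X ^ ((k + 2 * i)\<^sup>2) = fps_X ^ (2 * i\<^sup>2) * fps_X ^ (2 * (k + i)\<^sup>2)" for k
    by (simp only: power_add[symmetric])
  have "(-1) ^ k * ee k * ee (k + 2 * i)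
      = (-1) ^ k * iqfac 2 k * iqfac 2 (k + 2 * i) * (fps_X ^ (k\<^sup>2) * fps_X ^ ((k + 2 * i)\<^sup>2))" for k
    by (simp add: ee_eq mult_ac)
  then have "gamma (2 * i) = fsum (\<lambda>k. fps_X ^ (2 * i\<^sup>2) *
      ((-1) ^ k * fps_X ^ (2 * (k + i)\<^sup>2) * iqfac 2 k * iqfac 2 (k + 2 * i)))"
    unfolding gamma_def exp by (simp add: mult_ac)
  then show ?thesis unfolding gamma'_def fsum_cmult[OF sm] .
qed

lemma beta_even: "beta (2 * i) = fps_X ^ (2 * i\<^sup>2) * beta' i"
proof -
  have "(k + 2 * i)\<^sup>2 = 2 * i\<^sup>2 + (2 * i\<^sup>2 + 4 * i * k + k\<^sup>2)" for k
    by (simp add: power2_eq_square algebra_simps)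
  then have exp: "(fps_X :: int fps) ^ ((k + 2 * i)\<^sup>2) = fps_X ^ (2 * i\<^sup>2) * fps_X ^ (2 * i\<^sup>2 + 4 * i * k + k\<^sup>2)" for k
    by (simp only: power_add[of _ "2 * i\<^sup>2", symmetric])
  have "beta (2 * i) = fsum (\<lambda>k. fps_X ^ (2 * i\<^sup>2) *
      (fps_X ^ (2 * i\<^sup>2 + 4 * i * k + k\<^sup>2) * iqfac 2 (k + 2 * i) * pp k))"
    unfolding beta_def ee_eq exp by (simp add: mult_ac)
  then show ?thesis unfolding beta'_def fsum_cmult[OF fsummable_pp_mult] .
qed

lemma beta'_Suc: "beta' (Suc i) = beta' i - gamma' i"
proof -
  have "beta (2 * Suc i) = fps_X ^ (2 * (2 * i) + 2) * (beta (2 * i) - gamma (2 * i))"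
    using beta_rec[of "2 * i"] by simp
  then have "fps_X ^ (2 * (Suc i)\<^sup>2) * beta' (Suc i)
      = fps_X ^ (2 * (2 * i) + 2 + 2 * i\<^sup>2) * (beta' i - gamma' i)"
    unfolding beta_even gamma_even by (simp add: power_add algebra_simps)
  moreover have "2 * (2 * i) + 2 + 2 * i\<^sup>2 = 2 * (Suc i)\<^sup>2"
    by (simp add: power2_eq_square)
  ultimately show ?thesis by (simp del: power_Suc)
qed

lemma fsummable_beta': "fsummable beta'"
proof (rule fsummable_nat)
  fix i
  have "fps_X ^ i dvd fps_X ^ (2 * i\<^sup>2 + 4 * i * k + k\<^sup>2) * iqfac 2 (k + 2 * i) * pp k" for k
  proof -
    have "i \<le> 2 * i\<^sup>2" by (simp add: power2_eq_square)
    then have "i \<le> 2 * i\<^sup>2 + 4 * i * k + k\<^sup>2" by simp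
    then have "(fps_X :: int fps) ^ i dvd fps_X ^ (2 * i\<^sup>2 + 4 * i * k + k\<^sup>2)"
      by (rule le_imp_power_dvd)
    then show ?thesis by (intro dvd_mult2)
  qed
  then show "fps_X ^ i dvd beta' i" unfolding beta'_def by (rule fsum_dvd)
qed

text \<open>A telescoping sum; no boundary term remains because \<open>beta' i\<close> is divisible
  by X^i.\<close>

lemma fsum_gamma': "fsummable gamma'" "fsum gamma' = beta' 0"
proof -
  have sm: "fsummable (\<lambda>i. beta' (Suc i))"
    by (rule fsummable_inj[OF fsummable_beta']) simp
  have eq: "gamma' = (\<lambda>i. beta' i - beta' (Suc i))"
    by (rule ext) (simp add: beta'_Suc)
  show "fsummable gamma'"
    unfolding eq using fsummable_add[OF fsummable_beta' fsummable_cmult[OF sm, of "-1"]] by simp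
  show "fsum gamma' = beta' 0"
    unfolding eq fsum_diff[OF fsummable_beta' sm] using fsum_Suc[OF fsummable_beta'] by simp
qed

text \<open>Since \<open>beta 0\<close> is the sum of all \<open>gamma' i\<close>,
  \<open>rr 0 = 2 * beta 0 - gamma 0\<close> is the sum of \<open>gamma'\<close> at |i| over all
  integers i. These values are the diagonals of the array \<open>K\<close>; its rows are Gauss sums,
  and adding them up gives Euler's series for (-q^2;q^4)_infinity.\<close>

lemma rr_0: "rr 0 = qprod 1 2 4"
proof -
  define K where "K = (\<lambda>(l, k). if k \<le> 2 * l then (-1) ^ k * fps_X ^ (2 * l\<^sup>2) * iqfac 2 k * iqfac 2 (2 * l - k) else 0 :: int fps)"
  have smK: "fsummable K"
    unfolding fsummable_def
  proof
    fix m
    have "l \<le> m \<and> k \<le> 2 * m" if "fps_nth (K (l, k)) m \<noteq> 0" for l k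
    proof -
      have k: "k \<le> 2 * l" using that by (auto simp: K_def split: if_splits)
      then have "K (l, k) = fps_X ^ (2 * l\<^sup>2) * ((-1) ^ k * iqfac 2 k * iqfac 2 (2 * l - k))"
        by (simp add: K_def mult_ac)
      then have "2 * l\<^sup>2 \<le> m" using that by (auto simp: fps_X_power_mult_nth split: if_splits)
      moreover have "l \<le> 2 * l\<^sup>2" by (simp add: power2_eq_square)
      ultimately show ?thesis using k by linarith
    qed
    then have "{p. fps_nth (K p) m \<noteq> 0} \<subseteq> {..m} \<times> {..2 * m}" by auto
    then show "finite {p. fps_nth (K p) m \<noteq> 0}" by (rule finite_subset) simp
  qed
  have row: "fsum (\<lambda>k. K (l, k)) = eterm 1 2 4 l" for l
  proof -
    have "fsum (\<lambda>k. K (l, k)) = (\<Sum>k\<le>2 * l. K (l, k))"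
      by (rule fsum_finite) (auto simp: K_def)
    also have "\<dots> = fps_X ^ (2 * l\<^sup>2) * gsum 2 (2 * l)"
      unfolding gsum_def sum_distrib_left by (intro sum.cong refl) (simp add: K_def mult_ac)
    also have "\<dots> = fps_X ^ (2 * l\<^sup>2) * iqfac 4 l"
      by (simp add: gsum_even)
    also have "2 * l\<^sup>2 = 2 * l + 4 * (l choose 2)"
      by (induction l) (simp_all add: choose2_Suc power2_eq_square)
    finally show ?thesis by (simp add: eterm_def)
  qed
  have upper: "fsum (\<lambda>l. K (l, l + j)) = gamma' j" for j
  proof -
    have "K (m + j, m + j + j) = (-1) ^ m * fps_X ^ (2 * (m + j)\<^sup>2) * iqfac 2 m * iqfac 2 (m + 2 * j)" for m
    proof -
      have 1: "m + j + j = m + 2 * j" and 2: "2 * (m + j) - (m + 2 * j) = m" by simp_all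
      show ?thesis unfolding 1 by (simp add: K_def 2 power_add mult_ac)
    qed
    moreover have "fsummable (\<lambda>l. K (l, l + j))"
      using fsummable_inj[OF smK, of "\<lambda>l. (l, l + j)"] by (simp add: inj_def)
    \<comment> \<open>For l < j the second index l + j exceeds 2l and the entry is 0, so the
      diagonal effectively starts at l = j.\<close>
    then have "fsum (\<lambda>l. K (l, l + j)) = fsum (\<lambda>m. K (m + j, m + j + j))"
      by (rule fsum_offset) (simp add: K_def)
    ultimately show ?thesis by (simp only: gamma'_def)
  qed
  have lower: "fsum (\<lambda>k. K (k + Suc j, k)) = gamma' (Suc j)" for j
  proof -
    have "K (k + Suc j, k) = (-1) ^ k * fps_X ^ (2 * (k + Suc j)\<^sup>2) * iqfac 2 k * iqfac 2 (k + 2 * Suc j)" for k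
    proof -
      have "2 * (k + Suc j) - k = k + 2 * Suc j" by simp
      then show ?thesis by (simp add: K_def)
    qed
    then show ?thesis by (simp add: gamma'_def)
  qed
  have "qprod 1 2 4 = fsum K"
    unfolding qprod_def fsum_pair[OF smK] row ..
  also have "\<dots> = fsum gamma' + fsum (\<lambda>j. gamma' (Suc j))"
    unfolding fsum_diagonals[OF smK] upper lower ..
  also have "\<dots> = 2 * fsum gamma' - gamma' 0"
    using fsum_Suc[OF fsum_gamma'(1)] by simp
  also have "\<dots> = 2 * beta 0 - gamma 0"
    using beta_even[of 0] gamma_even[of 0] by (simp add: fsum_gamma'(2))
  also have "\<dots> = rr 0"
    by (simp add: rr_def alpha_def beta_def)
  finally show ?thesis ..
qed

text \<open>The bilateral series at x = 1. Its negative-index terms are those of positive index at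
  -1/x = -1, and the subtracted product removes the term n = 0, which both series contain. As a sum
  of Laurent coefficients, x^j and x^-j together contribute (1 + (-1)^j) \<open>rr j\<close> for j >
  0, so \<open>rr_even\<close> and \<open>rr_0\<close> give the value.\<close>

lemma bilateral_sum:
  "qprod 1 1 2 * fsum pp + qprod (-1) 1 2 * fsum (\<lambda>n. (-1) ^ n * pp n) - qprod 1 1 2 * qprod (-1) 1 2
    = qprod 1 2 4 * theta 1 2 2"
proof -
  have smp: "fsummable (\<lambda>n. (-1) ^ n * pp n)"
    by (rule fsummable_pp_mult)
  have qm: "qprod (-1) 1 2 = fsum (\<lambda>k. (-1) ^ k * ee k)"
    by (simp add: qprod_def eterm_m1[abs_def])
  let ?s = "\<lambda>j. (-1) ^ j :: int fps"
  have sma: "fsummable (\<lambda>k. ee k * pp (k + j))" for j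
    by (rule fsummable_shift_prod[OF fsummable_ee fsummable_pp])
  have smg: "fsummable (\<lambda>k. ((-1) ^ k * ee k) * ee (k + j))" for j
    by (rule fsummable_shift_prod[OF fsummable_ee_alt fsummable_ee])
  have SA: "fsummable alpha"
    using fsummable_fsum_diagonal[OF fsummable_prod[OF fsummable_ee fsummable_pp]]
    by (simp add: alpha_def[abs_def])
  have SB: "fsummable beta"
    using fsummable_fsum_diagonal[OF fsummable_prod[OF fsummable_pp fsummable_ee]]
    by (simp add: beta_def[abs_def] mult.commute)
  have SC: "fsummable gamma"
    using fsummable_fsum_diagonal[OF fsummable_prod[OF fsummable_ee_alt fsummable_ee]]
    by (simp add: gamma_def[abs_def])
  have S: "fsummable (\<lambda>i. f (Suc i))" if "fsummable f" for f :: "nat \<Rightarrow> int fps"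
    by (rule fsummable_inj[OF that]) simp
  have SM: "fsummable (\<lambda>i. ?s i * f i)" if "fsummable f" for f :: "nat \<Rightarrow> int fps"
    using that by (simp add: fsummable_def minus_one_power_iff)
  have sq: "?s k * ?s k = 1" for k by (simp flip: power_mult_distrib)
  have A: "qprod 1 1 2 * fsum pp = fsum alpha + fsum (\<lambda>j. beta (Suc j))"
    unfolding qprod_def fsum_prod[OF fsummable_ee fsummable_pp]
      fsum_diagonals[OF fsummable_prod[OF fsummable_ee fsummable_pp]]
    by (simp add: alpha_def[abs_def] beta_def)
  have B: "qprod (-1) 1 2 * fsum (\<lambda>n. (-1) ^ n * pp n)
      = fsum (\<lambda>j. ?s j * alpha j) + fsum (\<lambda>j. ?s (Suc j) * beta (Suc j))"
  proof -
    have "fsum (\<lambda>k. (?s k * ee k) * (?s (k + j) * pp (k + j))) = ?s j * alpha j" for j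
    proof -
      have "(?s k * ee k) * (?s (k + j) * pp (k + j)) = ?s j * (ee k * pp (k + j))" for k
      proof -
        have "(?s k * ee k) * (?s (k + j) * pp (k + j)) = (?s k * ?s k) * (?s j * (ee k * pp (k + j)))"
          by (simp add: power_add mult_ac)
        then show ?thesis unfolding sq by simp
      qed
      then show ?thesis unfolding alpha_def by (simp only: fsum_cmult[OF sma])
    qed
    moreover have "fsum (\<lambda>k. (?s (k + Suc j) * ee (k + Suc j)) * (?s k * pp k)) = ?s (Suc j) * beta (Suc j)" for j
    proof -
      have "(?s (k + Suc j) * ee (k + Suc j)) * (?s k * pp k) = ?s (Suc j) * (ee (k + Suc j) * pp k)" for k
      proof -
        have "(?s (k + Suc j) * ee (k + Suc j)) * (?s k * pp k) = (?s k * ?s k) * (?s (Suc j) * (ee (k + Suc j) * pp k))"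
          unfolding power_add[of _ k "Suc j"] by (simp only: mult_ac)
        then show ?thesis unfolding sq by simp
      qed
      then show ?thesis unfolding beta_def by (simp only: fsum_cmult[OF fsummable_pp_mult])
    qed
    ultimately show ?thesis
      unfolding qm fsum_prod[OF fsummable_ee_alt smp]
        fsum_diagonals[OF fsummable_prod[OF fsummable_ee_alt smp]] prod.case
      by presburger
  qed
  have C: "qprod 1 1 2 * qprod (-1) 1 2 = fsum gamma + fsum (\<lambda>j. ?s (Suc j) * gamma (Suc j))"
  proof -
    have "fsum (\<lambda>k. (?s (k + Suc j) * ee (k + Suc j)) * ee k) = ?s (Suc j) * gamma (Suc j)" for j
    proof -
      have "(?s (k + Suc j) * ee (k + Suc j)) * ee k = ?s (Suc j) * ((?s k * ee k) * ee (k + Suc j))" for k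
        unfolding power_add[of _ k "Suc j"] by (simp only: mult_ac)
      then show ?thesis unfolding gamma_def by (simp only: fsum_cmult[OF smg])
    qed
    then have "qprod (-1) 1 2 * qprod 1 1 2 = fsum gamma + fsum (\<lambda>j. ?s (Suc j) * gamma (Suc j))"
      unfolding qm qprod_def[of 1] fsum_prod[OF fsummable_ee_alt fsummable_ee]
        fsum_diagonals[OF fsummable_prod[OF fsummable_ee_alt fsummable_ee]] prod.case
      by (simp only: gamma_def[abs_def])
    then show ?thesis by (simp only: mult.commute)
  qed
  let ?a = "\<lambda>j. (1 + ?s (Suc j)) * rr (Suc j)"
  have tail: "fsum (\<lambda>j. alpha (Suc j)) + fsum (\<lambda>j. beta (Suc j))
      + (fsum (\<lambda>j. ?s (Suc j) * alpha (Suc j)) + fsum (\<lambda>j. ?s (Suc j) * beta (Suc j)))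
      - (fsum (\<lambda>j. gamma (Suc j)) + fsum (\<lambda>j. ?s (Suc j) * gamma (Suc j))) = fsum ?a"
  proof -
    have "?a j = alpha (Suc j) + beta (Suc j) + (?s (Suc j) * alpha (Suc j) + ?s (Suc j) * beta (Suc j))
        - (gamma (Suc j) + ?s (Suc j) * gamma (Suc j))" for j
    proof -
      have "?a j = alpha (Suc j) + ?s (Suc j) * alpha (Suc j)
          + (?s (Suc j) + ?s (Suc j) * ?s (Suc j)) * (beta (Suc j) - gamma (Suc j))"
        unfolding rr_def by (simp only: distrib_left distrib_right mult_1_left mult.assoc add_ac)
      then show ?thesis unfolding sq by (simp add: algebra_simps)
    qed
    then show ?thesis
      by (simp only: fsum_add fsum_diff fsummable_add S SA SB SC SM S[OF SM])
  qed
  have "fsum ?a = fsum (\<lambda>i. ?a (2 * i)) + fsum (\<lambda>i. ?a (2 * i + 1))"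
  proof (rule fsum_split)
    have "?a = (\<lambda>j. rr (Suc j) + ?s (Suc j) * rr (Suc j))"
      by (simp add: algebra_simps)
    moreover have "fsummable rr"
      using fsummable_add[OF SA SM[OF fsummable_add[OF SB fsummable_cmult[OF SC, of "-1"]]]]
      by (simp add: rr_def[abs_def])
    ultimately show "fsummable ?a"
      using fsummable_add[OF S S[OF SM]] by simp
    show "range (\<lambda>i::nat. 2 * i) \<inter> range (\<lambda>i. 2 * i + 1) = {}" by (auto, presburger)
    have "m \<in> range (\<lambda>i. 2 * i) \<union> range (\<lambda>i. 2 * i + 1)" for m :: nat
      by (cases "even m") (auto elim!: evenE oddE)
    then show "range (\<lambda>i::nat. 2 * i) \<union> range (\<lambda>i. 2 * i + 1) = UNIV" by blast
  qed (auto simp: inj_def)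
  moreover have "?a (2 * i) = 0" for i
    using rr_odd[of i] by simp
  moreover have "?a (2 * i + 1) = rr 0 * (2 * fps_X ^ (2 * (Suc i)\<^sup>2))" for i
    using rr_even[of "Suc i"] by (simp del: power_Suc)
  moreover have "fsum (\<lambda>i::nat. 0 :: int fps) = 0"
    by (simp add: fsum_def fps_eq_iff)
  ultimately have a: "fsum ?a = fsum (\<lambda>i. rr 0 * (2 * fps_X ^ (2 * (Suc i)\<^sup>2)))"
    by (simp only: add_0_left)
  have sms: "fsummable (\<lambda>i. fps_X ^ (2 * i\<^sup>2) :: int fps)"
    by (intro fsummable_nat le_imp_power_dvd) (simp add: power2_eq_square)
  have th: "theta 1 2 2 = 1 + fsum (\<lambda>i. 2 * fps_X ^ (2 * (Suc i)\<^sup>2))"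
  proof -
    have e: "2 * n + (2 + 2) * (n choose 2) = 2 * n\<^sup>2" for n :: nat
      by (induction n) (simp_all add: choose2_Suc power2_eq_square)
    have "theta 1 2 2 = fsum (\<lambda>n. fps_X ^ (2 * n\<^sup>2)) + fsum (\<lambda>n. fps_X ^ (2 * (Suc n)\<^sup>2))"
      using theta_halves[of 2 2 1] unfolding e by simp
    also have "fsum (\<lambda>n. fps_X ^ (2 * n\<^sup>2) :: int fps) = 1 + fsum (\<lambda>n. fps_X ^ (2 * (Suc n)\<^sup>2))"
      by (subst fsum_Suc[OF sms]) simp
    finally show ?thesis using fsum_cmult[OF S[OF sms], of 2] by simp
  qed
  have "fsum ?a = rr 0 * (theta 1 2 2 - 1)"
    unfolding a th by (subst fsum_cmult) (rule fsummable_cmult[OF S[OF sms]], simp)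
  moreover have "fsum alpha + fsum (\<lambda>j. beta (Suc j)) + (fsum (\<lambda>j. ?s j * alpha j) + fsum (\<lambda>j. ?s (Suc j) * beta (Suc j)))
      - (fsum gamma + fsum (\<lambda>j. ?s (Suc j) * gamma (Suc j))) = (2 * alpha 0 - gamma 0) + fsum ?a"
    unfolding tail[symmetric] fsum_Suc[OF SA] fsum_Suc[OF SC] fsum_Suc[OF SM[OF SA]] by simp
  moreover have "2 * alpha 0 - gamma 0 = rr 0"
    by (simp add: rr_def alpha_def beta_def)
  ultimately show ?thesis
    unfolding A B C rr_0 by (simp add: algebra_simps)
qed

section \<open>From the bilateral series back to \<open>v0\<close>\<close>

lemma iqfac_neg: "neg (iqfac 2 k) = iqfac 2 k"
proof (induction k)
  case (Suc k)
  have "(1 - fps_X ^ (2 * Suc k)) * neg (iqfac 2 (Suc k)) = neg ((1 - fps_X ^ (2 * Suc k)) * iqfac 2 (Suc k))"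
    by (simp add: neg_mult neg_diff neg_power del: mult_Suc_right power_Suc)
  also have "\<dots> = (1 - fps_X ^ (2 * Suc k)) * iqfac 2 (Suc k)"
    using Suc iqfac_Suc[of 2 k] by simp
  finally show ?case
    using one_minus_X_power_nonzero[of "2 * Suc k"] by simp
qed simp

lemma neg_ee: "neg (ee k) = (-1) ^ k * ee k"
proof -
  have "(-1 :: int fps) ^ k\<^sup>2 = (-1) ^ k" by (simp add: minus_one_power_iff)
  then show ?thesis
    by (simp add: ee_eq neg_mult iqfac_neg neg_power power_minus[of fps_X])
qed

text \<open>Changing the sign of q in P(x) amounts to changing that of x; this turns the series at x
  = -1 into V(-q).\<close>

lemma neg_pp: "neg (pp n) = (-1) ^ n * pp n"
proof (induction n rule: pp.induct)
  case 2
  show ?case by (simp add: neg_diff neg_ee)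
next
  case (3 n)
  have "(- fps_X :: int fps) ^ (2 * n + 3) = - (fps_X ^ (2 * n + 3))"
    "(- fps_X :: int fps) ^ (2 * n + 2) = fps_X ^ (2 * n + 2)"
    by simp_all
  with 3 show ?case
    by (simp add: neg_add neg_mult neg_power neg_uminus neg_ee algebra_simps)
qed simp

text \<open>The values P(q^(2j)). Iterating the difference equation of P from x = 1 through them
  produces the partial sums of the series defining \<open>v0\<close>, times
  (q;q^2)_infinity.\<close>

definition pser :: "nat \<Rightarrow> int fps" where
  "pser j = fsum (\<lambda>n. fps_X ^ (2 * j * n) * pp n)"

lemma pser_rec:
  "pser j = qprod (-1) (2 * j + 1) 2 + fps_X ^ (2 * j + 1) * (1 + fps_X ^ (2 * j + 1)) * pser (Suc j)"
proof -
  have smq: "fsummable (eterm (-1) (2 * j + 1) 2)"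
    by (rule fsummable_eterm) simp
  have e: "eterm (-1) (2 * j + 1) 2 n = fps_X ^ (2 * j * n) * ((-1) ^ n * ee n)" for n
    by (simp add: eterm_def algebra_simps power_add)
  have smd: "fsummable (\<lambda>n. fps_X ^ (2 * j * n) * dd n)"
  proof (rule fsummable_nat)
    fix n
    have "fps_X ^ n dvd dd n"
      unfolding dd_def by (intro dvd_diff X_dvd_pp dvd_mult X_dvd_ee)
    then show "fps_X ^ n dvd fps_X ^ (2 * j * n) * dd n" by (rule dvd_mult)
  qed
  have "pser j = fsum (\<lambda>n. eterm (-1) (2 * j + 1) 2 n + fps_X ^ (2 * j * n) * dd n)"
    unfolding pser_def e dd_def by (simp add: algebra_simps)
  also have "\<dots> = qprod (-1) (2 * j + 1) 2 + fsum (\<lambda>n. fps_X ^ (2 * j * n) * dd n)"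
    unfolding qprod_def by (rule fsum_add[OF smq smd])
  also have "fsum (\<lambda>n. fps_X ^ (2 * j * n) * dd n)
      = fsum (\<lambda>k. fps_X ^ (2 * k + 1) * fps_X ^ (2 * j * Suc k) * pp k)
      + fsum (\<lambda>k. fps_X ^ (2 * k + 2) * fps_X ^ (2 * j * Suc (Suc k)) * pp k)"
    by (subst fsum_dd_Suc) (rule dd_sum)
  also have "fsum (\<lambda>k. fps_X ^ (2 * k + 1) * fps_X ^ (2 * j * Suc k) * pp k)
      = fps_X ^ (2 * j + 1) * pser (Suc j)"
  proof -
    have "2 * k + 1 + 2 * j * Suc k = 2 * j + 1 + 2 * Suc j * k" for k by (simp add: algebra_simps)
    then have "fps_X ^ (2 * k + 1) * fps_X ^ (2 * j * Suc k) * pp k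
        = fps_X ^ (2 * j + 1) * (fps_X ^ (2 * Suc j * k) * pp k)" for k
      by (simp only: power_add[symmetric] mult.assoc[symmetric])
    then show ?thesis unfolding pser_def by (simp only: fsum_cmult[OF fsummable_pp_mult])
  qed
  also have "fsum (\<lambda>k. fps_X ^ (2 * k + 2) * fps_X ^ (2 * j * Suc (Suc k)) * pp k)
      = fps_X ^ (2 * j + 1 + (2 * j + 1)) * pser (Suc j)"
  proof -
    have "2 * k + 2 + 2 * j * Suc (Suc k) = 2 * j + 1 + (2 * j + 1) + 2 * Suc j * k" for k
      by (simp add: algebra_simps)
    then have "fps_X ^ (2 * k + 2) * fps_X ^ (2 * j * Suc (Suc k)) * pp k
        = fps_X ^ (2 * j + 1 + (2 * j + 1)) * (fps_X ^ (2 * Suc j * k) * pp k)" for k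
      by (simp only: power_add[symmetric] mult.assoc[symmetric])
    then show ?thesis unfolding pser_def by (simp only: fsum_cmult[OF fsummable_pp_mult])
  qed
  finally show ?thesis
    by (simp only: power_add distrib_left distrib_right mult_1_right mult.assoc)
qed

lemma qpoch_Suc: "qpoch a q (Suc n) = qpoch a q n * (1 - a * q ^ n)"
  by (simp add: qpoch_def)

lemma X_square_power: "fps_X * (fps_X\<^sup>2) ^ J = (fps_X ^ (2 * J + 1) :: int fps)"
  unfolding power_mult[symmetric] by (simp add: power_add mult.commute)

lemma qprod_qpoch: "qprod (-1) 1 2 = qpoch fps_X (fps_X\<^sup>2) J * qprod (-1) (2 * J + 1) 2"
proof (induction J)
  case (Suc J)
  have "qprod (-1) (2 * J + 1) 2 = (1 - fps_X * (fps_X\<^sup>2) ^ J) * qprod (-1) (2 * Suc J + 1) 2"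
  proof -
    have "2 * J + 1 + 2 = 2 * Suc J + 1" by simp
    then show ?thesis
      using qprod_rec[of "2 * J + 1" 2 "-1"] unfolding X_square_power by simp
  qed
  then show ?case unfolding qpoch_Suc mult.assoc by (simp only: Suc)
qed (simp add: qpoch_def)

lemma pser_iterate:
  "pser 0 = qprod (-1) 1 2 * (\<Sum>j<J. v0_term j)
    + fps_X ^ (J\<^sup>2) * qpoch (- fps_X) (fps_X\<^sup>2) J * pser J"
proof (induction J)
  case (Suc J)
  define B where "B = qpoch (- fps_X :: int fps) (fps_X\<^sup>2) J"
  have "qprod (-1) 1 2 * v0_term J = fps_X ^ (J\<^sup>2) * B * (qpoch fps_X (fps_X\<^sup>2) J
      * fps_right_inverse (qpoch fps_X (fps_X\<^sup>2) J) 1) * qprod (-1) (2 * J + 1) 2"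
    unfolding v0_term_def B_def by (subst qprod_qpoch[of J]) (simp only: mult_ac)
  then have "qprod (-1) 1 2 * v0_term J = fps_X ^ (J\<^sup>2) * B * qprod (-1) (2 * J + 1) 2"
    by (simp add: qpoch_mult_inverse)
  moreover have "fps_X ^ ((Suc J)\<^sup>2) * qpoch (- fps_X) (fps_X\<^sup>2) (Suc J)
      = fps_X ^ (J\<^sup>2) * B * (fps_X ^ (2 * J + 1) * (1 + fps_X ^ (2 * J + 1)))"
  proof -
    have "(Suc J)\<^sup>2 = J\<^sup>2 + (2 * J + 1)" by (simp add: power2_eq_square)
    then have 1: "(fps_X :: int fps) ^ ((Suc J)\<^sup>2) = fps_X ^ (J\<^sup>2) * fps_X ^ (2 * J + 1)"
      by (simp only: power_add)
    have 2: "1 - - fps_X * (fps_X\<^sup>2) ^ J = (1 + fps_X ^ (2 * J + 1) :: int fps)"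
      by (simp add: X_square_power)
    show ?thesis unfolding qpoch_Suc 1 2 B_def by (simp only: mult_ac)
  qed
  moreover have "pser 0 = qprod (-1) 1 2 * (\<Sum>j<J. v0_term j) + fps_X ^ (J\<^sup>2) * B
      * (qprod (-1) (2 * J + 1) 2 + fps_X ^ (2 * J + 1) * (1 + fps_X ^ (2 * J + 1)) * pser (Suc J))"
    using Suc pser_rec[of J] by (simp add: B_def)
  ultimately show ?case by (simp add: algebra_simps)
qed (simp add: qpoch_def)

lemma X_dvd_v0_term: "fps_X ^ n dvd v0_term n"
proof -
  have "fps_X ^ n dvd (fps_X :: int fps) ^ n\<^sup>2"
    by (intro le_imp_power_dvd) (simp add: power2_eq_square)
  then show ?thesis
    unfolding v0_term_def by (intro dvd_mult2)
qed

lemma fsummable_v0_term: "fsummable v0_term"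
  by (rule fsummable_nat) (rule X_dvd_v0_term)

lemma fsum_split_initial:
  fixes f :: "nat \<Rightarrow> 'a::comm_ring_1 fps"
  assumes "fsummable f"
  shows "fsum f = (\<Sum>i<n. f i) + fsum (\<lambda>i. f (i + n))"
proof (induction n)
  case (Suc n)
  have "fsummable (\<lambda>i. f (i + n))"
    using fsummable_inj[OF assms, of "\<lambda>i. i + n"] by simp
  then show ?case using Suc fsum_Suc[of "\<lambda>i. f (i + n)"] by (simp add: add.assoc)
qed simp

lemma fsum_tail_dvd:
  assumes "\<And>i. fps_X ^ i dvd f i"
  shows "fps_X ^ n dvd fsum (\<lambda>i. f (i + n))"
proof (rule fsum_dvd)
  show "fps_X ^ n dvd f (i + n)" for i
    using assms[of "i + n"] le_imp_power_dvd[of n "i + n" fps_X] dvd_trans by (metis le_add2)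
qed

text \<open>The topological sum in the definition of \<open>v0\<close> and the coefficientwise one
  are limits of the same partial sums.\<close>

lemma fsum_v0_term: "fsum v0_term = Abs_fps v0"
proof -
  have "v0_term sums fsum v0_term"
    unfolding sums_def
  proof (rule tendsto_fpsI)
    fix m
    have "fps_nth (\<Sum>n<N. v0_term n) m = fps_nth (fsum v0_term) m" if "N > m" for N
    proof -
      have "fps_X ^ N dvd fsum v0_term - (\<Sum>n<N. v0_term n)"
        using fsum_tail_dvd[OF X_dvd_v0_term, of N] fsum_split_initial[OF fsummable_v0_term, of N]
        by simp
      then have "fps_nth (fsum v0_term - (\<Sum>n<N. v0_term n)) m = 0"
        using that by (auto simp: fps_X_power_mult_nth elim!: dvdE simp del: fps_sub_nth)
      then show ?thesis by simp
    qed
    then show "eventually (\<lambda>N. fps_nth (\<Sum>n<N. v0_term n) m = fps_nth (fsum v0_term) m) sequentially"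
      by (intro eventually_mono[OF eventually_gt_at_top[of m]])
  qed
  then show ?thesis using v0_term_sums sums_unique2 by blast
qed

lemma pser_0: "pser 0 = qprod (-1) 1 2 * Abs_fps v0"
proof -
  have "fps_X ^ J dvd pser 0 - qprod (-1) 1 2 * Abs_fps v0" for J
  proof -
    have "pser 0 - qprod (-1) 1 2 * Abs_fps v0 = fps_X ^ (J\<^sup>2) * qpoch (- fps_X) (fps_X\<^sup>2) J * pser J
        - qprod (-1) 1 2 * fsum (\<lambda>i. v0_term (i + J))"
      unfolding fsum_v0_term[symmetric]
      by (subst pser_iterate[of J], subst fsum_split_initial[OF fsummable_v0_term, of J])
        (simp add: algebra_simps)
    moreover have "(fps_X :: int fps) ^ J dvd fps_X ^ (J\<^sup>2)"
      by (intro le_imp_power_dvd) (simp add: power2_eq_square)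
    ultimately show ?thesis
      using fsum_tail_dvd[OF X_dvd_v0_term, of J] by (auto intro!: dvd_diff intro: dvd_mult dvd_mult2)
  qed
  then show ?thesis using fps_X_power_dvd_all_zero[of "pser 0 - qprod (-1) 1 2 * Abs_fps v0"] by simp
qed

definition v0_fps :: "int fps" where "v0_fps = Abs_fps v0"

lemma v0_fps_bilateral: "(v0_fps + neg v0_fps - 1) * dil 4 phim = (dil 2 phi) ^ 2"
proof -
  have "pser 0 = fsum pp" by (simp add: pser_def)
  then have P: "fsum pp = qprod (-1) 1 2 * v0_fps"
    using pser_0 by (simp add: v0_fps_def)
  have "neg (fsum pp) = fsum (\<lambda>n. (-1) ^ n * pp n)"
    by (simp add: neg_fsum neg_pp)
  moreover have "neg (qprod (-1) 1 2) = qprod 1 1 2"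
  proof -
    have "neg (ee n) * (-1) ^ n = ee n" for n
      by (simp add: neg_ee mult.commute mult.left_commute flip: power_mult_distrib)
    then show ?thesis
      by (simp add: qprod_def neg_fsum eterm_m1 neg_mult neg_power neg_uminus mult.commute)
  qed
  ultimately have N: "fsum (\<lambda>n. (-1) ^ n * pp n) = qprod 1 1 2 * neg v0_fps"
    using P by (simp add: neg_mult)
  have "qprod 1 1 2 * qprod (-1) 1 2 * (v0_fps + neg v0_fps - 1) = qprod 1 2 4 * theta 1 2 2"
    using bilateral_sum unfolding P N by (simp add: algebra_simps)
  then have "qprod (-1) 2 4 * (v0_fps + neg v0_fps - 1) = qprod 1 2 4 * theta 1 2 2"
    using qprod_plus_minus[of 1 2] by simp
  \<comment> \<open>The multiplier completes (q^2;q^4)_infinity on the left to phi(-q^4) and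
    (-q^2;q^4)_infinity on the right to phi(q^2).\<close>
  then have "qprod (-1) 2 4 * (v0_fps + neg v0_fps - 1) * (qprod 1 2 4 * qprod (-1) 4 4)
      = qprod 1 2 4 * theta 1 2 2 * (qprod 1 2 4 * qprod (-1) 4 4)"
    by (rule arg_cong)
  then have "(v0_fps + neg v0_fps - 1) * ((qprod 1 2 4 * qprod (-1) 2 4) * qprod (-1) 4 4)
      = (qprod 1 2 4 ^ 2 * qprod (-1) 4 4) * theta 1 2 2"
    by (simp only: power2_eq_square mult_ac)
  moreover have "qprod 1 2 4 ^ 2 * qprod (-1) 4 4 = dil 2 phi"
    using theta_phi_prod[of 2] by (simp add: dil_phi)
  moreover have "(qprod 1 2 4 * qprod (-1) 2 4) * qprod (-1) 4 4 = dil 4 phim"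
    using theta_phim_prod[of 4] qprod_plus_minus[of 2 4] qprod_self_split[of 4 "-1"]
    by (simp add: dil_phim power2_eq_square mult_ac)
  moreover have "theta 1 2 2 = dil 2 phi"
    by (simp add: dil_phi)
  ultimately show ?thesis by (simp only: power2_eq_square)
qed

lemma v0_even: "(2 * sec 2 0 v0_fps - 1) * dil 2 phim = phi ^ 2"
proof -
  have "v0_fps + neg v0_fps - 1 = dil 2 (2 * sec 2 0 v0_fps - 1)"
  proof -
    have "v0_fps + neg v0_fps = dil 2 (2 * sec 2 0 v0_fps)"
      by (rule fps_ext) (auto simp: dil_nth fps_numeral_fps_const elim!: evenE)
    then show ?thesis by (simp add: dil_diff)
  qed
  then have "dil 2 ((2 * sec 2 0 v0_fps - 1) * dil 2 phim) = dil 2 (phi ^ 2)"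
    using v0_fps_bilateral by (simp add: dil_mult dil_dil dil_power)
  then have "sec 2 0 (dil 2 ((2 * sec 2 0 v0_fps - 1) * dil 2 phim)) = sec 2 0 (dil 2 (phi ^ 2))"
    by (rule arg_cong)
  then show ?thesis by (simp add: sec_dil)
qed

lemma sec_1: "sec a 0 1 = 1" if "a > 0"
  using that by (auto simp: fps_eq_iff)

lemma sec_sec: "sec a r (sec b s f) = sec (b * a) (b * r + s) f"
  by (simp add: fps_eq_iff algebra_simps)

text \<open>Taking even exponents in \<open>v0_even\<close> turns phi(-q^2) into phi(-q) but leaves
  phi(q)^2 unchanged, by \<open>sec_phi_square\<close>.\<close>

lemma v0_4n: "(2 * sec 4 0 v0_fps - 1) * phim = phi ^ 2"
proof -
  have "sec 2 0 (dil 2 phim * (2 * sec 2 0 v0_fps - 1)) = phi ^ 2"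
    using v0_even sec_phi_square by (simp add: mult.commute)
  then show ?thesis
    by (simp add: sec_dil_mult sec_diff sec_numeral_mult sec_1 sec_sec mult.commute)
qed

section \<open>Dissections modulo powers of 2\<close>

lemma phim_nonzero: "phim \<noteq> 0"
proof -
  have eq: "phim = qprod (-1) 1 2 ^ 2 * qprod (-1) 2 2"
    using theta_phim_prod[of 1] by (simp add: phim_def)
  show ?thesis unfolding eq by (simp add: qprod_nonzero)
qed

text \<open>Before each section the identity is multiplied by a power of phi(q), which by
  \<open>phi_phim\<close> turns the denominator phi(-q)^k into a power of phi(-q^2); that is a
  series in q^2 and passes through the section. Odd exponents are taken once, then even ones twice:
  4(8n+1) = 32n+4.\<close>

lemma v0_8_dissection: "(2 * sec 32 4 v0_fps - 6 * psi) * phim ^ 8 = 1024 * fps_X * psi ^ 9"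
proof -
  define W0 where "W0 = 2 * sec 4 0 v0_fps - 1"
  define W1 where "W1 = sec 2 1 W0"
  define W2 where "W2 = sec 2 0 W1"
  define W3 where "W3 = sec 2 0 W2"
  define a b where "a = phi ^ 2" and "b = dil 2 (psi ^ 2)"
  have ab: "phi ^ 2 = dil 2 a + 4 * (fps_X * dil 2 b)"
    unfolding a_def b_def by (subst phi_square_dissect) (simp add: dil_dil mult.assoc)
  define P Y where "P = dil 2 phi" and "Y = dil 4 psi"
  have PY: "phi = dil 2 P + 2 * (fps_X * dil 2 Y)"
    unfolding P_def Y_def by (subst phi_dissect) (simp add: dil_dil mult.assoc)
  have "dil 2 (phim ^ 2) * W0 = phi * (W0 * phim)"
    by (simp add: dil_power phi_phim[symmetric] mult_ac)
  also have "\<dots> = phi ^ 3"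
    unfolding W0_def v0_4n by (simp add: power3_eq_cube power2_eq_square)
  also have "\<dots> = dil 2 (P ^ 3 + 12 * fps_X * P * Y ^ 2) + fps_X * dil 2 (6 * P ^ 2 * Y + 8 * fps_X * Y ^ 3)"
    unfolding PY by (simp add: dil_mult dil_add dil_power dil_X power3_eq_cube power2_eq_square algebra_simps)
  finally have "sec 2 1 (dil 2 (phim ^ 2) * W0)
      = sec 2 1 (dil 2 (P ^ 3 + 12 * fps_X * P * Y ^ 2) + fps_X * dil 2 (6 * P ^ 2 * Y + 8 * fps_X * Y ^ 3))"
    by (rule arg_cong)
  then have "phim ^ 2 * W1 = 6 * P ^ 2 * Y + 8 * fps_X * Y ^ 3"
    by (simp add: sec_dil_mult sec_add sec_dil sec_X_dil W1_def)
  also have "\<dots> = dil 2 (2 * dil 2 psi) * (3 * dil 2 a + 4 * (fps_X * dil 2 b))"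
    by (simp add: P_def Y_def a_def b_def dil_dil dil_mult dil_power power3_eq_cube power2_eq_square algebra_simps)
  finally have "phim ^ 2 * W1 * phi ^ 2
      = dil 2 (2 * dil 2 psi) * (3 * dil 2 a + 4 * (fps_X * dil 2 b)) * phi ^ 2"
    by (rule arg_cong)
  also have "phim ^ 2 * W1 * phi ^ 2 = (phi * phim) ^ 2 * W1"
    by (simp add: power2_eq_square mult_ac)
  also have "(phi * phim) ^ 2 = dil 2 (phim ^ 4)"
    unfolding phi_phim by (simp add: dil_power flip: power_mult)
  also have "dil 2 (2 * dil 2 psi) * (3 * dil 2 a + 4 * (fps_X * dil 2 b)) * phi ^ 2
      = dil 2 (2 * dil 2 psi) * (dil 2 (3 * a ^ 2 + 16 * fps_X * b ^ 2) + fps_X * dil 2 (16 * a * b))"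
    unfolding ab by (simp add: dil_mult dil_add dil_power dil_X power2_eq_square algebra_simps)
  finally have "sec 2 0 (dil 2 (phim ^ 4) * W1)
      = sec 2 0 (dil 2 (2 * dil 2 psi) * (dil 2 (3 * a ^ 2 + 16 * fps_X * b ^ 2) + fps_X * dil 2 (16 * a * b)))"
    by (rule arg_cong)
  then have "phim ^ 4 * W2 = 2 * dil 2 psi * (3 * a ^ 2 + 16 * fps_X * b ^ 2)"
    by (simp add: sec_dil_mult sec_add sec_dil sec_X_dil W2_def)
  \<comment> \<open>Jacobi's quartic identity trades phi(q)^4 for phi(-q)^4, so that 6 psi(q^2)
    splits off free of the denominator; 64 = 3 * 16 + 16.\<close>
  also have "3 * a ^ 2 + 16 * fps_X * b ^ 2 = 3 * phim ^ 4 + 64 * (fps_X * dil 2 (psi ^ 4))"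
  proof -
    have "a ^ 2 = phi ^ 4" "b ^ 2 = dil 2 (psi ^ 4)"
      by (simp_all add: a_def b_def dil_power flip: power_mult)
    then show ?thesis by (simp add: phi4_phim4)
  qed
  finally have W2: "phim ^ 4 * W2 = 2 * dil 2 psi * (3 * phim ^ 4 + 64 * (fps_X * dil 2 (psi ^ 4)))" .
  have "psi ^ 5 = psi * psi ^ 4"
    using power_Suc[of psi 4] by simp
  then have "dil 2 (psi ^ 5) = dil 2 psi * dil 2 (psi ^ 4)"
    by (simp add: dil_mult)
  then have "phim ^ 4 * (W2 - 6 * dil 2 psi) = 128 * (fps_X * dil 2 (psi ^ 5))"
    unfolding right_diff_distrib W2 by (simp add: algebra_simps)
  then have "phim ^ 4 * (W2 - 6 * dil 2 psi) * phi ^ 4 = 128 * (fps_X * dil 2 (psi ^ 5)) * phi ^ 4"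
    by (rule arg_cong)
  also have "phim ^ 4 * (W2 - 6 * dil 2 psi) * phi ^ 4 = (phi * phim) ^ 4 * (W2 - 6 * dil 2 psi)"
    by (simp add: power_mult_distrib mult_ac)
  also have "(phi * phim) ^ 4 = dil 2 (phim ^ 8)"
    unfolding phi_phim by (simp add: dil_power flip: power_mult)
  \<comment> \<open>With A and B the series a and b at q^2, only the cross term 8 q^2 A B of q (A +
    4qB)^2 has even exponents.\<close>
  also have "128 * (fps_X * dil 2 (psi ^ 5)) * phi ^ 4
      = dil 2 (128 * psi ^ 5) * (fps_X * dil 2 (a ^ 2 + 16 * fps_X * b ^ 2) + dil 2 (8 * (fps_X * a * b)))"
  proof -
    have "phi ^ 4 = (phi ^ 2) ^ 2" by (simp flip: power_mult)
    then show ?thesis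
      unfolding ab by (simp add: dil_mult dil_add dil_power dil_X power2_eq_square algebra_simps)
  qed
  finally have "sec 2 0 (dil 2 (phim ^ 8) * (W2 - 6 * dil 2 psi))
      = sec 2 0 (dil 2 (128 * psi ^ 5) * (fps_X * dil 2 (a ^ 2 + 16 * fps_X * b ^ 2) + dil 2 (8 * (fps_X * a * b))))"
    by (rule arg_cong)
  then have "phim ^ 8 * (W3 - 6 * psi) = 128 * psi ^ 5 * (8 * (fps_X * a * b))"
    by (simp add: sec_dil_mult sec_add sec_diff sec_dil sec_X_dil sec_numeral_mult W3_def)
  also have "fps_X * a * b = fps_X * psi ^ 4"
    unfolding a_def b_def psi_4 by (simp add: mult_ac)
  also have "128 * psi ^ 5 * (8 * (fps_X * psi ^ 4)) = 1024 * fps_X * psi ^ 9"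
  proof -
    have "psi ^ 9 = psi ^ 5 * psi ^ 4"
      using power_add[of psi 5 4] by simp
    then show ?thesis by simp
  qed
  finally have "(W3 - 6 * psi) * phim ^ 8 = 1024 * fps_X * psi ^ 9"
    by (simp add: mult.commute)
  moreover have "W3 = 2 * sec 32 4 v0_fps"
  proof -
    have "W3 = sec 8 1 W0" by (simp add: W1_def W2_def W3_def sec_sec)
    also have "\<dots> = 2 * sec 32 4 v0_fps - sec 8 1 1"
      by (simp add: W0_def sec_diff sec_numeral_mult sec_sec)
    also have "sec 8 1 (1 :: int fps) = 0" by (simp add: fps_eq_iff)
    finally show ?thesis by simp
  qed
  ultimately show ?thesis by simp
qed

lemma v0_32n_4: "sec 32 4 v0_fps = 3 * psi + 512 * (fps_X * (uu ^ 27 * phim))"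
proof -
  have "psi ^ 9 = uu ^ 27 * phim * phim ^ 8"
  proof -
    have "phim ^ 9 = phim * phim ^ 8"
      using power_Suc[of phim 8] by simp
    then show ?thesis
      unfolding psi_eq_uu power_mult_distrib by (simp add: mult.assoc flip: power_mult)
  qed
  then have "2 * (sec 32 4 v0_fps - 3 * psi) * phim ^ 8 = 2 * (512 * (fps_X * (uu ^ 27 * phim))) * phim ^ 8"
    using v0_8_dissection by (simp add: algebra_simps)
  then have "2 * (sec 32 4 v0_fps - 3 * psi) = 2 * (512 * (fps_X * (uu ^ 27 * phim)))"
    by (rule mult_right_cancel[THEN iffD1, rotated]) (simp add: phim_nonzero)
  moreover have "(2 :: int fps) \<noteq> 0" by simp
  ultimately have "sec 32 4 v0_fps - 3 * psi = 512 * (fps_X * (uu ^ 27 * phim))"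
    using mult_left_cancel by blast
  then show ?thesis by (simp add: algebra_simps)
qed

section \<open>Congruences modulo 27\<close>

definition fcong :: "int fps \<Rightarrow> int fps \<Rightarrow> int fps \<Rightarrow> bool" where
  "fcong m f g \<longleftrightarrow> m dvd f - g"

lemma fcong_refl [simp]: "fcong m f f"
  by (simp add: fcong_def)

lemma fcong_sym: "fcong m f g \<Longrightarrow> fcong m g f"
  unfolding fcong_def by (metis dvd_minus_iff minus_diff_eq)

lemma fcong_trans [trans]: "fcong m f g \<Longrightarrow> fcong m g h \<Longrightarrow> fcong m f h"
  unfolding fcong_def using dvd_add[of m "f - g" "g - h"] by simp

lemma fcong_add: "fcong m f g \<Longrightarrow> fcong m f' g' \<Longrightarrow> fcong m (f + f') (g + g')"
  unfolding fcong_def using dvd_add[of m "f - g" "f' - g'"] by (simp add: algebra_simps)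

lemma fcong_mult: "fcong m f g \<Longrightarrow> fcong m f' g' \<Longrightarrow> fcong m (f * f') (g * g')"
proof -
  assume "fcong m f g" "fcong m f' g'"
  moreover have "f * f' - g * g' = (f - g) * f' + g * (f' - g')" by (simp add: algebra_simps)
  ultimately show ?thesis unfolding fcong_def by simp
qed

lemma fcong_power: "fcong m f g \<Longrightarrow> fcong m (f ^ n) (g ^ n)"
  by (induction n) (simp_all add: fcong_mult)

lemma fcong_sec:
  assumes "fcong (numeral c) f g"
  shows "fcong (numeral c) (sec a r f) (sec a r g)"
proof -
  from assms obtain h where "f - g = numeral c * h" unfolding fcong_def by blast
  then have "sec a r f - sec a r g = numeral c * sec a r h"
    by (simp add: sec_diff[symmetric] sec_numeral_mult)
  then show ?thesis unfolding fcong_def by simp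
qed

lemma fcong_nth:
  assumes "fcong (numeral c) f g"
  shows "numeral c dvd fps_nth f n - fps_nth g n"
proof -
  from assms obtain h where "f - g = numeral c * h" unfolding fcong_def by blast
  then have "fps_nth (f - g) n = fps_nth (numeral c * h) n" by simp
  then show ?thesis by (simp add: fps_numeral_fps_const)
qed

lemma numeral_dvd_fps:
  assumes "\<And>n. numeral c dvd fps_nth (f :: int fps) n"
  shows "numeral c dvd f"
proof
  show "f = numeral c * Abs_fps (\<lambda>n. fps_nth f n div numeral c)"
    using assms by (intro fps_ext) (simp add: fps_numeral_fps_const)
qed

text \<open>Split off the constant term, f = c + q g. Cubing is additive modulo 3, c^3 is congruent
  to c, and q^3 moves the question for g three coefficients down, which drives the
  induction.\<close>

lemma fcong_cube_3: "fcong 3 (f ^ 3) (dil 3 f)"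
proof -
  have "3 dvd fps_nth (f ^ 3 - dil 3 f) n" for n
  proof (induction n arbitrary: f rule: less_induct)
    case (less n)
    define c g where "c = fps_nth f 0" and "g = fps_shift 1 f"
    have f: "f = fps_const c + fps_X * g"
      by (rule fps_ext) (simp add: c_def g_def)
    have dc: "dil 3 (fps_const c) = fps_const c"
      by (auto simp: fps_eq_iff dil_nth)
    have "f ^ 3 - dil 3 f = fps_const (c ^ 3 - c) + fps_X ^ 3 * (g ^ 3 - dil 3 g)
        + 3 * (fps_const c ^ 2 * fps_X * g + fps_const c * fps_X ^ 2 * g ^ 2)"
      unfolding f dil_add dc
      by (simp add: dil_mult dil_X power3_eq_cube power2_eq_square algebra_simps
          fps_const_sub[symmetric] fps_const_mult[symmetric] del: fps_const_sub fps_const_mult)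
    moreover have "3 dvd c ^ 3 - c"
    proof -
      have "c ^ 3 - c = (c - 1) * c * (c + 1)" by (simp add: algebra_simps power3_eq_cube)
      moreover have "3 dvd c - 1 \<or> 3 dvd c \<or> 3 dvd c + 1" by presburger
      ultimately show ?thesis by auto
    qed
    moreover have "3 dvd fps_nth (fps_X ^ 3 * (g ^ 3 - dil 3 g)) n"
      using less.IH[of "n - 3" g] by (simp add: fps_X_power_mult_nth)
    ultimately show ?case by (auto simp: fps_numeral_fps_const)
  qed
  then show ?thesis unfolding fcong_def by (rule numeral_dvd_fps)
qed

text \<open>Each cubing of a congruence gains a factor 3 in the modulus: 3, 9, 27.\<close>

lemma fcong_cube_lift:
  assumes "fcong 3 f g"
  shows "fcong 27 (f ^ 9) (g ^ 9)"
proof -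
  have cube: "\<exists>l. x ^ 3 = y ^ 3 + 3 * m * l" if "x = y + m * k" "m = 3 * m'" for x y m m' k :: "int fps"
    unfolding that
    by (rule exI[of _ "y ^ 2 * k + 3 * m' * y * k ^ 2 + 3 * m' ^ 2 * k ^ 3"])
      (simp add: power3_eq_cube power2_eq_square algebra_simps)
  from assms obtain k where "f - g = 3 * k" unfolding fcong_def by blast
  then have "f = g + 3 * k" by (simp add: algebra_simps)
  from cube[OF this, of 1] obtain l where l: "f ^ 3 = g ^ 3 + 9 * l" by auto
  from cube[OF l, of 3] obtain r where "(f ^ 3) ^ 3 = (g ^ 3) ^ 3 + 27 * r" by auto
  then show ?thesis unfolding fcong_def by (simp flip: power_mult)
qed

lemma fcong_uu27: "fcong 27 (uu ^ 27) (dil 3 (uu ^ 9))"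
  using fcong_cube_lift[OF fcong_cube_3[of uu]] by (simp add: dil_power flip: power_mult)

lemma sec_3_0_X: "sec 3 0 (fps_X * f) = fps_X * sec 3 2 f"
  and sec_3_1_X: "sec 3 1 (fps_X * f) = sec 3 0 f"
  and sec_3_2_X: "sec 3 2 (fps_X * f) = sec 3 1 f"
proof -
  have "3 * n - Suc 0 = 3 * (n - 1) + 2" if "n \<noteq> 0" for n :: nat
    using that by (cases n) simp_all
  then show "sec 3 0 (fps_X * f) = fps_X * sec 3 2 f"
    by (intro fps_ext) (simp add: One_nat_def)
  show "sec 3 1 (fps_X * f) = sec 3 0 f" by (rule fps_ext) (simp add: One_nat_def)
  show "sec 3 2 (fps_X * f) = sec 3 1 f" by (rule fps_ext) (simp flip: Suc_eq_plus1)
qed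

lemma sec_3_parts: "f = dil 3 (sec 3 0 f) + fps_X * dil 3 (sec 3 1 f) + fps_X ^ 2 * dil 3 (sec 3 2 f)"
proof (rule fps_eq_sec[of 3])
  fix r :: nat assume r: "r < 3"
  then consider "r = 0" | "r = 1" | "r = 2" by linarith
  then show "sec 3 r f = sec 3 r (dil 3 (sec 3 0 f) + fps_X * dil 3 (sec 3 1 f) + fps_X ^ 2 * dil 3 (sec 3 2 f))"
    by cases (simp_all add: sec_add sec_dil sec_X_dil sec_X_power_dil)
qed simp

text \<open>f is x(q^3) + 3k where k has no exponent divisible by 3. In the cube the term 9 x(q^3)^2
  k therefore drops out of the section, and the remaining ones carry the factor 27.\<close>

lemma fcong_sec_cube:
  assumes "fcong 3 f (dil 3 g)"
  shows "fcong 27 (sec 3 0 (f ^ 3)) (sec 3 0 f ^ 3)"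
proof -
  have "fcong 3 (sec 3 1 f) 0" "fcong 3 (sec 3 2 f) 0"
    using fcong_sec[OF assms, of 3 1] fcong_sec[OF assms, of 3 2] by (simp_all add: sec_dil)
  then obtain y z where yz: "sec 3 1 f = 3 * y" "sec 3 2 f = 3 * z"
    unfolding fcong_def by (metis diff_zero dvdE)
  define x where "x = sec 3 0 f"
  define k where "k = fps_X * dil 3 y + fps_X ^ 2 * dil 3 z"
  have "f = dil 3 x + 3 * k"
    by (subst sec_3_parts) (simp add: yz x_def k_def dil_mult algebra_simps)
  then have "f ^ 3 = dil 3 (x ^ 3) + 9 * (dil 3 (x ^ 2) * k) + 27 * (dil 3 x * k ^ 2 + k ^ 3)"
    by (simp add: dil_mult power3_eq_cube power2_eq_square algebra_simps)
  then have "sec 3 0 (f ^ 3) = x ^ 3 + 9 * (x ^ 2 * sec 3 0 k) + 27 * sec 3 0 (dil 3 x * k ^ 2 + k ^ 3)"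
    by (simp only: sec_add sec_numeral_mult sec_dil_mult sec_dil) simp
  also have "sec 3 0 k = 0"
    by (simp add: k_def sec_add sec_X_dil sec_X_power_dil)
  finally show ?thesis by (simp add: fcong_def x_def)
qed

lemma fps_unit_cancel:
  assumes "fps_nth (S :: int fps) 0 = 1" "fcong m (S * f) (S * g)"
  shows "fcong m f g"
proof -
  have "S * fps_right_inverse S 1 = 1"
    using assms(1) by (intro fps_right_inverse) simp
  moreover have "fcong m (fps_right_inverse S 1 * (S * f)) (fps_right_inverse S 1 * (S * g))"
    by (intro fcong_mult assms fcong_refl)
  ultimately show ?thesis by (simp add: mult.assoc[symmetric] mult.commute[of _ S])
qed

text \<open>The 3-dissection of phi(-q) times u^3: modulo 3 the factor -2 is 1 and u^3 is u(q^3),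
  which \<open>theta_m1_5\<close> merges with the theta function into psi(q^9). It serves to show
  that the denominator \<open>S\<close> in \<open>fcong_main\<close> is congruent to psi.\<close>

lemma fcong_psi: "fcong 3 psi (uu ^ 3 * phim ^ 9 + fps_X * psi ^ 9)"
proof -
  have nine: "fcong 3 (dil 9 f) (f ^ 9)" for f
  proof -
    have "fcong 3 (dil 3 (dil 3 f)) ((dil 3 f) ^ 3)" by (rule fcong_sym) (rule fcong_cube_3)
    also have "fcong 3 ((dil 3 f) ^ 3) ((f ^ 3) ^ 3)"
      by (intro fcong_power fcong_sym[OF fcong_cube_3])
    finally show ?thesis by (simp add: dil_dil flip: power_mult)
  qed
  let ?B = "theta (-1) 1 5"
  have "psi = uu ^ 3 * dil 9 phim + (-2) * fps_X * (uu ^ 3 * dil 3 ?B)"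
    unfolding psi_eq_uu by (subst phim_dissect) (simp add: algebra_simps)
  also have "fcong 3 (uu ^ 3 * dil 9 phim + (-2) * fps_X * (uu ^ 3 * dil 3 ?B))
      (uu ^ 3 * phim ^ 9 + 1 * fps_X * (dil 3 uu * dil 3 ?B))"
    by (intro fcong_add fcong_mult fcong_refl nine fcong_cube_3) (simp add: fcong_def)
  also have "dil 3 uu * dil 3 ?B = dil 9 psi"
    using theta_m1_5 by (simp add: dil_mult[symmetric] dil_dil mult.commute)
  also have "fcong 3 (uu ^ 3 * phim ^ 9 + 1 * fps_X * dil 9 psi) (uu ^ 3 * phim ^ 9 + 1 * fps_X * psi ^ 9)"
    by (intro fcong_add fcong_mult fcong_refl nine)
  finally show ?thesis by simp
qed

text \<open>Dissecting psi = u^3 phi(-q) gives three linear equations for the sections of u^3, with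
  solution x = u(1 + 12 q P^3/S). Modulo 27 its cube is u^3 (1 + 9 q P^3/S), where P^3/S matters
  only modulo 3; there S is psi and P^3 is psi(q^9), and multiplication by phi(-q) turns u^3 into
  psi.\<close>

lemma fcong_main: "fcong 27 (phim * sec 3 0 (uu ^ 9)) (psi + 9 * fps_X * dil 9 psi)"
proof -
  define x y z where "x = sec 3 0 (uu ^ 3)" and "y = sec 3 1 (uu ^ 3)" and "z = sec 3 2 (uu ^ 3)"
  define a A B P where "a = dil 3 phim" and "A = theta 1 1 2" and "B = theta (-1) 1 5" and "P = dil 3 psi"
  have phim: "phim = dil 3 a - 2 * (fps_X * dil 3 B)"
    unfolding a_def B_def by (subst phim_dissect) (simp add: dil_dil mult.assoc)
  have psi: "psi = dil 3 A + fps_X * dil 3 P"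
    unfolding P_def A_def by (subst psi_dissect) (simp add: dil_dil)
  have prod: "psi = dil 3 a * uu ^ 3 - 2 * (dil 3 B * (fps_X * uu ^ 3))"
    unfolding psi_eq_uu by (subst phim) (simp add: algebra_simps)
  have parts: "sec 3 r psi = a * sec 3 r (uu ^ 3) - 2 * (B * sec 3 r (fps_X * uu ^ 3))" if "r < 3" for r
    by (subst prod) (use that in \<open>simp add: sec_diff sec_numeral_mult sec_dil_mult\<close>)
  have parts': "sec 3 0 psi = A" "sec 3 1 psi = P" "sec 3 2 psi = 0"
    by (subst psi; simp add: sec_add sec_dil sec_X_dil)+
  have rel: "A = a * x - 2 * (B * (fps_X * z))" "P = a * y - 2 * (B * x)" "0 = a * z - 2 * (B * y)"
    using parts[of 0] parts[of 1] parts[of 2]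
    by (simp_all add: parts' x_def y_def z_def sec_3_0_X sec_3_1_X sec_3_2_X)
  have A: "A = uu * a" and B: "B * uu = P"
    unfolding A_def a_def B_def P_def by (rule theta_1_2 theta_m1_5)+
  \<comment> \<open>The linear system has determinant a^3 - 8 q B^3; multiplied by u^3 this becomes
    \<open>S\<close>, because B u = P.\<close>
  define S where "S = uu ^ 3 * a ^ 3 - 8 * fps_X * P ^ 3"
  have "x * (a ^ 3 - 8 * fps_X * B ^ 3) = A * a ^ 2 + 4 * fps_X * B ^ 2 * P"
  proof -
    have "A * a ^ 2 = x * a ^ 3 - 2 * fps_X * B * a * (a * z)"
      unfolding rel(1) by (simp add: algebra_simps power2_eq_square power3_eq_cube)
    also have "a * z = 2 * (B * y)" using rel(3) by simp
    also have "2 * fps_X * B * a * (2 * (B * y)) = 4 * fps_X * B ^ 2 * (a * y)"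
      by (simp add: algebra_simps power2_eq_square)
    also have "a * y = P + 2 * (B * x)" using rel(2) by simp
    finally show ?thesis by (simp add: algebra_simps power2_eq_square power3_eq_cube)
  qed
  then have "uu ^ 3 * (x * (a ^ 3 - 8 * fps_X * B ^ 3)) = uu ^ 3 * (A * a ^ 2 + 4 * fps_X * B ^ 2 * P)"
    by (rule arg_cong)
  then have "S * x = uu * (S + 12 * fps_X * P ^ 3)"
    unfolding A S_def B[symmetric] by (simp add: algebra_simps power2_eq_square power3_eq_cube)
  then have "S ^ 3 * x ^ 3 = uu ^ 3 * (S + 12 * fps_X * P ^ 3) ^ 3"
    by (metis power_mult_distrib)
  \<comment> \<open>Of the binomial coefficients times powers of 12, 36 is 9 modulo 27, while 432
    and 1728 are multiples of 27.\<close>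
  also have "\<dots> = S ^ 2 * (uu ^ 3 * (S + 9 * fps_X * P ^ 3))
      + 27 * (uu ^ 3 * (S ^ 2 * fps_X * P ^ 3 + 16 * S * (fps_X * P ^ 3) ^ 2 + 64 * (fps_X * P ^ 3) ^ 3))"
    by (simp add: algebra_simps power2_eq_square power3_eq_cube)
  finally have "fcong 27 (S ^ 2 * (S * x ^ 3)) (S ^ 2 * (uu ^ 3 * (S + 9 * fps_X * P ^ 3)))"
    unfolding fcong_def by (simp add: power2_eq_square power3_eq_cube mult.assoc)
  moreover have S0: "fps_nth S 0 = 1"
  proof -
    have "fps_nth uu 0 = 1"
      using qprod_cong_1[of 1 1 1] by (auto simp: uu_def elim!: dvdE dest!: arg_cong[of _ _ "\<lambda>f. fps_nth f 0"])
    moreover have "fps_nth phim 0 = 1"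
    proof -
      have "fps_nth (qprod (-1) 1 2) 0 = 1" "fps_nth (qprod (-1) 2 2) 0 = 1"
        using qprod_cong_1_weak[of 1 2 1 "-1"] qprod_cong_1_weak[of 2 2 1 "-1"]
        by (auto elim!: dvdE dest!: arg_cong[of _ _ "\<lambda>f. fps_nth f 0"])
      then show ?thesis
        using theta_phim_prod[of 1] by (simp add: phim_def fps_power_zeroth)
    qed
    ultimately show ?thesis by (simp add: S_def a_def dil_nth fps_power_zeroth)
  qed
  moreover have "fps_nth (S ^ 2) 0 = 1" using S0 by (simp add: fps_power_zeroth)
  ultimately have x3: "fcong 27 (S * x ^ 3) (uu ^ 3 * (S + 9 * fps_X * P ^ 3))"
    using fps_unit_cancel by blast
  \<comment> \<open>Both sides are congruent to psi^10 modulo 3: P^3 and psi(q^9) to psi^9, and S to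
    psi by \<open>fcong_psi\<close>.\<close>
  have "fcong 3 (psi * P ^ 3) (dil 9 psi * S)"
  proof -
    have P3: "fcong 3 P (psi ^ 3)" and a3: "fcong 3 a (phim ^ 3)"
      unfolding P_def a_def by (rule fcong_sym, rule fcong_cube_3)+
    have P9: "fcong 3 (P ^ 3) (psi ^ 9)"
      using fcong_power[OF P3, of 3] by (simp flip: power_mult)
    have "fcong 3 (dil 9 psi) (P ^ 3)"
      using fcong_sym[OF fcong_cube_3[of P]] by (simp add: P_def dil_dil)
    then have psi9: "fcong 3 (dil 9 psi) (psi ^ 9)" using P9 by (rule fcong_trans)
    have "fcong 3 (dil 9 psi * S) (psi ^ 9 * S)"
      by (intro fcong_mult psi9 fcong_refl)
    also have "psi ^ 9 * S = psi ^ 9 * (uu ^ 3 * a ^ 3 + (-8) * fps_X * P ^ 3)" by (simp add: S_def)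
    also have "fcong 3 (psi ^ 9 * (uu ^ 3 * a ^ 3 + (-8) * fps_X * P ^ 3))
        (psi ^ 9 * (uu ^ 3 * (phim ^ 3) ^ 3 + 1 * fps_X * psi ^ 9))"
      by (intro fcong_mult fcong_add fcong_refl fcong_power a3 P9) (simp add: fcong_def dvdI[of 9 3 3])
    also have "psi ^ 9 * (uu ^ 3 * (phim ^ 3) ^ 3 + 1 * fps_X * psi ^ 9)
        = psi ^ 9 * (uu ^ 3 * phim ^ 9 + fps_X * psi ^ 9)"
      by (simp flip: power_mult)
    also have "fcong 3 (psi ^ 9 * (uu ^ 3 * phim ^ 9 + fps_X * psi ^ 9)) (psi ^ 9 * psi)"
      by (intro fcong_mult fcong_refl fcong_sym[OF fcong_psi])
    also have "fcong 3 (psi ^ 9 * psi) (P ^ 3 * psi)"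
      by (intro fcong_mult fcong_refl fcong_sym[OF P9])
    finally show ?thesis unfolding mult.commute[of "P ^ 3"] by (rule fcong_sym)
  qed
  then obtain k where k: "psi * P ^ 3 = dil 9 psi * S + 3 * k"
    unfolding fcong_def by (auto elim!: dvdE simp: algebra_simps)
  have "fcong 27 (S * (phim * x ^ 3)) (phim * (uu ^ 3 * (S + 9 * fps_X * P ^ 3)))"
    using fcong_mult[OF fcong_refl[of 27 phim] x3] by (simp add: mult_ac)
  also have "phim * (uu ^ 3 * (S + 9 * fps_X * P ^ 3)) = psi * S + 9 * fps_X * (psi * P ^ 3)"
    unfolding psi_eq_uu by (simp add: algebra_simps)
  also have "\<dots> = S * (psi + 9 * fps_X * dil 9 psi) + 27 * (fps_X * k)"
    unfolding k by (simp add: algebra_simps)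
  also have "fcong 27 \<dots> (S * (psi + 9 * fps_X * dil 9 psi))"
    by (simp add: fcong_def)
  finally have "fcong 27 (phim * x ^ 3) (psi + 9 * fps_X * dil 9 psi)"
    by (rule fps_unit_cancel[OF S0])
  moreover have "fcong 27 (phim * sec 3 0 (uu ^ 9)) (phim * x ^ 3)"
    using fcong_mult[OF fcong_refl fcong_sec_cube[OF fcong_cube_3[of uu]], of phim]
    by (simp add: x_def flip: power_mult)
  ultimately show ?thesis using fcong_trans by blast
qed

text \<open>Two sections modulo 3. In the first, u(q^3)^9 passes through and phi(-q) becomes
  phi(-q^3), since 9 divides every square divisible by 3; in the second, phi(-q^3) passes
  through.\<close>

lemma fcong_sec_9: "fcong 27 (sec 9 0 (uu ^ 27 * phim)) (psi + 9 * fps_X * dil 9 psi)"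
proof -
  have sec_phim: "sec 3 0 phim = dil 3 phim"
  proof -
    have "phim = dil 3 (dil 3 phim) - 2 * (fps_X * dil 3 (theta (-1) 1 5))"
      by (subst phim_dissect) (simp add: dil_dil mult.assoc)
    then have "sec 3 0 phim = sec 3 0 (dil 3 (dil 3 phim) - 2 * (fps_X * dil 3 (theta (-1) 1 5)))"
      by (rule arg_cong)
    then show ?thesis by (simp add: sec_diff sec_numeral_mult sec_X_dil sec_dil)
  qed
  have "fcong 27 (sec 3 0 (uu ^ 27 * phim)) (sec 3 0 (dil 3 (uu ^ 9) * phim))"
    by (intro fcong_sec fcong_mult fcong_uu27 fcong_refl)
  also have "sec 3 0 (dil 3 (uu ^ 9) * phim) = dil 3 phim * uu ^ 9"
    using sec_dil_mult[of 0 3 "uu ^ 9" phim] by (simp add: sec_phim mult.commute)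
  finally have "fcong 27 (sec 3 0 (sec 3 0 (uu ^ 27 * phim))) (sec 3 0 (dil 3 phim * uu ^ 9))"
    by (rule fcong_sec)
  then have "fcong 27 (sec 9 0 (uu ^ 27 * phim)) (phim * sec 3 0 (uu ^ 9))"
    by (simp add: sec_sec sec_dil_mult)
  then show ?thesis using fcong_main by (rule fcong_trans)
qed

section \<open>Triangular numbers and the arithmetic progressions\<close>

lemma psi_nth_nonzero:
  assumes "fps_nth psi n \<noteq> 0"
  obtains m :: nat where "8 * n + 1 = m\<^sup>2"
proof -
  have "\<exists>m::int. nat (m * (2 * m - 1)) = n"
  proof (rule ccontr)
    assume "\<nexists>m::int. nat (m * (2 * m - 1)) = n"
    then have "fps_nth (fps_X ^ nat (m * (2 * m - 1)) :: int fps) n = 0" for m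
      by (auto simp: fps_X_power_nth)
    then show False using assms by (simp add: psi_fsum fsum_def)
  qed
  then obtain m :: int where "nat (m * (2 * m - 1)) = n" by blast
  then have "int n = m * (2 * m - 1)"
    using mult_pred_nonneg[of 1 2 m] by (metis int_nat_eq zero_le_one one_le_numeral)
  then have "int (8 * n + 1) = (4 * m - 1)\<^sup>2"
    by (simp add: power2_eq_square algebra_simps)
  also have "\<dots> = int ((nat \<bar>4 * m - 1\<bar>)\<^sup>2)" by simp
  finally have "8 * n + 1 = (nat \<bar>4 * m - 1\<bar>)\<^sup>2" by (simp only: of_nat_eq_iff)
  then show thesis by (rule that)
qed

text \<open>36(8n+1) = 32(9n+1) + 4, so psi contributes at the exponents 9n+1, n and, if 9 divides
  n-1, (n-1)/9. The associated numbers 9(8n+1), 8n+1 and (8n+1)/9 are squares only if 8n+1 is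
  one.\<close>

lemma v0_cong:
  assumes nosq: "\<And>m::nat. 8 * n + 1 \<noteq> m\<^sup>2"
  shows "[v0 (36 * (8 * n + 1)) = 0] (mod 27)"
proof -
  have 0: "fps_nth psi n = 0"
    using psi_nth_nonzero nosq by metis
  have 1: "fps_nth (fps_X * dil 9 psi) n = 0"
  proof (rule ccontr)
    assume "fps_nth (fps_X * dil 9 psi) n \<noteq> 0"
    then have n: "n \<noteq> 0" "9 dvd n - 1" "fps_nth psi ((n - 1) div 9) \<noteq> 0"
      by (auto simp: dil_nth One_nat_def split: if_splits)
    then obtain t where t: "n - 1 = 9 * t" by blast
    with n(3) obtain m where "8 * t + 1 = m\<^sup>2" by (auto elim: psi_nth_nonzero)
    moreover have "8 * n + 1 = 9 * (8 * t + 1)" using t n(1) by simp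
    ultimately have "8 * n + 1 = (3 * m)\<^sup>2" by (simp add: power2_eq_square)
    then show False using nosq by blast
  qed
  have 2: "fps_nth psi (9 * n + 1) = 0"
  proof (rule ccontr)
    assume "fps_nth psi (9 * n + 1) \<noteq> 0"
    then obtain m where m: "8 * (9 * n + 1) + 1 = m\<^sup>2" by (rule psi_nth_nonzero)
    then have *: "9 * (8 * n + 1) = m\<^sup>2" by simp
    then have "m\<^sup>2 = 3 * (3 * (8 * n + 1))" by simp
    then have "3 dvd m\<^sup>2" by (rule dvdI)
    then have "3 dvd m" using prime_dvd_power[of "3::nat" m 2] by simp
    then obtain l where "m = 3 * l" by blast
    with * have "8 * n + 1 = l\<^sup>2" by (simp add: power2_eq_square)
    then show False using nosq by blast
  qed
  have "v0 (36 * (8 * n + 1)) = fps_nth (sec 32 4 v0_fps) (9 * n + 1)"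
    by (simp add: v0_fps_def algebra_simps)
  also have "\<dots> = 512 * fps_nth (sec 9 0 (uu ^ 27 * phim)) n"
    unfolding v0_32n_4 using 2 by (simp add: fps_numeral_fps_const)
  finally have "v0 (36 * (8 * n + 1)) = 512 * fps_nth (sec 9 0 (uu ^ 27 * phim)) n" .
  moreover have "27 dvd fps_nth (sec 9 0 (uu ^ 27 * phim)) n"
  proof -
    have "fps_nth (psi + 9 * fps_X * dil 9 psi) n = fps_nth psi n + 9 * fps_nth (fps_X * dil 9 psi) n"
      unfolding mult.assoc by (simp only: fps_numeral_fps_const fps_add_nth fps_mult_left_const_nth)
    then show ?thesis
      using fcong_nth[OF fcong_sec_9, of n] 0 1 by simp
  qed
  ultimately show ?thesis by (simp add: cong_0_iff)
qed

lemma not_square: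
  fixes k m :: nat
  assumes "k mod 3 = 2 \<or> k mod 9 = 3 \<or> k mod 9 = 6"
  shows "k \<noteq> m\<^sup>2"
proof
  assume k: "k = m\<^sup>2"
  have "m mod 9 < 9" by simp
  then have "m mod 9 \<in> set [0..<9]" by simp
  then have "(m mod 9)\<^sup>2 mod 9 \<in> {0, 1, 4, 7}"
    by (auto simp: upt_rec power2_eq_square)
  then have "k mod 9 \<in> {0, 1, 4, 7}" by (simp add: k power_mod)
  moreover have "k mod 9 mod 3 = k mod 3" by (rule mod_mod_cancel) simp
  ultimately show False using assms by auto
qed

theorem theorem5p4:
  fixes n :: nat
  shows "[v0 (3 ^ 2 * (96 * n + 68)) = 0] (mod 27) \<and>
         [v0 (3 ^ 3 * (96 * n + 44)) = 0] (mod 27) \<and>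
         [v0 (3 ^ 3 * (96 * n + 76)) = 0] (mod 27)"
proof (intro conjI)
  \<comment> \<open>3^2 (96n+68) = 36(24n+17) with 24n+17 = 8(3n+2)+1. In the same way 3^3 (96n+44)
    = 36(72n+33) and 3^3 (96n+76) = 36(72n+57) lead to 9n+4 and 9n+7 below.\<close>
  have "(8 * (3 * n + 2) + 1) mod 3 = 2"
    using mod_mult_self3[of "8 * n + 5" 3 2] by (simp add: algebra_simps)
  then show "[v0 (3 ^ 2 * (96 * n + 68)) = 0] (mod 27)"
    using v0_cong[of "3 * n + 2"] not_square by (simp add: algebra_simps)
  have "(8 * (9 * n + 4) + 1) mod 9 = 6"
    using mod_mult_self3[of "8 * n + 3" 9 6] by (simp add: algebra_simps)
  then show "[v0 (3 ^ 3 * (96 * n + 44)) = 0] (mod 27)"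
    using v0_cong[of "9 * n + 4"] not_square by (simp add: algebra_simps)
  have "(8 * (9 * n + 7) + 1) mod 9 = 3"
    using mod_mult_self3[of "8 * n + 6" 9 3] by (simp add: algebra_simps)
  then show "[v0 (3 ^ 3 * (96 * n + 76)) = 0] (mod 27)"
    using v0_cong[of "9 * n + 7"] not_square by (simp add: algebra_simps)
qed

end
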